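(* Let $\sigma=2$, $\tau>1$ and $\mu>0$, and let $K_\tau$, $\mu^\star=\sqrt{3/K_\tau}$ and $\mathcal E_0(\mu)$ be as defined in the context. Then: (1) $$\mathcal E_0(\mu)=\begin{cases}0 & \text{if } 0<\mu\le\mu^\star,\\ -\infty & \text{if } \mu>\mu^\star.\end{cases}$$ (2) Ground States of $E_0$ at mass $\mu$ exist if and only if $\mu=\mu^\star$, and they are optimizers of the Gagliardo–Nirenberg inequality $$\|u\|_{L^6(\mathbb R)}^6\le K_\tau\left(\|u'\|_{L^2(\mathbb R^-)}^2+\|u'\|_{L^2(\mathbb R^+)}^2\right)\|u\|_{L^2(\mathbb R)}^4,\qquad u\in\mathcal D^\tau$$ (i.e. they attain equality in it). Moreover $$\mu^\star=\frac{\sqrt3}{2}\left(\frac{\pi}{2}+2\arcsin\left(\frac{1}{\sqrt{1+\tau^4}}\right)\right).$$ (3) Further positive stationary states of $E_0$ at mass $\mu$ (that is, positive stationary states which are not Ground States) exist if and only if $\mu=\widetilde\mu$, where $$\widetilde\mu=\frac{\sqrt3}{2}\left(\frac{3\pi}{2}-2\arcsin\left(\frac{1}{\sqrt{1+\tau^4}}\right)\right).$$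
   Context: Write $\mathbb R^-=(-\infty,0)$, $\mathbb R^+=(0,+\infty)$. For $\tau>1$ let $$\mathcal D^\tau=\{u\in H^1(\mathbb R^-)\oplus H^1(\mathbb R^+): u(0^+)=\tau u(0^-)\}$$ (complex-valued functions on $\mathbb R\setminus\{0\}$), and for $\mu>0$ let $\mathcal D^\tau_\mu=\{u\in\mathcal D^\tau:\|u\|_{L^2(\mathbb R)}^2=\mu\}$; $\|u\|_{L^2(\mathbb R)}^2$ is the mass of $u$. With $\sigma=2$ and $\alpha=0$ the energy is, for $u\in\mathcal D^\tau$, $$E_0(u)=\frac12\left(\|u'\|_{L^2(\mathbb R^-)}^2+\|u'\|_{L^2(\mathbb R^+)}^2\right)-\frac16\|u\|_{L^{6}(\mathbb R)}^{6},$$ and $\mathcal E_0(\mu)=\inf\{E_0(v): v\in\mathcal D^\tau_\mu\}$. The optimal Gagliardo–Nirenberg constant is $$K_\tau=\sup_{u\in\mathcal D^\tau\setminus\{0\}}\frac{\|u\|_{L^6(\mathbb R)}^6}{\left(\|u'\|_{L^2(\mathbb R^-)}^2+\|u'\|_{L^2(\mathbb R^+)}^2\right)\|u\|_{L^2(\mathbb R)}^4},$$ and $\mu^\star:=\sqrt{3/K_\tau}$. A Ground State of $E_0$ at mass $\mu$ is a nonnegative minimizer of $E_0$ on $\mathcal D^\tau_\mu$. A stationary state of $E_0$ at mass $\mu$ is a critical point of $E_0$ constrained to $\mathcal D^\tau_\mu$, i.e. $u\in\mathcal D^\tau_\mu$ such that the differential of $E_0$ at $u$ (with $\mathcal D^\tau$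 regarded as a real Hilbert space with the $H^1(\mathbb R^-)\oplus H^1(\mathbb R^+)$ norm) vanishes on every $\eta\in\mathcal D^\tau$ with $\mathrm{Re}\int_{\mathbb R}u\,\overline{\eta}\,dx=0$. *)

theory Defs
  imports "HOL-Analysis.Analysis"
begin

text \<open>
  Lebesgue and Sobolev functions are represented by honest functions \<open>real \<Rightarrow> complex\<close>; every notion
  below depends on such a function only up to equality almost everywhere. A function on
  \<open>\<real> \<setminus> {0}\<close> is given an irrelevant value at \<open>0\<close>.
\<close>

abbreviation Rminus :: "real set" where "Rminus \<equiv> {..<0}"
abbreviation Rplus :: "real set" where "Rplus \<equiv> {0<..}"

section \<open>Lebesgue and Sobolev spaces\<close>

definition L2 :: "real set \<Rightarrow> (real \<Rightarrow> complex) set" where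
  "L2 I = {u. set_borel_measurable lebesgue I u \<and>
              set_integrable lebesgue I (\<lambda>x. (norm (u x))\<^sup>2)}"

text \<open>The Bochner integral of a non-integrable function is \<open>0\<close>, so \<open>Lp_norm\<close> is the norm only on
  \<open>L\<^sup>p\<close>. It is used with \<open>p = 2\<close> and, on the Sobolev space below (which embeds into \<open>L\<^sup>6\<close>),
  with \<open>p = 6\<close>.\<close>

definition Lp_norm :: "real \<Rightarrow> real set \<Rightarrow> (real \<Rightarrow> complex) \<Rightarrow> real" where
  "Lp_norm p I u = (LINT x:I|lebesgue. norm (u x) powr p) powr (1 / p)"

definition locally_integrable :: "real set \<Rightarrow> (real \<Rightarrow> complex) \<Rightarrow> bool" where
  "locally_integrable I u \<longleftrightarrow> (\<forall>K. compact K \<and> K \<subseteq> I \<longrightarrow> set_integrable lebesgue K u)"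

text \<open>Compactly supported \<open>C\<^sup>1\<close> functions on the open set \<open>I\<close>, extended by zero. Testing against
  \<open>C\<^sup>1\<close> instead of smooth functions follows Brezis (Functional Analysis, Sobolev Spaces and PDE,
  Section 8.2) and yields the same weak derivatives.\<close>

definition test_functions :: "real set \<Rightarrow> (real \<Rightarrow> real) set" where
  "test_functions I = {\<phi>. \<phi> C1_differentiable_on UNIV \<and>
      (\<exists>K. compact K \<and> K \<subseteq> I \<and> (\<forall>x. x \<notin> K \<longrightarrow> \<phi> x = 0))}"

definition is_weak_deriv :: "real set \<Rightarrow> (real \<Rightarrow> complex) \<Rightarrow> (real \<Rightarrow> complex) \<Rightarrow> bool" where
  "is_weak_deriv I u g \<longleftrightarrow> locally_integrable I u \<and> locally_integrable I g \<and>
     (\<forall>\<phi>\<in>test_functions I.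
        (LINT x:I|lebesgue. deriv \<phi> x *\<^sub>R u x) = - (LINT x:I|lebesgue. \<phi> x *\<^sub>R g x))"

text \<open>Weak derivatives on open sets are unique up to null sets; the choice is immaterial.\<close>

definition weak_deriv :: "real set \<Rightarrow> (real \<Rightarrow> complex) \<Rightarrow> real \<Rightarrow> complex" where
  "weak_deriv I u = (SOME g. is_weak_deriv I u g)"

definition H1 :: "real set \<Rightarrow> (real \<Rightarrow> complex) set" where
  "H1 I = {u \<in> L2 I. \<exists>g\<in>L2 I. is_weak_deriv I u g}"

text \<open>The representative continuous on \<open>\<real> \<setminus> {0}\<close>; for functions that are \<open>H\<^sup>1\<close> on both half-lines
  it exists, is unique off \<open>0\<close>, and has one-sided limits at \<open>0\<close>.\<close>

definition cont_rep :: "(real \<Rightarrow> complex) \<Rightarrow> real \<Rightarrow> complex" where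
  "cont_rep u = (SOME v. continuous_on (- {0}) v \<and> (AE x in lebesgue. u x = v x))"

definition trace_left :: "(real \<Rightarrow> complex) \<Rightarrow> complex" where
  "trace_left u = Lim (at_left 0) (cont_rep u)"

definition trace_right :: "(real \<Rightarrow> complex) \<Rightarrow> complex" where
  "trace_right u = Lim (at_right 0) (cont_rep u)"

definition Dspace :: "real \<Rightarrow> (real \<Rightarrow> complex) set" where
  "Dspace \<tau> = {u. u \<in> H1 Rminus \<and> u \<in> H1 Rplus \<and> trace_right u = of_real \<tau> * trace_left u}"

definition Dmass :: "real \<Rightarrow> real \<Rightarrow> (real \<Rightarrow> complex) set" where
  "Dmass \<tau> \<mu> = {u \<in> Dspace \<tau>. (Lp_norm 2 UNIV u)\<^sup>2 = \<mu>}"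

section \<open>Energy and Gagliardo--Nirenberg constant\<close>

definition grad_sq :: "(real \<Rightarrow> complex) \<Rightarrow> real" where
  "grad_sq u = (Lp_norm 2 Rminus (weak_deriv Rminus u))\<^sup>2 + (Lp_norm 2 Rplus (weak_deriv Rplus u))\<^sup>2"

definition E0 :: "(real \<Rightarrow> complex) \<Rightarrow> real" where
  "E0 u = 1 / 2 * grad_sq u - 1 / 6 * (Lp_norm 6 UNIV u) ^ 6"

definition inf_energy :: "real \<Rightarrow> real \<Rightarrow> ereal" where
  "inf_energy \<tau> \<mu> = (INF v\<in>Dmass \<tau> \<mu>. ereal (E0 v))"

definition K_GN :: "real \<Rightarrow> real" where
  "K_GN \<tau> = (SUP u\<in>{u \<in> Dspace \<tau>. \<not> (AE x in lebesgue. u x = 0)}.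
     (Lp_norm 6 UNIV u) ^ 6 / (grad_sq u * (Lp_norm 2 UNIV u) ^ 4))"

definition mu_star :: "real \<Rightarrow> real" where
  "mu_star \<tau> = sqrt (3 / K_GN \<tau>)"

section \<open>Ground states and stationary states\<close>

definition nonneg_fun :: "(real \<Rightarrow> complex) \<Rightarrow> bool" where
  "nonneg_fun u \<longleftrightarrow> (\<forall>x. x \<noteq> 0 \<longrightarrow> Im (cont_rep u x) = 0 \<and> Re (cont_rep u x) \<ge> 0)"

definition positive_fun :: "(real \<Rightarrow> complex) \<Rightarrow> bool" where
  "positive_fun u \<longleftrightarrow> (\<forall>x. x \<noteq> 0 \<longrightarrow> Im (cont_rep u x) = 0 \<and> Re (cont_rep u x) > 0)"

definition ground_state :: "real \<Rightarrow> real \<Rightarrow> (real \<Rightarrow> complex) \<Rightarrow> bool" where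
  "ground_state \<tau> \<mu> u \<longleftrightarrow> u \<in> Dmass \<tau> \<mu> \<and> nonneg_fun u \<and> (\<forall>v\<in>Dmass \<tau> \<mu>. E0 u \<le> E0 v)"

definition H1_norm :: "(real \<Rightarrow> complex) \<Rightarrow> real" where
  "H1_norm u = sqrt ((Lp_norm 2 UNIV u)\<^sup>2 + grad_sq u)"

text \<open>\<open>L\<close> is the Frechet differential at \<open>u\<close> of \<open>F\<close> on the real Hilbert space
  \<open>(Dspace \<tau>, H1_norm)\<close>. Since \<open>Dspace \<tau>\<close> is a set of representatives and not a type,
  \<open>has_derivative\<close> does not apply and its definition is spelled out.\<close>

definition has_differential ::
    "real \<Rightarrow> ((real \<Rightarrow> complex) \<Rightarrow> real) \<Rightarrow> ((real \<Rightarrow> complex) \<Rightarrow> real) \<Rightarrow> (real \<Rightarrow> complex) \<Rightarrow> bool" where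
  "has_differential \<tau> F L u \<longleftrightarrow>
     (\<forall>v\<in>Dspace \<tau>. \<forall>w\<in>Dspace \<tau>. L (\<lambda>x. v x + w x) = L v + L w) \<and>
     (\<forall>c::real. \<forall>v\<in>Dspace \<tau>. L (\<lambda>x. c *\<^sub>R v x) = c * L v) \<and>
     (\<exists>C. \<forall>v\<in>Dspace \<tau>. \<bar>L v\<bar> \<le> C * H1_norm v) \<and>
     (\<forall>\<epsilon>>0. \<exists>\<delta>>0. \<forall>h\<in>Dspace \<tau>. H1_norm h < \<delta> \<longrightarrow>
        \<bar>F (\<lambda>x. u x + h x) - F u - L h\<bar> \<le> \<epsilon> * H1_norm h)"

definition stationary_state :: "real \<Rightarrow> real \<Rightarrow> (real \<Rightarrow> complex) \<Rightarrow> bool" where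
  "stationary_state \<tau> \<mu> u \<longleftrightarrow> u \<in> Dmass \<tau> \<mu> \<and>
     (\<exists>L. has_differential \<tau> E0 L u \<and>
        (\<forall>\<eta>\<in>Dspace \<tau>. Re (LINT x|lebesgue. u x * cnj (\<eta> x)) = 0 \<longrightarrow> L \<eta> = 0))"

end

theory Submission
  imports Defs
begin

text \<open>Reflecting the left half turns \<open>u\<close> into two functions on \<open>(0, \<infinity>)\<close> that are coupled only through
  their values at \<open>0\<close>. In the mass coordinate \<open>s(x) = \<integral>\<^sub>0\<^sup>x \<bar>u\<bar>\<^sup>2\<close> the energy density of
  \<open>\<rho> = \<bar>u\<bar>\<^sup>2\<close> becomes \<open>(\<rho>\<^sub>s\<^sup>2 - (4/3) \<rho>\<^sup>2) / 8\<close>, which is quadratic. Adding the exact derivative of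
  \<open>cot (A - 2 s / \<surd>3) \<rho>\<^sup>2\<close> completes the square, so a half-line of mass \<open>m\<close> has energy at least a
  multiple of \<open>cot A \<rho>(0)\<^sup>2\<close> whenever \<open>2 m / \<surd>3 < A < \<pi>\<close>; together with the jump condition the
  choice \<open>A\<^sub>1 + A\<^sub>2 = \<pi>/2 + 2 arcsin (1 / \<surd>(1 + \<tau>\<^sup>4))\<close> makes the total nonnegative and gives the
  critical mass. By scaling, this is the sharp Gagliardo--Nirenberg inequality.

  A positive stationary state solves \<open>u'' = \<lambda> u - u\<^sup>5\<close> on both sides with \<open>u'(0\<^sup>-) = \<tau> u'(0\<^sup>+)\<close>. The
  first integral and the two conditions at \<open>0\<close> determine \<open>u'/(\<surd>\<lambda> u)\<close> at \<open>0\<close> up to a common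
  sign, the arccosine of \<open>u'/(\<surd>\<lambda> u)\<close> grows at the rate \<open>2 u\<^sup>2 / \<surd>3\<close>, and hence the mass takes one
  of two values. All of these states have energy zero, so those of critical mass are ground states.\<close>

text \<open>How the mass is divided between the two half-lines is not known in advance, so the
  boundary terms must have a nonnegative sum for every pair of angles A1, A2 with a given sum S. The
  jump weights them to cot A1 + \<tau>^4 cot A2, which has the sign of (1 + \<tau>^4) sin S +
  (\<tau>^4 - 1) sin (A1 - A2). The largest admissible S in (pi/2, pi) therefore solves (1 +
  \<tau>^4) sin S = \<tau>^4 - 1, and this is the origin of the arcsine in the critical mass.
  Equality requires A2 = A1 + pi/2, which is how the ground state soliton divides its mass.

  The cotangent blows up when its argument reaches 0, so each angle has to exceed 2 m / sqrt 3
  strictly. The comparison thus works only strictly below the critical mass, and the critical case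
  comes from rescaling the amplitude and passing to the limit. No compactness of minimizing
  sequences enters: the explicit solitons show that the constant is attained.\<close>

section \<open>Indefinite integrals on the closed half-line\<close>

text \<open>Local absolute continuity as a property of a pair: \<open>g\<close> matters only up to
  null sets and no pointwise derivative is claimed, whereas \<open>f\<close> is fixed at every point
  of the closed half-line, so that \<open>f 0\<close> can serve as the trace.\<close>

definition indef_int :: "(real \<Rightarrow> 'a::euclidean_space) \<Rightarrow> (real \<Rightarrow> 'a) \<Rightarrow> bool" where
  "indef_int f g \<longleftrightarrow> (\<forall>b\<ge>0. g absolutely_integrable_on {0..b} \<and> f b = f 0 + integral {0..b} g)"

lemma indef_intD:
  assumes "indef_int f g"
  shows "b \<ge> 0 \<Longrightarrow> g absolutely_integrable_on {0..b}"
    and "b \<ge> 0 \<Longrightarrow> f b = f 0 + integral {0..b} g"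
  using assms unfolding indef_int_def by blast+

lemma indef_int_abs_integrable:
  assumes "indef_int f g" "0 \<le> x"
  shows "g absolutely_integrable_on {x..y}"
proof (cases "x \<le> y")
  case True
  then show ?thesis
    using assms(2)
    by (intro absolutely_integrable_on_subinterval[OF indef_intD(1)[OF assms(1), of y]]) auto
qed auto

lemma indef_int_diff:
  assumes "indef_int f g" "0 \<le> x" "x \<le> y"
  shows "f y - f x = integral {x..y} g"
proof -
  have "g integrable_on {0..y}"
    using indef_int_abs_integrable[OF assms(1), of 0 y]
    by (auto intro: set_lebesgue_integral_eq_integral)
  then have "integral {0..x} g + integral {x..y} g = integral {0..y} g"
    using assms by (intro Henstock_Kurzweil_Integration.integral_combine) auto
  then show ?thesis
    using indef_intD(2)[OF assms(1), of x] indef_intD(2)[OF assms(1), of y] assms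
    by (simp add: algebra_simps)
qed

lemma indef_int_continuous:
  assumes "indef_int f g"
  shows "continuous_on {0..b} f"
proof -
  have "g integrable_on {0..b}"
    using indef_int_abs_integrable[OF assms, of 0 b]
    by (auto intro: set_lebesgue_integral_eq_integral)
  then have "continuous_on {0..b} (\<lambda>x. f 0 + integral {0..x} g)"
    by (intro continuous_intros indefinite_integral_continuous_1)
  moreover have "continuous_on {0..b} (\<lambda>x. f 0 + integral {0..x} g) \<longleftrightarrow> continuous_on {0..b} f"
    by (rule continuous_on_cong) (auto simp: indef_intD(2)[OF assms, symmetric])
  ultimately show ?thesis by simp
qed

lemma indef_int_continuous_on:
  assumes "indef_int f g"
  shows "continuous_on {0..} f"
proof -
  have "continuous (at x within {0..}) f" if "x \<ge> 0" for x
  proof -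
    have "continuous (at x within {0..x+1}) f"
      using indef_int_continuous[OF assms, of "x+1"] that
      by (auto simp: continuous_on_eq_continuous_within)
    moreover have "at x within {0..x+1} = at x within {0..}"
      by (rule at_within_nhd[where S="{..<x+1}"]) auto
    ultimately show ?thesis by simp
  qed
  then show ?thesis by (auto simp: continuous_on_eq_continuous_within)
qed

lemma abs_integrable_continuous_mult:
  fixes f g :: "real \<Rightarrow> 'a::{real_normed_algebra, euclidean_space}"
  assumes "continuous_on {a..b} f" "g absolutely_integrable_on {a..b}"
  shows "(\<lambda>x. f x * g x) absolutely_integrable_on {a..b}"
    "(\<lambda>x. g x * f x) absolutely_integrable_on {a..b}"
proof -
  have m: "f \<in> borel_measurable (lebesgue_on {a..b})"
    by (intro continuous_imp_measurable_on_sets_lebesgue assms) auto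
  have b: "bounded (f ` {a..b})"
    by (intro compact_imp_bounded compact_continuous_image assms) auto
  have bl: "bilinear (\<lambda>(x::'a) y. x * y)"
    by (simp add: bilinear_conv_bounded_bilinear bounded_bilinear_mult)
  have bl': "bilinear (\<lambda>(x::'a) y. y * x)"
    using bounded_bilinear.flip[OF bounded_bilinear_mult[where 'a='a]]
    by (simp add: bilinear_conv_bounded_bilinear)
  show "(\<lambda>x. f x * g x) absolutely_integrable_on {a..b}"
    by (rule absolutely_integrable_bounded_measurable_product[OF bl m _ b assms(2)]) auto
  show "(\<lambda>x. g x * f x) absolutely_integrable_on {a..b}"
    by (rule absolutely_integrable_bounded_measurable_product[OF bl' m _ b assms(2)]) auto
qed

text \<open>Without differentiation almost everywhere at hand, the product rule is obtained by Bolzano's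
  bisection principle: on short intervals the defect of the formula is at most
  \<open>\<epsilon> \<integral> (\<bar>g\<bar> + \<bar>l\<bar>)\<close>, and this bound is additive.\<close>

lemma indef_int_mult:
  fixes f g k l :: "real \<Rightarrow> 'a::{real_normed_algebra, euclidean_space}"
  assumes fg: "indef_int f g" and kl: "indef_int k l"
  shows "indef_int (\<lambda>x. f x * k x) (\<lambda>x. f x * l x + g x * k x)"
  unfolding indef_int_def
proof (intro allI impI)
  fix b :: real assume b: "b \<ge> 0"
  let ?p = "\<lambda>x. f x * l x + g x * k x"
  let ?N = "\<lambda>x. norm (l x) + norm (g x)"
  have gi: "g absolutely_integrable_on {x..y}" and li: "l absolutely_integrable_on {x..y}"
    if "0 \<le> x" for x y
    using indef_int_abs_integrable[OF fg that] indef_int_abs_integrable[OF kl that] by auto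
  have fc: "continuous_on {x..y} f" and kc: "continuous_on {x..y} k" if "0 \<le> x" for x y
    using indef_int_continuous_on[OF fg] indef_int_continuous_on[OF kl] that
    by (auto elim!: continuous_on_subset)
  have flai: "(\<lambda>x. f x * l x) absolutely_integrable_on {x..y}"
    and gkai: "(\<lambda>x. g x * k x) absolutely_integrable_on {x..y}" if "0 \<le> x" for x y
    using abs_integrable_continuous_mult[OF fc[OF that] li[OF that], of y]
      abs_integrable_continuous_mult[OF kc[OF that] gi[OF that], of y] by blast+
  have pai: "?p absolutely_integrable_on {x..y}" if "0 \<le> x" for x y
    using flai[OF that] gkai[OF that] by (rule set_integral_add)
  have pi: "?p integrable_on {x..y}" if "0 \<le> x" for x y
    using pai[OF that] by (rule set_lebesgue_integral_eq_integral)
  have Ni: "?N integrable_on {x..y}" if "0 \<le> x" for x y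
    using gi[OF that] li[OF that]
    by (intro integrable_add) (auto simp: absolutely_integrable_on_def)
  have est: "norm (f b * k b - f 0 * k 0 - integral {0..b} ?p) \<le> e * integral {0..b} ?N"
    if e: "e > 0" for e
  proof -
    have *: "0 \<le> x \<and> x \<le> y \<and> y \<le> b \<longrightarrow>
          norm (f y * k y - f x * k x - integral {x..y} ?p) \<le> e * integral {x..y} ?N"
      if "x = 0" "y = b" for x y
      using b[folded that(2), folded that(1)]
    proof (induction rule: Bolzano)
      case (trans x y z)
      show ?case
      proof
        assume h: "0 \<le> x \<and> x \<le> z \<and> z \<le> b"
        have i: "integral {x..z} ?p = integral {x..y} ?p + integral {y..z} ?p"
          using trans h pi by (intro Henstock_Kurzweil_Integration.integral_combine[symmetric]) auto
        have j: "integral {x..z} ?N = integral {x..y} ?N + integral {y..z} ?N"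
          using trans h Ni by (intro Henstock_Kurzweil_Integration.integral_combine[symmetric]) auto
        have "f z * k z - f x * k x - integral {x..z} ?p =
          (f y * k y - f x * k x - integral {x..y} ?p) + (f z * k z - f y * k y - integral {y..z} ?p)"
          by (simp add: i)
        also have "norm \<dots> \<le> e * integral {x..y} ?N + e * integral {y..z} ?N"
          by (rule order_trans[OF norm_triangle_ineq], rule add_mono) (use trans h in auto)
        finally show "norm (f z * k z - f x * k x - integral {x..z} ?p) \<le> e * integral {x..z} ?N"
          by (simp only: j distrib_left)
      qed
    next
      case (local c)
      then have cb: "0 \<le> c" "c \<le> b" using that by auto
      have "continuous_on {0..b} f" "continuous_on {0..b} k" using fc kc by auto
      with cb obtain d1 d2 where d: "d1 > 0" "d2 > 0"
        "\<And>x. x \<in> {0..b} \<Longrightarrow> dist x c < d1 \<Longrightarrow> dist (f x) (f c) < e / 2"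
        "\<And>x. x \<in> {0..b} \<Longrightarrow> dist x c < d2 \<Longrightarrow> dist (k x) (k c) < e / 2"
        unfolding continuous_on_iff using e by (metis atLeastAtMost_iff half_gt_zero)
      show ?case
      proof (intro exI[of _ "min d1 d2"] conjI allI impI)
        show "min d1 d2 > 0" using d by auto
        fix x y assume xy: "x \<le> c \<and> c \<le> y \<and> y - x < min d1 d2" and h: "0 \<le> x \<and> x \<le> y \<and> y \<le> b"
        have cl: "norm (f s - f t) \<le> e" "norm (k s - k t) \<le> e" if "s \<in> {x..y}" "t \<in> {x..y}" for s t
        proof -
          have "dist s c < d1" "dist t c < d1" "dist s c < d2" "dist t c < d2"
            using that xy by (auto simp: dist_real_def)
          then have "dist (f s) (f c) < e/2" "dist (f t) (f c) < e/2"
            "dist (k s) (k c) < e/2" "dist (k t) (k c) < e/2"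
            using d(3)[of s] d(3)[of t] d(4)[of s] d(4)[of t] that h by auto
          then show "norm (f s - f t) \<le> e" "norm (k s - k t) \<le> e"
            using dist_triangle2[of "f s" "f t" "f c"] dist_triangle2[of "k s" "k t" "k c"]
            by (auto simp: dist_norm)
        qed
        have x0: "0 \<le> x" using h by auto
        have li': "l integrable_on {x..y}" and gi': "g integrable_on {x..y}"
          using li[OF x0] gi[OF x0] by (auto intro: set_lebesgue_integral_eq_integral)
        \<comment> \<open>Freezing \<open>f\<close> at the right endpoint and \<open>k\<close> at
          the left one makes the comparison exact: f(y) (k(y) - k(x)) + (f(y) - f(x)) k(x)
          telescopes to f(y) k(y) - f(x) k(x). Only the oscillation of \<open>f\<close> and
          \<open>k\<close> on the short interval then remains as error.\<close>
        have i1: "((\<lambda>s. f y * l s) has_integral f y * integral {x..y} l) {x..y}"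
          using has_integral_mult_right[OF integrable_integral[OF li']] .
        have i2: "((\<lambda>s. g s * k x) has_integral integral {x..y} g * k x) {x..y}"
          using has_integral_mult_left[OF integrable_integral[OF gi']] .
        have k1: "integral {x..y} l = k y - k x" and g1: "integral {x..y} g = f y - f x"
          using indef_int_diff[OF kl] indef_int_diff[OF fg] h by auto
        have "((\<lambda>s. f y * l s + g s * k x - ?p s) has_integral
            f y * integral {x..y} l + integral {x..y} g * k x - integral {x..y} ?p) {x..y}"
          by (intro has_integral_diff has_integral_add i1 i2 integrable_integral pi x0)
        then have hi: "((\<lambda>s. f y * l s + g s * k x - ?p s) has_integral
            f y * k y - f x * k x - integral {x..y} ?p) {x..y}"
          by (simp add: k1 g1 algebra_simps)
        have "norm (f y * k y - f x * k x - integral {x..y} ?p) \<le> integral {x..y} (\<lambda>s. e * ?N s)"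
          unfolding integral_unique[OF hi, symmetric]
        proof (rule integral_norm_bound_integral)
          show "(\<lambda>s. f y * l s + g s * k x - ?p s) integrable_on {x..y}" using hi by auto
          show "(\<lambda>s. e * ?N s) integrable_on {x..y}"
            using Ni[OF x0] by (rule integrable_on_mult_right)
          fix s assume s: "s \<in> {x..y}"
          have "f y * l s + g s * k x - ?p s = (f y - f s) * l s + g s * (k x - k s)"
            by (simp add: algebra_simps)
          also have "norm \<dots> \<le> norm ((f y - f s) * l s) + norm (g s * (k x - k s))"
            by (rule norm_triangle_ineq)
          also have "\<dots> \<le> norm (f y - f s) * norm (l s) + norm (g s) * norm (k x - k s)"
            by (intro add_mono norm_mult_ineq)
          also have "\<dots> \<le> e * norm (l s) + norm (g s) * e"
            using cl[of y s] cl[of x s] s h e by (intro add_mono mult_mono) auto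
          finally show "norm (f y * l s + g s * k x - ?p s) \<le> e * ?N s"
            by (simp add: algebra_simps)
        qed
        then show "norm (f y * k y - f x * k x - integral {x..y} ?p) \<le> e * integral {x..y} ?N"
          by simp
      qed
    qed
    show ?thesis using * b by auto
  qed
  have "norm (f b * k b - f 0 * k 0 - integral {0..b} ?p) \<le> 0"
  proof (rule field_le_epsilon)
    fix e :: real assume e: "e > 0"
    define I where "I = integral {0..b} ?N"
    have I: "I \<ge> 0" unfolding I_def using Ni by (intro integral_nonneg) auto
    have "norm (f b * k b - f 0 * k 0 - integral {0..b} ?p) \<le> e / (I + 1) * I"
      using est[of "e / (I + 1)"] e I by (simp add: I_def)
    also have "\<dots> \<le> e" using e I by (simp add: field_simps)
    finally show "norm (f b * k b - f 0 * k 0 - integral {0..b} ?p) \<le> 0 + e" by simp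
  qed
  then have "f b * k b = f 0 * k 0 + integral {0..b} ?p"
    by (simp add: algebra_simps)
  then show "?p absolutely_integrable_on {0..b} \<and> f b * k b = f 0 * k 0 + integral {0..b} ?p"
    using pai[of 0 b] by auto
qed

lemma indef_int_bounded_linear:
  assumes "bounded_linear T" "indef_int f g"
  shows "indef_int (\<lambda>x. T (f x)) (\<lambda>x. T (g x))"
proof -
  interpret bounded_linear T by fact
  have "(\<lambda>x. T (g x)) absolutely_integrable_on {0..b} \<and>
      T (f b) = T (f 0) + integral {0..b} (\<lambda>x. T (g x))" if b: "b \<ge> 0" for b
  proof
    have gi: "g integrable_on {0..b}"
      using indef_intD(1)[OF assms(2) b] by (rule set_lebesgue_integral_eq_integral)
    show "(\<lambda>x. T (g x)) absolutely_integrable_on {0..b}"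
      using absolutely_integrable_linear[OF indef_intD(1)[OF assms(2) b] assms(1)]
      by (simp add: o_def)
    have "integral {0..b} (T \<circ> g) = T (integral {0..b} g)"
      by (rule integral_linear[OF gi assms(1)])
    then show "T (f b) = T (f 0) + integral {0..b} (\<lambda>x. T (g x))"
      using indef_intD(2)[OF assms(2) b] by (simp add: o_def add)
  qed
  then show ?thesis unfolding indef_int_def by blast
qed

lemma indef_int_add:
  assumes "indef_int f g" "indef_int k l"
  shows "indef_int (\<lambda>x. f x + k x) (\<lambda>x. g x + l x)"
  unfolding indef_int_def
proof (intro allI impI conjI)
  fix b :: real assume b: "b \<ge> 0"
  note A = indef_intD[OF assms(1) b] indef_intD[OF assms(2) b]
  show "(\<lambda>x. g x + l x) absolutely_integrable_on {0..b}"
    using A(1) A(3) by (rule set_integral_add)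
  have "integral {0..b} (\<lambda>x. g x + l x) = integral {0..b} g + integral {0..b} l"
    using A by (intro Henstock_Kurzweil_Integration.integral_add) (auto intro: set_lebesgue_integral_eq_integral)
  then show "f b + k b = f 0 + k 0 + integral {0..b} (\<lambda>x. g x + l x)"
    using A by simp
qed

lemma indef_int_C1:
  fixes f :: "real \<Rightarrow> 'a::euclidean_space"
  assumes d: "\<And>x. x \<ge> 0 \<Longrightarrow> (f has_vector_derivative g x) (at x within {0..})"
    and c: "continuous_on {0..} g"
  shows "indef_int f g"
  unfolding indef_int_def
proof (intro allI impI conjI)
  fix b :: real assume b: "b \<ge> 0"
  show "g absolutely_integrable_on {0..b}"
    using absolutely_integrable_continuous[of 0 b g] continuous_on_subset[OF c, of "{0..b}"] by simp
  have "(g has_integral (f b - f 0)) {0..b}"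
    by (rule fundamental_theorem_of_calculus)
       (use b in \<open>auto intro!: has_vector_derivative_within_subset[OF d]\<close>)
  then show "f b = f 0 + integral {0..b} g" by (simp add: integral_unique)
qed

lemma indef_int_has_derivative:
  assumes "indef_int f g" "continuous_on {0..} g" "x \<ge> 0"
  shows "(f has_vector_derivative g x) (at x within {0..})"
proof -
  have "continuous_on {0..x+1} g" by (rule continuous_on_subset[OF assms(2)]) auto
  then have "((\<lambda>u. integral {0..u} g) has_vector_derivative g x) (at x within {0..x+1})"
    by (rule integral_has_vector_derivative) (use assms in auto)
  then have "((\<lambda>u. f 0 + integral {0..u} g) has_vector_derivative g x) (at x within {0..x+1})"
    by (auto intro!: derivative_eq_intros)
  then have "(f has_vector_derivative g x) (at x within {0..x+1})"
    by (rule has_vector_derivative_transform[rotated 2])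
       (use assms in \<open>auto simp: indef_intD(2)[OF assms(1), symmetric]\<close>)
  moreover have "at x within {0..x+1} = at x within {0..}"
    by (rule at_within_nhd[where S="{..<x+1}"]) (use assms in auto)
  ultimately show ?thesis by simp
qed

section \<open>Integrals over the half-line\<close>

abbreviation halfline :: "real measure" where
  "halfline \<equiv> lebesgue_on {0<..}"

lemma integrable_halfline_iff: "integrable halfline f \<longleftrightarrow> f absolutely_integrable_on {0<..}"
  by (simp add: set_integrable_def integrable_restrict_space)

lemma halfline_set_integral:
  fixes f :: "real \<Rightarrow> 'a::euclidean_space"
  shows "(LINT x:{0<..}|lebesgue. f x) = integral\<^sup>L halfline f"
  using integral_restrict_space[of "{0<..}" lebesgue f] by (simp add: set_lebesgue_integral_def)

lemma measurable_halfline_iff: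
  fixes f :: "real \<Rightarrow> 'a::euclidean_space"
  shows "f \<in> borel_measurable halfline \<longleftrightarrow> set_borel_measurable lebesgue {0<..} f"
  using borel_measurable_restrict_space_iff[of "{0<..}" lebesgue f] by (simp add: set_borel_measurable_def)

lemma AE_halfline_iff: "(AE x in halfline. P x) \<longleftrightarrow> (AE x in lebesgue. x > 0 \<longrightarrow> P x)"
  by (simp add: AE_restrict_space_iff)

lemma continuous_measurable_halfline:
  fixes f :: "real \<Rightarrow> 'a::euclidean_space"
  assumes "continuous_on {0..} f"
  shows "f \<in> borel_measurable halfline"
  by (intro continuous_imp_measurable_on_sets_lebesgue continuous_on_subset[OF assms]) auto

text \<open>Reconciles the two conventions in use: integrals over \<open>halfline\<close> omit the
  point 0, while \<open>indef_int\<close> integrates over intervals that contain it.\<close>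

lemma abs_integrable_Icc_iff_Ioc:
  fixes f :: "real \<Rightarrow> 'a::euclidean_space"
  shows "f absolutely_integrable_on {a..b} \<longleftrightarrow> f absolutely_integrable_on {a<..b}"
proof (rule absolutely_integrable_spike_set_eq)
  show "negligible {x \<in> {a..b} - {a<..b}. f x \<noteq> 0}"
    by (rule negligible_subset[of "{a}"]) auto
  show "negligible {x \<in> {a<..b} - {a..b}. f x \<noteq> 0}"
    by (rule negligible_subset[of "{a}"]) auto
qed

lemma halfline_abs_integrable:
  fixes h :: "real \<Rightarrow> 'a::euclidean_space"
  assumes "integrable halfline h"
  shows "h absolutely_integrable_on {0..b}"
  unfolding abs_integrable_Icc_iff_Ioc
  using assms unfolding integrable_halfline_iff by (rule set_integrable_subset) auto

lemma halfline_integral_Icc: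
  fixes h :: "real \<Rightarrow> 'a::euclidean_space"
  assumes "h absolutely_integrable_on {0..b}"
  shows "integral\<^sup>L halfline (\<lambda>x. indicator {..b} x *\<^sub>R h x) = integral {0..b} h"
    and "integrable halfline (\<lambda>x. indicator {..b} x *\<^sub>R h x)"
proof -
  have e: "(\<lambda>x. indicator {0<..} x *\<^sub>R indicator {..b} x *\<^sub>R h x) = (\<lambda>x. indicator {0<..b} x *\<^sub>R h x)"
    by (auto simp: indicator_def fun_eq_iff)
  have i: "h absolutely_integrable_on {0<..b}" using assms abs_integrable_Icc_iff_Ioc by blast
  have "integral\<^sup>L halfline (\<lambda>x. indicator {..b} x *\<^sub>R h x) = (LINT x:{0<..b}|lebesgue. h x)"
    by (subst halfline_set_integral[symmetric]) (simp only: set_lebesgue_integral_def e)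
  also have "\<dots> = integral {0<..b} h" using i by (rule set_lebesgue_integral_eq_integral)
  also have "\<dots> = integral {0..b} h"
  proof (rule integral_spike_set)
    show "negligible {x \<in> {0<..b} - {0..b}. h x \<noteq> 0}"
      by (rule negligible_subset[of "{0}"]) auto
    show "negligible {x \<in> {0..b} - {0<..b}. h x \<noteq> 0}"
      by (rule negligible_subset[of "{0}"]) auto
  qed
  finally show "integral\<^sup>L halfline (\<lambda>x. indicator {..b} x *\<^sub>R h x) = integral {0..b} h" .
  show "integrable halfline (\<lambda>x. indicator {..b} x *\<^sub>R h x)"
    unfolding integrable_halfline_iff set_integrable_def e using i by (simp add: set_integrable_def)
qed

lemma integral_tendsto_halfline:
  fixes h :: "real \<Rightarrow> 'a::euclidean_space"
  assumes "integrable halfline h"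
  shows "((\<lambda>b. integral {0..b} h) \<longlongrightarrow> integral\<^sup>L halfline h) at_top"
proof -
  have "((\<lambda>b. integral\<^sup>L halfline (\<lambda>x. indicator {..b} x *\<^sub>R h x)) \<longlongrightarrow> integral\<^sup>L halfline h) at_top"
  proof (rule integral_dominated_convergence_at_top)
    show "h \<in> borel_measurable halfline" using assms by auto
    show "integrable halfline (\<lambda>x. norm (h x))" using assms by auto
    show "(\<lambda>x. indicator {..b} x *\<^sub>R h x) \<in> borel_measurable halfline" for b
      by (rule borel_measurable_integrable, rule halfline_integral_Icc(2),
          rule halfline_abs_integrable[OF assms])
    show "AE x in halfline. ((\<lambda>b. indicator {..b} x *\<^sub>R h x) \<longlongrightarrow> h x) at_top"
    proof (rule AE_I2)
      fix x
      have "eventually (\<lambda>b. indicator {..b} x *\<^sub>R h x = h x) at_top"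
        using eventually_ge_at_top[of x] by eventually_elim (auto simp: indicator_def)
      then show "((\<lambda>b. indicator {..b} x *\<^sub>R h x) \<longlongrightarrow> h x) at_top" by (rule tendsto_eventually)
    qed
    show "\<forall>\<^sub>F b in at_top. AE x in halfline. norm (indicator {..b} x *\<^sub>R h x) \<le> norm (h x)"
      by (auto simp: indicator_def)
  qed
  then show ?thesis
    by (simp add: halfline_integral_Icc(1)[OF halfline_abs_integrable[OF assms]])
qed

text \<open>The source of contradictions at infinity: it excludes nonzero limits of integrable
  functions and nonzero values of conserved quantities.\<close>

lemma not_integrable_halfline_const:
  fixes c :: real
  assumes "integrable halfline (\<lambda>x. c)"
  shows "c = 0"
proof (rule ccontr)
  assume c: "c \<noteq> 0"
  have t: "((\<lambda>b. integral {0..b::real} (\<lambda>x. c)) \<longlongrightarrow> integral\<^sup>L halfline (\<lambda>x. c)) at_top"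
    by (rule integral_tendsto_halfline[OF assms])
  have "((\<lambda>b. b * c) \<longlongrightarrow> integral\<^sup>L halfline (\<lambda>x. c)) at_top"
    by (rule Lim_transform_eventually[OF t])
       (rule eventually_mono[OF eventually_ge_at_top[of 0]], simp)
  then have "((\<lambda>b. b * c / c) \<longlongrightarrow> integral\<^sup>L halfline (\<lambda>x. c) / c) at_top"
    by (intro tendsto_divide tendsto_const c)
  then have "((\<lambda>b::real. b) \<longlongrightarrow> integral\<^sup>L halfline (\<lambda>x. c) / c) at_top" using c by simp
  then show False
    using not_tendsto_and_filterlim_at_infinity[of at_top "\<lambda>b::real. b"]
      filterlim_at_top_imp_at_infinity[OF filterlim_ident] by auto
qed

text \<open>Integrability of \<open>h'\<close> gives \<open>h\<close> a limit, and a nonzero limit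
  would contradict the integrability of \<open>h\<close>. This disposes of the boundary term at
  infinity in every later integration by parts.\<close>

lemma indef_int_vanishes_at_infinity:
  fixes h h' :: "real \<Rightarrow> 'a::euclidean_space"
  assumes h: "indef_int h h'" and i: "integrable halfline h" "integrable halfline h'"
  shows "(h \<longlongrightarrow> 0) at_top" "integral\<^sup>L halfline h' = - h 0"
proof -
  define L where "L = h 0 + integral\<^sup>L halfline h'"
  have t0: "((\<lambda>b. h 0 + integral {0..b} h') \<longlongrightarrow> L) at_top"
    unfolding L_def by (intro tendsto_intros integral_tendsto_halfline i)
  have t: "(h \<longlongrightarrow> L) at_top"
    by (rule Lim_transform_eventually[OF t0])
       (rule eventually_mono[OF eventually_ge_at_top[of 0]], simp add: indef_intD(2)[OF h, symmetric])
  have "L = 0"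
  proof (rule ccontr)
    assume L: "L \<noteq> 0"
    then have "eventually (\<lambda>x. norm (h x) > norm L / 2) at_top"
      using tendsto_norm[OF t] by (intro order_tendstoD) auto
    then obtain B where B: "\<And>x. x \<ge> B \<Longrightarrow> norm (h x) > norm L / 2"
      by (auto simp: eventually_at_top_linorder)
    define B' where "B' = max B 0"
    \<comment> \<open>The constant \<open>norm L / 2\<close> is dominated on the whole half-line: by
      the indicator term up to \<open>B'\<close>, and by \<open>norm (h x)\<close> beyond.\<close>
    have "integrable halfline (\<lambda>x. norm L / 2 * indicator {..B'} x + norm (h x))"
    proof (intro Bochner_Integration.integrable_add integrable_norm i)
      show "integrable halfline (\<lambda>x. norm L / 2 * indicator {..B'} x)"
        using halfline_integral_Icc(2)[of B' "\<lambda>x. norm L / 2"]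
        by (simp add: absolutely_integrable_on_const ac_simps)
    qed
    then have "integrable halfline (\<lambda>x. norm L / 2)"
    proof (rule Bochner_Integration.integrable_bound)
      show "AE x in halfline. norm (norm L / 2) \<le> norm (norm L / 2 * indicator {..B'} x + norm (h x))"
      proof (rule AE_I2)
        fix x :: real
        show "norm (norm L / 2) \<le> norm (norm L / 2 * indicator {..B'} x + norm (h x))"
        proof (cases "x \<le> B'")
          case False
          then have "norm (h x) > norm L / 2" using B[of x] by (simp add: B'_def)
          then show ?thesis using False by (simp add: indicator_def)
        qed (simp add: indicator_def)
      qed
    qed auto
    then have "norm L / 2 = 0" by (rule not_integrable_halfline_const)
    then show False using L by simp
  qed
  then show "(h \<longlongrightarrow> 0) at_top" "integral\<^sup>L halfline h' = - h 0"
    using t by (simp_all add: L_def eq_neg_iff_add_eq_0 add.commute)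
qed

section \<open>Sobolev functions on the half-line\<close>

definition L2_half :: "(real \<Rightarrow> complex) \<Rightarrow> bool" where
  "L2_half f \<longleftrightarrow> f \<in> borel_measurable halfline \<and> integrable halfline (\<lambda>x. (norm (f x))\<^sup>2)"

text \<open>The derivative is carried along as an argument instead of being chosen, and
  \<open>f\<close> is the continuous representative itself, so traces are plain values at 0.\<close>

definition H1_half :: "(real \<Rightarrow> complex) \<Rightarrow> (real \<Rightarrow> complex) \<Rightarrow> bool" where
  "H1_half f g \<longleftrightarrow> L2_half f \<and> L2_half g \<and> indef_int f g"

lemma L2_halfD:
  assumes "L2_half f"
  shows "f \<in> borel_measurable halfline" "integrable halfline (\<lambda>x. (norm (f x))\<^sup>2)"
  using assms by (auto simp: L2_half_def)

lemma L2_half_iff: "f \<in> L2 {0<..} \<longleftrightarrow> L2_half f"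
  by (simp add: L2_def L2_half_def measurable_halfline_iff integrable_halfline_iff)

lemma norm_mult_le_squares: "norm (a * b :: complex) \<le> (norm a)\<^sup>2 + (norm b)\<^sup>2"
proof -
  have "2 * (norm a * norm b) \<le> (norm a)\<^sup>2 + (norm b)\<^sup>2"
    using sum_squares_bound[of "norm a" "norm b"] by (simp add: mult_ac)
  moreover have "norm a * norm b \<ge> 0" by simp
  ultimately show ?thesis unfolding norm_mult by linarith
qed

lemma L2_half_mult:
  assumes "L2_half f" "L2_half g"
  shows "integrable halfline (\<lambda>x. f x * g x)"
proof (rule Bochner_Integration.integrable_bound)
  show "integrable halfline (\<lambda>x. (norm (f x))\<^sup>2 + (norm (g x))\<^sup>2)"
    using L2_halfD(2)[OF assms(1)] L2_halfD(2)[OF assms(2)] by auto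
  show "(\<lambda>x. f x * g x) \<in> borel_measurable halfline"
    using L2_halfD(1)[OF assms(1)] L2_halfD(1)[OF assms(2)] by auto
  show "AE x in halfline. norm (f x * g x) \<le> norm ((norm (f x))\<^sup>2 + (norm (g x))\<^sup>2)"
    using norm_mult_le_squares by (auto intro: order_trans[OF _ abs_ge_self])
qed

lemma L2_half_bound:
  assumes "L2_half f" "g \<in> borel_measurable halfline"
    and "AE x in halfline. norm (g x) \<le> C * norm (f x)"
  shows "L2_half g"
  unfolding L2_half_def
proof (rule conjI[OF assms(2)], rule Bochner_Integration.integrable_bound)
  show "integrable halfline (\<lambda>x. C\<^sup>2 * (norm (f x))\<^sup>2)"
    using L2_halfD(2)[OF assms(1)] by auto
  show "(\<lambda>x. (norm (g x))\<^sup>2) \<in> borel_measurable halfline" using assms(2) by auto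
  show "AE x in halfline. norm ((norm (g x))\<^sup>2) \<le> norm (C\<^sup>2 * (norm (f x))\<^sup>2)"
    using assms(3)
  proof eventually_elim
    case (elim x)
    then have "(norm (g x))\<^sup>2 \<le> (C * norm (f x))\<^sup>2" by (intro power_mono) auto
    then show ?case by (simp add: power_mult_distrib)
  qed
qed

lemma L2_half_add:
  assumes "L2_half f" "L2_half g"
  shows "L2_half (\<lambda>x. f x + g x)"
  unfolding L2_half_def
proof
  show m: "(\<lambda>x. f x + g x) \<in> borel_measurable halfline"
    using L2_halfD(1)[OF assms(1)] L2_halfD(1)[OF assms(2)] by auto
  show "integrable halfline (\<lambda>x. (norm (f x + g x))\<^sup>2)"
  proof (rule Bochner_Integration.integrable_bound)
    show "integrable halfline (\<lambda>x. 2 * ((norm (f x))\<^sup>2 + (norm (g x))\<^sup>2))"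
      using L2_halfD(2)[OF assms(1)] L2_halfD(2)[OF assms(2)] by auto
    show "(\<lambda>x. (norm (f x + g x))\<^sup>2) \<in> borel_measurable halfline" using m by auto
    show "AE x in halfline. norm ((norm (f x + g x))\<^sup>2) \<le> norm (2 * ((norm (f x))\<^sup>2 + (norm (g x))\<^sup>2))"
    proof (rule AE_I2)
      fix x
      have "(norm (f x + g x))\<^sup>2 \<le> (norm (f x) + norm (g x))\<^sup>2"
        by (intro power_mono norm_triangle_ineq) auto
      also have "\<dots> \<le> 2 * ((norm (f x))\<^sup>2 + (norm (g x))\<^sup>2)"
        using sum_squares_bound[of "norm (f x)" "norm (g x)"] by (simp add: power2_sum)
      finally show "norm ((norm (f x + g x))\<^sup>2) \<le> norm (2 * ((norm (f x))\<^sup>2 + (norm (g x))\<^sup>2))"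
        by simp
    qed
  qed
qed

lemma L2_half_cmult: "L2_half f \<Longrightarrow> L2_half (\<lambda>x. c * f x)"
  by (rule L2_half_bound[of f _ "norm c"]) (auto simp: L2_half_def norm_mult)

lemma L2_half_cnj: "L2_half f \<Longrightarrow> L2_half (\<lambda>x. cnj (f x))"
  by (rule L2_half_bound[of f _ 1])
     (auto simp: L2_half_def bounded_linear_cnj intro: borel_measurable_continuous_onI[THEN measurable_compose_rev] continuous_intros)

lemma L2_half_Re: "L2_half f \<Longrightarrow> L2_half (\<lambda>x. complex_of_real (Re (f x)))"
  by (rule L2_half_bound[of f _ 1]) (auto simp: L2_half_def abs_Re_le_cmod)

lemma L2_half_cong_AE:
  assumes "L2_half f" "AE x in halfline. f x = g x" "g \<in> borel_measurable halfline"
  shows "L2_half g"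
  by (rule L2_half_bound[of f _ 1]) (use assms in auto)

text \<open>Rests on the completeness of Lebesgue measure. It yields measurability of functions,
  such as chosen weak derivatives, that are known only almost everywhere.\<close>

lemma measurable_halfline_cong_AE:
  fixes f g :: "real \<Rightarrow> complex"
  assumes f: "f \<in> borel_measurable halfline" and ae: "AE x in halfline. f x = g x"
  shows "g \<in> borel_measurable halfline"
proof -
  have "(\<lambda>x. indicator {0<..} x *\<^sub>R g x) \<in> borel_measurable lebesgue"
  proof (rule borel_measurable_AE)
    show "(\<lambda>x. indicator {0<..} x *\<^sub>R f x) \<in> borel_measurable lebesgue"
      using f by (simp add: measurable_halfline_iff set_borel_measurable_def)
    show "AE x in lebesgue. indicator {0<..} x *\<^sub>R f x = indicator {0<..} x *\<^sub>R g x"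
      using ae unfolding AE_halfline_iff by eventually_elim (auto simp: indicator_def)
  qed
  then show ?thesis by (simp add: measurable_halfline_iff set_borel_measurable_def)
qed

text \<open>On bounded intervals \<bar>g\<bar> \<le> 1 + \<bar>g\<bar>^2 puts square integrable
  functions into L1.\<close>

lemma L2_half_abs_integrable:
  assumes "L2_half g"
  shows "g absolutely_integrable_on {0..b}"
proof -
  have I: "integrable halfline (\<lambda>x. indicator {..b} x *\<^sub>R g x)"
  proof (rule Bochner_Integration.integrable_bound)
    show "integrable halfline (\<lambda>x. indicator {..b} x *\<^sub>R (1::real) + (norm (g x))\<^sup>2)"
      using L2_halfD(2)[OF assms]
      by (intro Bochner_Integration.integrable_add halfline_integral_Icc)
         (auto simp: absolutely_integrable_on_const)
    show "(\<lambda>x. indicator {..b} x *\<^sub>R g x) \<in> borel_measurable halfline"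
    proof -
      have "indicat_real {..b} \<in> borel_measurable halfline"
        using halfline_integral_Icc(2)[of b "\<lambda>x. 1::real"]
        by (auto simp: absolutely_integrable_on_const dest: borel_measurable_integrable)
      then show ?thesis using L2_halfD(1)[OF assms] by auto
    qed
    show "AE x in halfline. norm (indicator {..b} x *\<^sub>R g x) \<le> norm (indicator {..b} x *\<^sub>R (1::real) + (norm (g x))\<^sup>2)"
    proof (rule AE_I2)
      fix x
      have "norm (g x) \<le> 1 + (norm (g x))\<^sup>2"
        using sum_squares_bound[of "norm (g x)" 1] norm_ge_zero[of "g x"] unfolding power2_eq_square
        by linarith
      then show "norm (indicator {..b} x *\<^sub>R g x) \<le> norm (indicator {..b} x *\<^sub>R (1::real) + (norm (g x))\<^sup>2)"
        by (auto simp: indicator_def)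
    qed
  qed
  have "(\<lambda>x. indicator {..b} x *\<^sub>R g x) absolutely_integrable_on {0..b}"
    by (rule halfline_abs_integrable[OF I])
  moreover have "(\<lambda>x. indicator {..b} x *\<^sub>R g x) absolutely_integrable_on {0..b} \<longleftrightarrow> g absolutely_integrable_on {0..b}"
    by (rule set_integrable_cong) auto
  ultimately show ?thesis by simp
qed

lemma H1_halfD:
  assumes "H1_half f g"
  shows "L2_half f" "L2_half g" "indef_int f g"
  using assms by (auto simp: H1_half_def)

lemma H1_half_add:
  assumes "H1_half f g" "H1_half k l"
  shows "H1_half (\<lambda>x. f x + k x) (\<lambda>x. g x + l x)"
  using assms by (auto simp: H1_half_def intro: L2_half_add indef_int_add)

lemma H1_half_cmult:
  assumes "H1_half f g"
  shows "H1_half (\<lambda>x. c * f x) (\<lambda>x. c * g x)"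
  using assms by (auto simp: H1_half_def intro: L2_half_cmult
      indef_int_bounded_linear[OF bounded_linear_mult_right])

lemma H1_half_cnj:
  assumes "H1_half f g"
  shows "H1_half (\<lambda>x. cnj (f x)) (\<lambda>x. cnj (g x))"
  using assms by (auto simp: H1_half_def intro: L2_half_cnj
      indef_int_bounded_linear[OF bounded_linear_cnj])

lemma H1_half_Re:
  assumes "H1_half f g"
  shows "H1_half (\<lambda>x. complex_of_real (Re (f x))) (\<lambda>x. complex_of_real (Re (g x)))"
proof -
  have "bounded_linear (\<lambda>z. complex_of_real (Re z))"
    using bounded_linear_compose[OF bounded_linear_of_real bounded_linear_Re] by simp
  then show ?thesis
    using assms by (auto simp: H1_half_def intro: L2_half_Re indef_int_bounded_linear)
qed

text \<open>The product of two H1 functions is in L1 together with its derivative, so only the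
  boundary term at 0 survives.\<close>

lemma H1_half_parts:
  assumes fg: "H1_half f g" and kl: "H1_half k l"
  shows "integral\<^sup>L halfline (\<lambda>x. f x * l x + g x * k x) = - (f 0 * k 0)"
    and "((\<lambda>x. f x * k x) \<longlongrightarrow> 0) at_top"
    and "integrable halfline (\<lambda>x. f x * l x + g x * k x)"
proof -
  note f = H1_halfD[OF fg] and k = H1_halfD[OF kl]
  show i: "integrable halfline (\<lambda>x. f x * l x + g x * k x)"
    by (intro Bochner_Integration.integrable_add L2_half_mult f k)
  note A = indef_int_vanishes_at_infinity[OF indef_int_mult[OF f(3) k(3)] L2_half_mult[OF f(1) k(1)] i]
  show "integral\<^sup>L halfline (\<lambda>x. f x * l x + g x * k x) = - (f 0 * k 0)" by (rule A(2))
  show "((\<lambda>x. f x * k x) \<longlongrightarrow> 0) at_top" by (rule A(1))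
qed

lemma H1_half_tendsto_0:
  assumes "H1_half f g"
  shows "(f \<longlongrightarrow> 0) at_top"
proof -
  have "((\<lambda>x. norm (f x * cnj (f x))) \<longlongrightarrow> 0) at_top"
    using tendsto_norm[OF H1_half_parts(2)[OF assms H1_half_cnj[OF assms]]] by simp
  then have "((\<lambda>x. sqrt (norm (f x * cnj (f x)))) \<longlongrightarrow> sqrt 0) at_top" by (rule tendsto_real_sqrt)
  then have "((\<lambda>x. norm (f x)) \<longlongrightarrow> 0) at_top" by (simp add: norm_mult real_sqrt_mult_self)
  then show ?thesis by (rule tendsto_norm_zero_cancel)
qed

text \<open>The derivative of \<bar>f\<bar>^2 is at most \<bar>f\<bar>^2 + \<bar>g\<bar>^2 in
  modulus. The value at 0 and the increment from 0 to \<open>x\<close> each cost one integral of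
  this bound, hence the factor 2.\<close>

lemma H1_half_bound:
  assumes H: "H1_half f g" and x: "x \<ge> 0"
  shows "(norm (f x))\<^sup>2 \<le> 2 * (integral\<^sup>L halfline (\<lambda>x. (norm (f x))\<^sup>2) + integral\<^sup>L halfline (\<lambda>x. (norm (g x))\<^sup>2))"
proof -
  let ?h = "\<lambda>x. f x * cnj (f x)" and ?h' = "\<lambda>x. f x * cnj (g x) + g x * cnj (f x)"
  note C = H1_half_cnj[OF H]
  note P = H1_half_parts[OF H C]
  have i: "indef_int ?h ?h'" by (rule indef_int_mult[OF H1_halfD(3)[OF H] H1_halfD(3)[OF C]])
  have n: "integrable halfline (\<lambda>x. norm (?h' x))" using P(3) by auto
  have "integral\<^sup>L halfline (\<lambda>x. norm (?h' x)) \<le>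
      integral\<^sup>L halfline (\<lambda>x. (norm (f x))\<^sup>2 + (norm (g x))\<^sup>2)"
  proof (rule integral_mono[OF n])
    show "integrable halfline (\<lambda>x. (norm (f x))\<^sup>2 + (norm (g x))\<^sup>2)"
      using H1_halfD[OF H] by (auto simp: L2_half_def)
    fix x
    have "norm (?h' x) \<le> norm (f x * cnj (g x)) + norm (g x * cnj (f x))" by (rule norm_triangle_ineq)
    also have "\<dots> \<le> (norm (f x))\<^sup>2 + (norm (g x))\<^sup>2"
      using sum_squares_bound[of "norm (f x)" "norm (g x)"] by (simp add: norm_mult)
    finally show "norm (?h' x) \<le> (norm (f x))\<^sup>2 + (norm (g x))\<^sup>2" .
  qed
  also have "\<dots> = integral\<^sup>L halfline (\<lambda>x. (norm (f x))\<^sup>2) + integral\<^sup>L halfline (\<lambda>x. (norm (g x))\<^sup>2)"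
    using H1_halfD[OF H] by (intro Bochner_Integration.integral_add) (auto simp: L2_half_def)
  finally have B: "integral\<^sup>L halfline (\<lambda>x. norm (?h' x)) \<le> \<dots>" .
  have "norm (integral {0..x} ?h') = norm (integral\<^sup>L halfline (\<lambda>t. indicator {..x} t *\<^sub>R ?h' t))"
    using halfline_integral_Icc(1)[OF indef_intD(1)[OF i x]] by simp
  also have "\<dots> \<le> integral\<^sup>L halfline (\<lambda>t. norm (indicator {..x} t *\<^sub>R ?h' t))"
    by (rule integral_norm_bound)
  also have "\<dots> \<le> integral\<^sup>L halfline (\<lambda>x. norm (?h' x))"
    by (rule integral_mono[OF integrable_norm[OF halfline_integral_Icc(2)[OF indef_intD(1)[OF i x]]] n])
       (auto simp: indicator_def)
  finally have 1: "norm (integral {0..x} ?h') \<le> integral\<^sup>L halfline (\<lambda>x. norm (?h' x))" .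
  have "norm (?h 0) = norm (integral\<^sup>L halfline ?h')" using P(1) by simp
  also have "\<dots> \<le> integral\<^sup>L halfline (\<lambda>x. norm (?h' x))" by (rule integral_norm_bound)
  finally have 2: "norm (?h 0) \<le> integral\<^sup>L halfline (\<lambda>x. norm (?h' x))" .
  have "(norm (f x))\<^sup>2 = norm (?h x)" by (simp add: norm_mult power2_eq_square)
  also have "\<dots> = norm (?h 0 + integral {0..x} ?h')" using indef_intD(2)[OF i x] by simp
  also have "\<dots> \<le> norm (?h 0) + norm (integral {0..x} ?h')" by (rule norm_triangle_ineq)
  also have "\<dots> \<le> (integral\<^sup>L halfline (\<lambda>x. (norm (f x))\<^sup>2) + integral\<^sup>L halfline (\<lambda>x. (norm (g x))\<^sup>2)) +
      (integral\<^sup>L halfline (\<lambda>x. (norm (f x))\<^sup>2) + integral\<^sup>L halfline (\<lambda>x. (norm (g x))\<^sup>2))"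
    by (intro add_mono order_trans[OF 2 B] order_trans[OF 1 B])
  finally show ?thesis by simp
qed

lemma H1_half_bounded:
  assumes "H1_half f g"
  obtains B where "B > 0" "\<And>x. x \<ge> 0 \<Longrightarrow> norm (f x) \<le> B"
proof -
  define S where "S = 2 * (integral\<^sup>L halfline (\<lambda>x. (norm (f x))\<^sup>2) + integral\<^sup>L halfline (\<lambda>x. (norm (g x))\<^sup>2))"
  have "norm (f x) \<le> sqrt S + 1" if "x \<ge> 0" for x
    using real_le_rsqrt[OF H1_half_bound[OF assms that]] by (simp add: S_def)
  moreover have "S \<ge> 0" using H1_half_bound[OF assms, of 0] by (simp add: S_def order_trans[OF zero_le_power2])
  ultimately show ?thesis using that[of "sqrt S + 1"] by (simp add: add_nonneg_pos)
qed

text \<open>Boundedness gives \<bar>f\<bar>^6 \<le> B^4 \<bar>f\<bar>^2. Integrability is essential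
  here: otherwise the sextic integral would silently take the default value 0.\<close>

lemma H1_half_power6:
  assumes "H1_half f g"
  shows "integrable halfline (\<lambda>x. (norm (f x)) ^ 6)"
proof -
  obtain B where B: "B > 0" "\<And>x. x \<ge> 0 \<Longrightarrow> norm (f x) \<le> B" using H1_half_bounded[OF assms] by metis
  show ?thesis
  proof (rule Bochner_Integration.integrable_bound)
    show "integrable halfline (\<lambda>x. B ^ 4 * (norm (f x))\<^sup>2)"
      using H1_halfD[OF assms] by (auto simp: L2_half_def)
    show "(\<lambda>x. (norm (f x)) ^ 6) \<in> borel_measurable halfline"
      using H1_halfD[OF assms] by (auto simp: L2_half_def)
    show "AE x in halfline. norm ((norm (f x)) ^ 6) \<le> norm (B ^ 4 * (norm (f x))\<^sup>2)"
    proof (rule AE_I2)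
      fix x assume "x \<in> space halfline"
      then have "norm (f x) ^ 4 \<le> B ^ 4" using B by (intro power_mono) auto
      then have "norm (f x) ^ 4 * (norm (f x))\<^sup>2 \<le> B ^ 4 * (norm (f x))\<^sup>2" by (intro mult_right_mono) auto
      then show "norm ((norm (f x)) ^ 6) \<le> norm (B ^ 4 * (norm (f x))\<^sup>2)"
        by (simp add: power_add[symmetric])
    qed
  qed
qed

section \<open>Weak derivatives on the half-line\<close>

lemma compact_in_halfline:
  assumes "compact K" "K \<subseteq> {0<..}"
  obtains a b :: real where "0 < a" "a < b" "K \<subseteq> {a..b}"
proof (cases "K = {}")
  case True
  then show ?thesis using that[of 1 2] by auto
next
  case False
  obtain s t where s: "s \<in> K" "\<forall>x\<in>K. s \<le> x" and t: "t \<in> K" "\<forall>x\<in>K. x \<le> t"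
    using compact_attains_inf[OF assms(1) False] compact_attains_sup[OF assms(1) False] by metis
  \<comment> \<open>The added 1 keeps the interval nondegenerate when \<open>K\<close> is a single
    point.\<close>
  show ?thesis by (rule that[of s "t+1"]) (use s t assms in force)+
qed

section \<open>C1 bumps and test functions on the half-line\<close>

lemma has_real_derivative_max_0_square:
  "((\<lambda>y::real. (max 0 y)\<^sup>2) has_real_derivative 2 * max 0 y) (at y)"
proof -
  consider "y > 0" | "y < 0" | "y = 0" by linarith
  then show ?thesis
  proof cases
    case 1
    have "((\<lambda>y::real. y\<^sup>2) has_real_derivative 2 * max 0 y) (at y)"
      using 1 by (auto intro!: derivative_eq_intros)
    then show ?thesis
      by (rule DERIV_cong_ev[OF refl _ refl, THEN iffD1, rotated])
         (rule eventually_mono[OF eventually_nhds_in_open[of "{0<..}"]], use 1 in auto)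
  next
    case 2
    have "((\<lambda>y::real. 0) has_real_derivative 2 * max 0 y) (at y)" using 2 by simp
    then show ?thesis
      by (rule DERIV_cong_ev[OF refl _ refl, THEN iffD1, rotated])
         (rule eventually_mono[OF eventually_nhds_in_open[of "{..<0}"]], use 2 in auto)
  next
    case 3
    have "((\<lambda>h::real. max 0 h) \<longlongrightarrow> max 0 0) (at 0)" by (intro tendsto_intros)
    moreover have "max 0 h = (max 0 h)\<^sup>2 / h" if "h \<noteq> 0" for h :: real
      using that by (auto simp: max_def power2_eq_square)
    then have "eventually (\<lambda>h::real. max 0 h = (max 0 h)\<^sup>2 / h) (at 0)"
      by (auto simp: eventually_at intro!: exI[of _ 1])
    ultimately have "((\<lambda>h::real. (max 0 h)\<^sup>2 / h) \<longlongrightarrow> max 0 0) (at 0)"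
      by (rule Lim_transform_eventually)
    then show ?thesis using 3 by (simp add: DERIV_def)
  qed
qed

text \<open>Squaring the positive part of the parabola makes it C1 across its two zeros, so for
  \<open>a < b\<close> this is a test function that is positive exactly on the open
  interval.\<close>

definition bump :: "real \<Rightarrow> real \<Rightarrow> real \<Rightarrow> real" where
  "bump a b x = (max 0 ((x - a) * (b - x)))\<^sup>2"

definition bump' :: "real \<Rightarrow> real \<Rightarrow> real \<Rightarrow> real" where
  "bump' a b x = 2 * max 0 ((x - a) * (b - x)) * (a + b - 2 * x)"

lemma bump_deriv: "(bump a b has_real_derivative bump' a b x) (at x)"
proof -
  have "((\<lambda>x. (x - a) * (b - x)) has_real_derivative (a + b - 2 * x)) (at x)"
    by (auto intro!: derivative_eq_intros simp: algebra_simps)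
  from DERIV_chain2[OF has_real_derivative_max_0_square this]
  show ?thesis by (simp add: bump_def[abs_def] bump'_def)
qed

lemma bump_outside: "a \<le> b \<Longrightarrow> x \<notin> {a<..<b} \<Longrightarrow> bump a b x = 0"
proof -
  assume "a \<le> b" "x \<notin> {a<..<b}"
  then have "(x - a) * (b - x) \<le> 0"
    by (cases "x \<le> a") (auto intro: mult_nonpos_nonneg mult_nonneg_nonpos)
  then show "bump a b x = 0" by (simp add: bump_def)
qed

lemma bump_pos: "a < x \<Longrightarrow> x < b \<Longrightarrow> bump a b x > 0"
  by (auto simp: bump_def max_def not_le intro: mult_pos_pos)

lemma bump_nonneg: "bump a b x \<ge> 0"
  by (simp add: bump_def)

lemma continuous_on_bump: "continuous_on S (bump a b)"
  unfolding bump_def by (intro continuous_intros)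

lemma continuous_on_bump': "continuous_on S (bump' a b)"
  unfolding bump'_def by (intro continuous_intros)

lemma test_functions_halfline_iff:
  "\<phi> \<in> test_functions {0<..} \<longleftrightarrow> \<phi> C1_differentiable_on UNIV \<and>
      (\<exists>a b. 0 < a \<and> a < b \<and> (\<forall>x. x \<notin> {a..b} \<longrightarrow> \<phi> x = 0))"
proof
  assume "\<phi> \<in> test_functions {0<..}"
  then obtain K where K: "\<phi> C1_differentiable_on UNIV" "compact K" "K \<subseteq> {0<..}" "\<forall>x. x \<notin> K \<longrightarrow> \<phi> x = 0"
    unfolding test_functions_def by blast
  from compact_in_halfline[OF K(2,3)] obtain a b where "0 < a" "a < b" "K \<subseteq> {a..b}" .
  then show "\<phi> C1_differentiable_on UNIV \<and>
      (\<exists>a b. 0 < a \<and> a < b \<and> (\<forall>x. x \<notin> {a..b} \<longrightarrow> \<phi> x = 0))"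
    using K by blast
next
  assume "\<phi> C1_differentiable_on UNIV \<and>
      (\<exists>a b. 0 < a \<and> a < b \<and> (\<forall>x. x \<notin> {a..b} \<longrightarrow> \<phi> x = 0))"
  then obtain a b where ab: "\<phi> C1_differentiable_on UNIV" "0 < a" "a < b" "\<forall>x. x \<notin> {a..b} \<longrightarrow> \<phi> x = 0"
    by blast
  then have "compact {a..b}" "{a..b} \<subseteq> {0<..}" by auto
  with ab show "\<phi> \<in> test_functions {0<..}" unfolding test_functions_def by blast
qed

lemma C1_deriv:
  assumes "\<phi> C1_differentiable_on UNIV"
  shows "(\<phi> has_real_derivative deriv \<phi> x) (at x)" "continuous_on S (deriv \<phi>)" "continuous_on S \<phi>"
proof -
  obtain D where D: "\<And>x. (\<phi> has_vector_derivative D x) (at x)" "continuous_on UNIV D"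
    using assms unfolding C1_differentiable_on_def by blast
  have d: "(\<phi> has_real_derivative D x) (at x)" for x
    using D(1) by (simp add: has_real_derivative_iff_has_vector_derivative)
  have e: "deriv \<phi> = D" using d by (intro ext DERIV_imp_deriv)
  show "(\<phi> has_real_derivative deriv \<phi> x) (at x)" unfolding e by (rule d)
  show "continuous_on S (deriv \<phi>)" unfolding e by (rule continuous_on_subset[OF D(2)]) auto
  show "continuous_on S \<phi>"
    using d by (meson DERIV_isCont continuous_at_imp_continuous_on)
qed

lemma deriv_outside_support:
  assumes "\<phi> C1_differentiable_on UNIV" "\<forall>x. x \<notin> {a..b} \<longrightarrow> \<phi> x = 0" "x \<notin> {a..b}"
  shows "deriv \<phi> x = 0"
proof -
  have "(\<phi> has_real_derivative 0) (at x)"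
  proof (rule DERIV_cong_ev[OF refl _ refl, THEN iffD1])
    show "((\<lambda>_. 0) has_real_derivative 0) (at x)" by simp
    show "\<forall>\<^sub>F y in nhds x. 0 = \<phi> y"
      by (rule eventually_mono[OF eventually_nhds_in_open[of "- {a..b}"]]) (use assms in auto)
  qed
  then show ?thesis by (rule DERIV_imp_deriv)
qed

lemma integrable_continuous_support_mult:
  fixes u :: "real \<Rightarrow> 'a::euclidean_space" and \<psi> :: "real \<Rightarrow> real"
  assumes u: "u absolutely_integrable_on {a..b}" and c: "continuous_on {a..b} \<psi>"
    and z: "\<And>x. x \<notin> {a..b} \<Longrightarrow> \<psi> x = 0"
  shows "integrable lebesgue (\<lambda>x. \<psi> x *\<^sub>R u x)" "integrable halfline (\<lambda>x. \<psi> x *\<^sub>R u x)"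
proof -
  have bl: "bilinear (\<lambda>x (y::'a). x *\<^sub>R y)"
    by (simp add: bilinear_conv_bounded_bilinear bounded_bilinear_scaleR)
  have "(\<lambda>x. \<psi> x *\<^sub>R u x) absolutely_integrable_on {a..b}"
    by (rule absolutely_integrable_bounded_measurable_product[OF bl _ _ _ u])
       (auto intro!: continuous_imp_measurable_on_sets_lebesgue c compact_imp_bounded compact_continuous_image)
  moreover have "(\<lambda>x. indicator {a..b} x *\<^sub>R \<psi> x *\<^sub>R u x) = (\<lambda>x. \<psi> x *\<^sub>R u x)"
    using z by (auto simp: indicator_def fun_eq_iff)
  ultimately show i: "integrable lebesgue (\<lambda>x. \<psi> x *\<^sub>R u x)" by (simp add: set_integrable_def)
  show "integrable halfline (\<lambda>x. \<psi> x *\<^sub>R u x)"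
    unfolding integrable_halfline_iff set_integrable_def
    using integrable_mult_indicator[OF _ i, of "{0<..}"] by simp
qed

lemma locally_integrable_halfline_iff:
  "locally_integrable {0<..} u \<longleftrightarrow> (\<forall>a b. 0 < a \<and> a < b \<longrightarrow> u absolutely_integrable_on {a..b})"
proof
  assume "locally_integrable {0<..} u"
  then show "\<forall>a b. 0 < a \<and> a < b \<longrightarrow> u absolutely_integrable_on {a..b}"
    unfolding locally_integrable_def by (simp add: subset_iff)
next
  assume A: "\<forall>a b. 0 < a \<and> a < b \<longrightarrow> u absolutely_integrable_on {a..b}"
  show "locally_integrable {0<..} u"
    unfolding locally_integrable_def
  proof (intro allI impI)
    fix K :: "real set" assume K: "compact K \<and> K \<subseteq> {0<..}"
    then obtain a b where "0 < a" "a < b" "K \<subseteq> {a..b}" using compact_in_halfline by metis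
    with A K show "u absolutely_integrable_on K"
      using set_integrable_subset[of lebesgue "{a..b}" u K] by (auto intro: lmeasurable_compact fmeasurableD)
  qed
qed

lemma L2_half_locally_integrable:
  assumes "L2_half u"
  shows "locally_integrable {0<..} u"
  unfolding locally_integrable_halfline_iff
  using absolutely_integrable_on_subinterval[OF L2_half_abs_integrable[OF assms]]
  by (meson atLeastatMost_subset_iff less_imp_le order_refl)

text \<open>The test functions are \<open>\<chi> p\<^sub>n\<close>, where \<open>\<chi>\<close> is a bump and the polynomials \<open>p\<^sub>n\<close> approximate
  the sign of \<open>d\<close>, which is a limit almost everywhere of continuous functions.\<close>

lemma fundamental_lemma_real:
  fixes d :: "real \<Rightarrow> real"
  assumes ab: "a < b" and d: "d absolutely_integrable_on {a..b}"
    and test: "\<And>\<phi>. \<phi> C1_differentiable_on UNIV \<Longrightarrow> (\<And>x. x \<notin> {a..b} \<Longrightarrow> \<phi> x = 0) \<Longrightarrow>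
      integral\<^sup>L lebesgue (\<lambda>x. \<phi> x * d x) = 0"
  shows "AE x in lebesgue. x \<in> {a<..<b} \<longrightarrow> d x = 0"
proof -
  \<comment> \<open>Truncating \<open>d\<close> to the interval makes it integrable and measurable
    on the whole line; multiplication by the bump hides the difference.\<close>
  define e where "e x = indicator {a..b} x * d x" for x
  have bo: "bump a b x = 0" if "x \<notin> {a..b}" for x
    using bump_outside[of a b x] ab that by auto
  have be: "bump a b x * d x = bump a b x * e x" for x
    by (cases "x \<in> {a..b}") (simp_all add: e_def bo)
  have ei: "integrable lebesgue e" using d by (simp add: set_integrable_def e_def[abs_def])
  have "(\<lambda>x. sgn (e x)) \<in> borel_measurable lebesgue" using ei by auto
  then have "(\<lambda>x. sgn (e x)) measurable_on UNIV"
    by (simp add: measurable_on_iff_borel_measurable lebesgue_on_UNIV_eq)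
  then obtain N g where N: "negligible N" and g: "\<And>n. continuous_on UNIV (g n)"
    and lim: "\<And>x. x \<notin> N \<Longrightarrow> (\<lambda>n. g n x) \<longlonglongrightarrow> sgn (e x)"
    unfolding measurable_on_def by auto
  \<comment> \<open>Clamping to [-1, 1] fixes every value of \<open>sgn\<close>, so the almost
    everywhere limit is unchanged. The polynomials, which stay within 1 of the clamped functions,
    are then bounded by 2 on the interval, as dominated convergence needs.\<close>
  define cl where "cl y = max (-1) (min 1 y)" for y :: real
  have "\<exists>p. real_polynomial_function p \<and> (\<forall>x\<in>{a..b}. \<bar>cl (g n x) - p x\<bar> < 1 / (real n + 1))" for n :: nat
  proof -
    have "continuous_on {a..b} (\<lambda>x. cl (g n x))"
      unfolding cl_def by (intro continuous_intros continuous_on_subset[OF g]) auto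
    then show ?thesis
      by (rule Stone_Weierstrass_real_polynomial_function[OF compact_Icc, where e="1 / (real n + 1)"]) auto
  qed
  then obtain p where p: "\<And>n. real_polynomial_function (p n)"
    "\<And>n x. x \<in> {a..b} \<Longrightarrow> \<bar>cl (g n x) - p n x\<bar> < 1 / (real n + 1)" by metis
  have z: "integral\<^sup>L lebesgue (\<lambda>x. bump a b x * p n x * e x) = 0" for n
  proof -
    obtain p' where p': "\<And>x. (p n has_real_derivative p' x) (at x)" "real_polynomial_function p'"
      using has_real_derivative_polynomial_function[OF p(1)[of n]] by metis
    have "(\<lambda>x. bump a b x * p n x) C1_differentiable_on UNIV"
      unfolding C1_differentiable_on_def
    proof (intro exI conjI ballI)
      show "((\<lambda>x. bump a b x * p n x) has_vector_derivative (bump' a b x * p n x + p' x * bump a b x)) (at x)" for x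
        using DERIV_mult[OF bump_deriv p'(1)] by (simp add: has_real_derivative_iff_has_vector_derivative)
      show "continuous_on UNIV (\<lambda>x. bump' a b x * p n x + p' x * bump a b x)"
        using p(1)[of n] p'(2)
        by (intro continuous_intros continuous_on_bump continuous_on_bump' continuous_on_polymonial_function)
           (simp_all add: real_polynomial_function_eq)
    qed
    then have "integral\<^sup>L lebesgue (\<lambda>x. bump a b x * p n x * d x) = 0"
      by (rule test) (simp add: bo)
    moreover have "(\<lambda>x. bump a b x * p n x * d x) = (\<lambda>x. bump a b x * p n x * e x)"
      using be by (simp add: fun_eq_iff) metis
    ultimately show ?thesis by simp
  qed
  have "bounded (bump a b ` {a..b})"
    by (intro compact_imp_bounded compact_continuous_image continuous_on_bump) auto
  then obtain M where "\<forall>y\<in>bump a b ` {a..b}. norm y \<le> M" unfolding bounded_iff by blast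
  then have M: "\<bar>bump a b x\<bar> \<le> M" if "x \<in> {a..b}" for x using that by auto
  have M0: "M \<ge> 0" using M[of a] ab by auto
  have "(\<lambda>n. integral\<^sup>L lebesgue (\<lambda>x. bump a b x * p n x * e x)) \<longlonglongrightarrow>
      integral\<^sup>L lebesgue (\<lambda>x. bump a b x * sgn (e x) * e x)"
  proof (rule integral_dominated_convergence)
    have bm: "(\<lambda>x. bump a b x) \<in> borel_measurable lebesgue"
      by (intro continuous_imp_measurable_on_sets_lebesgue[where S=UNIV, unfolded lebesgue_on_UNIV_eq] continuous_on_bump) auto
    show "(\<lambda>x. bump a b x * sgn (e x) * e x) \<in> borel_measurable lebesgue"
      using ei bm by auto
    have "p n \<in> borel_measurable lebesgue" for n
      using p(1)[of n]
      by (intro continuous_imp_measurable_on_sets_lebesgue[where S=UNIV, unfolded lebesgue_on_UNIV_eq] continuous_on_polymonial_function) (auto simp: real_polynomial_function_eq)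
    then show "(\<lambda>x. bump a b x * p n x * e x) \<in> borel_measurable lebesgue" for n
      using ei bm by auto
    show "integrable lebesgue (\<lambda>x. M * 2 * \<bar>e x\<bar>)" using ei by auto
    show "AE x in lebesgue. norm (bump a b x * p n x * e x) \<le> M * 2 * \<bar>e x\<bar>" for n
    proof (rule AE_I2)
      fix x
      show "norm (bump a b x * p n x * e x) \<le> M * 2 * \<bar>e x\<bar>"
      proof (cases "x \<in> {a..b}")
        case True
        have "\<bar>cl (g n x) - p n x\<bar> < 1" by (rule less_le_trans[OF p(2)[OF True]]) simp
        moreover have "\<bar>cl (g n x)\<bar> \<le> 1" by (auto simp: cl_def)
        ultimately have "\<bar>p n x\<bar> \<le> 2" by linarith
        then show ?thesis using M[OF True] M0
          by (auto simp: abs_mult intro!: mult_mono)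
      qed (simp add: e_def)
    qed
    have "AE x in lebesgue. x \<notin> N"
      using N negligible_iff_null_sets AE_not_in by blast
    then show "AE x in lebesgue. (\<lambda>n. bump a b x * p n x * e x) \<longlonglongrightarrow> bump a b x * sgn (e x) * e x"
    proof eventually_elim
      case (elim x)
      show ?case
      proof (cases "x \<in> {a..b}")
        case True
        have c1: "(\<lambda>n. cl (g n x)) \<longlonglongrightarrow> cl (sgn (e x))"
          unfolding cl_def by (intro tendsto_intros lim elim)
        have c2: "cl (sgn (e x)) = sgn (e x)" by (auto simp: cl_def sgn_if)
        have "(\<lambda>n. cl (g n x) - p n x) \<longlonglongrightarrow> 0"
        proof (rule Lim_null_comparison)
          show "\<forall>\<^sub>F n in sequentially. norm (cl (g n x) - p n x) \<le> 1 / (real n + 1)"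
            using p(2)[OF True] by (intro always_eventually) (auto intro: less_imp_le)
          show "(\<lambda>n. 1 / (real n + 1)) \<longlonglongrightarrow> 0"
            using LIMSEQ_inverse_real_of_nat by (simp add: inverse_eq_divide add.commute)
        qed
        from tendsto_diff[OF c1 this] have "(\<lambda>n. p n x) \<longlonglongrightarrow> sgn (e x)" by (simp add: c2)
        then show ?thesis by (intro tendsto_intros)
      qed (simp add: e_def)
    qed
  qed
  then have "(\<lambda>n::nat. 0) \<longlonglongrightarrow> integral\<^sup>L lebesgue (\<lambda>x. bump a b x * sgn (e x) * e x)"
    by (simp add: z)
  then have "0 = integral\<^sup>L lebesgue (\<lambda>x. bump a b x * sgn (e x) * e x)"
    by (intro LIMSEQ_unique[OF tendsto_const])
  moreover have "bump a b x * sgn (e x) * e x = bump a b x * \<bar>e x\<bar>" for x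
    by (simp add: sgn_mult_self_eq abs_sgn mult.assoc mult.commute)
  ultimately have i0: "integral\<^sup>L lebesgue (\<lambda>x. bump a b x * \<bar>e x\<bar>) = 0" by simp
  have "(\<lambda>x. \<bar>d x\<bar>) absolutely_integrable_on {a..b}" using d by (rule set_integrable_abs)
  from integrable_continuous_support_mult(1)[OF this continuous_on_bump, of a b]
  have "integrable lebesgue (\<lambda>x. bump a b x *\<^sub>R \<bar>d x\<bar>)"
    by (simp add: bo)
  moreover have "(\<lambda>x. bump a b x *\<^sub>R \<bar>d x\<bar>) = (\<lambda>x. bump a b x * \<bar>e x\<bar>)"
    using be by (simp add: fun_eq_iff) metis
  ultimately have "integrable lebesgue (\<lambda>x. bump a b x * \<bar>e x\<bar>)" by simp
  then have "AE x in lebesgue. bump a b x * \<bar>e x\<bar> = 0"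
    using i0 by (subst (asm) integral_nonneg_eq_0_iff_AE) (auto simp: bump_nonneg)
  then show ?thesis
    by eventually_elim (use bump_pos[of a _ b] in \<open>force simp: e_def indicator_def\<close>)
qed

lemma AE_halfline_if_intervals:
  assumes "\<And>a b::real. 0 < a \<Longrightarrow> a < b \<Longrightarrow> AE x in lebesgue. x \<in> {a<..<b} \<longrightarrow> P x"
  shows "AE x in halfline. P x"
proof -
  \<comment> \<open>Countably many intervals exhaust the half-line; the shift by 2 keeps the
    interval nondegenerate already for \<open>n = 0\<close>.\<close>
  have "AE x in lebesgue. \<forall>n::nat. x \<in> {1 / (real n + 2)<..<real n + 2} \<longrightarrow> P x"
    unfolding AE_all_countable
  proof (intro allI assms)
    fix n :: nat
    have "1 / (real n + 2) < 1" by simp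
    then show "1 / (real n + 2) < real n + 2" by linarith
  qed simp
  then show ?thesis
    unfolding AE_halfline_iff
  proof eventually_elim
    case (elim x)
    show ?case
    proof
      assume x: "0 < x"
      obtain n1 where n1: "1 / x < real n1" using reals_Archimedean2 by blast
      obtain n2 where n2: "x < real n2" using reals_Archimedean2 by blast
      define n where "n = max n1 n2"
      have "1 / x < real n + 2" "x < real n + 2" using n1 n2 unfolding n_def by auto
      moreover from this have "1 / (real n + 2) < x" using x by (simp add: field_simps)
      ultimately show "P x" using elim by auto
    qed
  qed
qed

lemma fundamental_lemma:
  assumes d: "locally_integrable {0<..} d"
    and test: "\<And>\<phi>. \<phi> \<in> test_functions {0<..} \<Longrightarrow> integral\<^sup>L halfline (\<lambda>x. \<phi> x *\<^sub>R d x) = 0"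
  shows "AE x in halfline. d x = 0"
proof (rule AE_halfline_if_intervals)
  fix a b :: real assume ab: "0 < a" "a < b"
  have di: "d absolutely_integrable_on {a..b}"
    using d ab unfolding locally_integrable_halfline_iff by auto
  have t: "integral\<^sup>L lebesgue (\<lambda>x. \<phi> x *\<^sub>R d x) = 0" and ti: "integrable lebesgue (\<lambda>x. \<phi> x *\<^sub>R d x)"
    if "\<phi> C1_differentiable_on UNIV" "\<And>x. x \<notin> {a..b} \<Longrightarrow> \<phi> x = 0" for \<phi>
  proof -
    have "\<phi> \<in> test_functions {0<..}" unfolding test_functions_halfline_iff using that ab by blast
    from test[OF this] have "(LINT x:{0<..}|lebesgue. \<phi> x *\<^sub>R d x) = 0"
      by (simp add: halfline_set_integral)
    moreover have "(\<lambda>x. indicator {0<..} x *\<^sub>R (\<phi> x *\<^sub>R d x)) = (\<lambda>x. \<phi> x *\<^sub>R d x)"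
      using that(2) ab by (force simp: fun_eq_iff indicator_def)
    ultimately show "integral\<^sup>L lebesgue (\<lambda>x. \<phi> x *\<^sub>R d x) = 0"
      by (simp add: set_lebesgue_integral_def)
    show "integrable lebesgue (\<lambda>x. \<phi> x *\<^sub>R d x)"
      by (rule integrable_continuous_support_mult(1)[OF di C1_deriv(3)[OF that(1)] that(2)])
  qed
  have "AE x in lebesgue. x \<in> {a<..<b} \<longrightarrow> Re (d x) = 0"
  proof (rule fundamental_lemma_real[OF ab(2)])
    show "(\<lambda>x. Re (d x)) absolutely_integrable_on {a..b}"
      using absolutely_integrable_linear[OF di bounded_linear_Re] by (simp add: o_def)
    fix \<phi> :: "real \<Rightarrow> real" assume "\<phi> C1_differentiable_on UNIV" "\<And>x. x \<notin> {a..b} \<Longrightarrow> \<phi> x = 0"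
    from integral_bounded_linear[OF bounded_linear_Re ti[OF this]] t[OF this]
    show "integral\<^sup>L lebesgue (\<lambda>x. \<phi> x * Re (d x)) = 0" by simp
  qed
  moreover have "AE x in lebesgue. x \<in> {a<..<b} \<longrightarrow> Im (d x) = 0"
  proof (rule fundamental_lemma_real[OF ab(2)])
    show "(\<lambda>x. Im (d x)) absolutely_integrable_on {a..b}"
      using absolutely_integrable_linear[OF di bounded_linear_Im] by (simp add: o_def)
    fix \<phi> :: "real \<Rightarrow> real" assume "\<phi> C1_differentiable_on UNIV" "\<And>x. x \<notin> {a..b} \<Longrightarrow> \<phi> x = 0"
    from integral_bounded_linear[OF bounded_linear_Im ti[OF this]] t[OF this]
    show "integral\<^sup>L lebesgue (\<lambda>x. \<phi> x * Im (d x)) = 0" by simp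
  qed
  ultimately show "AE x in lebesgue. x \<in> {a<..<b} \<longrightarrow> d x = 0"
    by eventually_elim (auto simp: complex_eq_iff)
qed

section \<open>Uniqueness of weak derivatives and integration by parts against test
  functions\<close>

lemma locally_integrable_halfline_diff:
  assumes "locally_integrable {0<..} u" "locally_integrable {0<..} v"
  shows "locally_integrable {0<..} (\<lambda>x. u x - v x)"
  using assms unfolding locally_integrable_def by (auto intro: set_integral_diff)

lemma integrable_test_mult:
  assumes "locally_integrable {0<..} u" "\<phi> \<in> test_functions {0<..}"
  shows "integrable halfline (\<lambda>x. \<phi> x *\<^sub>R u x)" "integrable halfline (\<lambda>x. deriv \<phi> x *\<^sub>R u x)"
proof -
  obtain a b where ab: "0 < a" "a < b" and z: "\<forall>x. x \<notin> {a..b} \<longrightarrow> \<phi> x = 0"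
    and c: "\<phi> C1_differentiable_on UNIV"
    using assms(2) unfolding test_functions_halfline_iff by blast
  have u: "u absolutely_integrable_on {a..b}"
    using assms(1) ab unfolding locally_integrable_halfline_iff by blast
  show "integrable halfline (\<lambda>x. \<phi> x *\<^sub>R u x)"
    by (rule integrable_continuous_support_mult(2)[OF u C1_deriv(3)[OF c]]) (use z in auto)
  show "integrable halfline (\<lambda>x. deriv \<phi> x *\<^sub>R u x)"
    by (rule integrable_continuous_support_mult(2)[OF u C1_deriv(2)[OF c]])
       (use deriv_outside_support[OF c z] in auto)
qed

lemma is_weak_deriv_halfline_iff:
  "is_weak_deriv {0<..} u g \<longleftrightarrow> locally_integrable {0<..} u \<and> locally_integrable {0<..} g \<and>
     (\<forall>\<phi>\<in>test_functions {0<..}.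
        integral\<^sup>L halfline (\<lambda>x. deriv \<phi> x *\<^sub>R u x) = - integral\<^sup>L halfline (\<lambda>x. \<phi> x *\<^sub>R g x))"
  by (simp add: is_weak_deriv_def halfline_set_integral)

text \<open>This makes the arbitrary choice in \<open>weak_deriv\<close> harmless: the difference of
  two candidates annihilates all test functions.\<close>

lemma weak_deriv_halfline_unique:
  assumes "is_weak_deriv {0<..} u g" "is_weak_deriv {0<..} u g'"
  shows "AE x in halfline. g x = g' x"
proof -
  note A = assms[unfolded is_weak_deriv_halfline_iff]
  have "AE x in halfline. g x - g' x = 0"
  proof (rule fundamental_lemma)
    show "locally_integrable {0<..} (\<lambda>x. g x - g' x)"
      using A by (intro locally_integrable_halfline_diff) auto
    fix \<phi> assume p: "\<phi> \<in> test_functions {0<..}"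
    have "integral\<^sup>L halfline (\<lambda>x. \<phi> x *\<^sub>R (g x - g' x)) =
        integral\<^sup>L halfline (\<lambda>x. \<phi> x *\<^sub>R g x) - integral\<^sup>L halfline (\<lambda>x. \<phi> x *\<^sub>R g' x)"
      unfolding scaleR_diff_right using A p
      by (intro Bochner_Integration.integral_diff integrable_test_mult) auto
    also have "\<dots> = 0" using A p by auto
    finally show "integral\<^sup>L halfline (\<lambda>x. \<phi> x *\<^sub>R (g x - g' x)) = 0" .
  qed
  then show ?thesis by simp
qed

lemma indef_int_test_parts:
  assumes v: "indef_int v g" and p: "\<phi> \<in> test_functions {0<..}"
    and lv: "locally_integrable {0<..} v" and lg: "locally_integrable {0<..} g"
  shows "integral\<^sup>L halfline (\<lambda>x. deriv \<phi> x *\<^sub>R v x) = - integral\<^sup>L halfline (\<lambda>x. \<phi> x *\<^sub>R (g x :: complex))"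
proof -
  obtain a b where ab: "0 < a" "a < b" and z: "\<forall>x. x \<notin> {a..b} \<longrightarrow> \<phi> x = 0"
    and c: "\<phi> C1_differentiable_on UNIV"
    using p unfolding test_functions_halfline_iff by blast
  have i: "indef_int (\<lambda>x. complex_of_real (\<phi> x)) (\<lambda>x. complex_of_real (deriv \<phi> x))"
  proof (rule indef_int_bounded_linear[OF bounded_linear_of_real], rule indef_int_C1)
    show "(\<phi> has_vector_derivative deriv \<phi> x) (at x within {0..})" for x
      using C1_deriv(1)[OF c, of x]
      by (simp add: has_real_derivative_iff_has_vector_derivative has_vector_derivative_at_within)
    show "continuous_on {0..} (deriv \<phi>)" by (rule C1_deriv(2)[OF c])
  qed
  note I = integrable_test_mult[OF lg p] integrable_test_mult[OF lv p]
  have "integral\<^sup>L halfline (\<lambda>x. of_real (\<phi> x) * g x + of_real (deriv \<phi> x) * v x) = - (of_real (\<phi> 0) * v 0)"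
    by (rule indef_int_vanishes_at_infinity(2)[OF indef_int_mult[OF i v]])
       (use I in \<open>auto simp: scaleR_conv_of_real\<close>)
  moreover have "\<phi> 0 = 0" using z ab by auto
  ultimately have "integral\<^sup>L halfline (\<lambda>x. \<phi> x *\<^sub>R g x + deriv \<phi> x *\<^sub>R v x) = 0"
    by (simp add: scaleR_conv_of_real)
  then show ?thesis using I by (simp add: eq_neg_iff_add_eq_0 add.commute)
qed

lemma H1_half_is_weak_deriv:
  assumes H: "H1_half f g" and ae: "AE x in halfline. u x = f x" and gk: "AE x in halfline. g x = k x"
    and u: "u \<in> borel_measurable halfline" and k: "k \<in> borel_measurable halfline"
  shows "is_weak_deriv {0<..} u k"
proof -
  note h = H1_halfD[OF H]
  have U: "L2_half u" by (rule L2_half_cong_AE[OF h(1) _ u]) (use ae in auto)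
  have K: "L2_half k" by (rule L2_half_cong_AE[OF h(2) _ k]) (use gk in auto)
  show ?thesis
    unfolding is_weak_deriv_halfline_iff
  proof (intro conjI ballI L2_half_locally_integrable U K)
    fix \<phi> assume p: "\<phi> \<in> test_functions {0<..}"
    then have c: "\<phi> C1_differentiable_on UNIV" unfolding test_functions_halfline_iff by blast
    have m: "\<phi> \<in> borel_measurable halfline" "deriv \<phi> \<in> borel_measurable halfline"
      by (intro continuous_measurable_halfline C1_deriv c)+
    have "integral\<^sup>L halfline (\<lambda>x. deriv \<phi> x *\<^sub>R u x) = integral\<^sup>L halfline (\<lambda>x. deriv \<phi> x *\<^sub>R f x)"
      by (rule integral_cong_AE) (use m u h(1) ae in \<open>auto simp: L2_half_def\<close>)
    moreover have "integral\<^sup>L halfline (\<lambda>x. \<phi> x *\<^sub>R k x) = integral\<^sup>L halfline (\<lambda>x. \<phi> x *\<^sub>R g x)"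
      by (rule integral_cong_AE) (use m k h(2) gk in \<open>auto simp: L2_half_def\<close>)
    ultimately show "integral\<^sup>L halfline (\<lambda>x. deriv \<phi> x *\<^sub>R u x) = - integral\<^sup>L halfline (\<lambda>x. \<phi> x *\<^sub>R k x)"
      using indef_int_test_parts[OF h(3) p] h by (simp add: L2_half_locally_integrable)
  qed
qed

section \<open>The lemma of du Bois-Reymond and H1 representatives\<close>

lemma antiderivative_test_function:
  assumes c: "continuous_on UNIV \<theta>" and ab: "0 < a" "a < b" and z: "\<And>x. x \<notin> {a..b} \<Longrightarrow> \<theta> x = 0"
    and i0: "integral\<^sup>L halfline \<theta> = 0"
  obtains \<phi> where "\<phi> \<in> test_functions {0<..}" "deriv \<phi> = \<theta>"
proof -
  define \<phi> where "\<phi> x = integral {0..x} \<theta>" for x :: real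
  have ti: "\<theta> absolutely_integrable_on {x..y}" for x y
    using absolutely_integrable_continuous[of x y \<theta>] continuous_on_subset[OF c] by simp
  have tint: "\<theta> integrable_on {x..y}" for x y
    using integrable_continuous_real continuous_on_subset[OF c] by blast
  have z0: "integral {x..y} \<theta> = 0" if "\<And>t. t \<in> {x..y} \<Longrightarrow> t < a" for x y
    by (intro integral_unique has_integral_is_0) (use that z in force)
  have shift: "\<phi> y = integral {-R..y} \<theta>" if "R \<ge> 0" "-R \<le> y" for y R
  proof (cases "y \<ge> 0")
    case True
    have "integral {-R..0} \<theta> + integral {0..y} \<theta> = integral {-R..y} \<theta>"
      using that True by (intro Henstock_Kurzweil_Integration.integral_combine tint) auto
    then show ?thesis using z0[of "-R" 0] ab by (simp add: \<phi>_def)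
  next
    case False
    then show ?thesis using z0[of "-R" y] ab by (simp add: \<phi>_def)
  qed
  have der: "(\<phi> has_real_derivative \<theta> x) (at x)" for x
  proof -
    define R where "R = \<bar>x\<bar> + 1"
    have s: "\<phi> y = integral {-R..y} \<theta>" if "-R \<le> y" for y
      by (rule shift) (use that in \<open>auto simp: R_def\<close>)
    have xR: "-R < x" "x < R" by (auto simp: R_def)
    have "((\<lambda>u. integral {-R..u} \<theta>) has_vector_derivative \<theta> x) (at x within {-R..R})"
      by (rule integral_has_vector_derivative) (use xR in \<open>auto intro: continuous_on_subset[OF c]\<close>)
    then have "(\<phi> has_vector_derivative \<theta> x) (at x within {-R..R})"
      by (rule has_vector_derivative_transform[rotated 2]) (use xR in \<open>auto simp: s\<close>)
    moreover have "at x within {-R..R} = at x"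
      by (rule at_within_interior) (use xR in auto)
    ultimately show ?thesis by (simp add: has_real_derivative_iff_has_vector_derivative)
  qed
  have C1: "\<phi> C1_differentiable_on UNIV"
    unfolding C1_differentiable_on_def
    using der c by (auto simp: has_real_derivative_iff_has_vector_derivative)
  have out: "\<phi> x = 0" if "x \<notin> {a..b}" for x
  proof (cases "x < a")
    case True
    then show ?thesis unfolding \<phi>_def by (intro z0) auto
  next
    case False
    have "integral\<^sup>L halfline (\<lambda>t. indicator {..x} t *\<^sub>R \<theta> t) = integral\<^sup>L halfline \<theta>"
      by (rule Bochner_Integration.integral_cong) (use False that z in \<open>auto simp: indicator_def\<close>)
    then show ?thesis unfolding \<phi>_def halfline_integral_Icc(1)[OF ti, symmetric] using i0 by simp
  qed
  show ?thesis
  proof (rule that)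
    show "\<phi> \<in> test_functions {0<..}"
      unfolding test_functions_halfline_iff using C1 out ab by blast
    show "deriv \<phi> = \<theta>" using der by (intro ext DERIV_imp_deriv)
  qed
qed

text \<open>Every test function is a multiple of one fixed bump plus the derivative of another test
  function. The latter does not see \<open>w\<close>, so \<open>w\<close> acts on test functions
  like the constant given by its mean against the bump.\<close>

lemma du_Bois_Reymond:
  assumes w: "locally_integrable {0<..} w"
    and test: "\<And>\<phi>. \<phi> \<in> test_functions {0<..} \<Longrightarrow> integral\<^sup>L halfline (\<lambda>x. deriv \<phi> x *\<^sub>R w x) = 0"
  shows "\<exists>c. AE x in halfline. w x = c"
proof -
  define I where "I = integral\<^sup>L halfline (bump 1 2)"
  have c1: "(\<lambda>x. 1::real) absolutely_integrable_on {a..b}" for a b :: real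
    by (auto simp: absolutely_integrable_on_const)
  have bi: "integrable halfline (bump 1 2)"
  proof -
    have "bump 1 2 x = 0" if "x \<notin> {1..2}" for x using bump_outside[of 1 2 x] that by auto
    from integrable_continuous_support_mult(2)[OF c1 continuous_on_bump this] show ?thesis by simp
  qed
  have "I \<noteq> 0"
  proof
    assume "I = 0"
    then have "AE x in halfline. bump 1 2 x = 0"
      using bi by (simp add: I_def integral_nonneg_eq_0_iff_AE bump_nonneg)
    then have "AE x in lebesgue. x \<notin> {1<..<2::real}"
      unfolding AE_halfline_iff by eventually_elim (use bump_pos[of 1 _ 2] in force)
    then have "AE x in lebesgue. x \<in> - {1<..<2::real}" by simp
    \<comment> \<open>A closed set that contains almost every point contains every point; 3/2 is
      just one point of the bump's interval.\<close>
    then have "3/2 \<in> - {1<..<2::real}"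
      by (intro mem_closed_if_AE_lebesgue) auto
    then show False by simp
  qed
  define c where "c = integral\<^sup>L halfline (\<lambda>x. bump 1 2 x *\<^sub>R w x) / of_real I"
  have bt: "bump 1 2 \<in> test_functions {0<..}"
    unfolding test_functions_halfline_iff
  proof
    show "bump 1 2 C1_differentiable_on UNIV"
      unfolding C1_differentiable_on_def
      using bump_deriv continuous_on_bump'
      by (intro exI[of _ "bump' 1 2"]) (auto simp: has_real_derivative_iff_has_vector_derivative)
    have "\<forall>x. x \<notin> {1..2} \<longrightarrow> bump 1 2 x = 0" using bump_outside[of 1 2] by auto
    then show "\<exists>a b. 0 < a \<and> a < b \<and> (\<forall>x. x \<notin> {a..b} \<longrightarrow> bump 1 2 x = 0)"
      by (intro exI[of _ 1] exI[of _ 2]) auto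
  qed
  have wc: "locally_integrable {0<..} (\<lambda>x. w x - c)"
  proof (rule locally_integrable_halfline_diff[OF w])
    show "locally_integrable {0<..} (\<lambda>x. c)"
      unfolding locally_integrable_halfline_iff by (auto simp: absolutely_integrable_on_const)
  qed
  have "AE x in halfline. w x - c = 0"
  proof (rule fundamental_lemma[OF wc])
    fix \<psi> assume p: "\<psi> \<in> test_functions {0<..}"
    obtain a b where ab: "0 < a" "a < b" and z: "\<forall>x. x \<notin> {a..b} \<longrightarrow> \<psi> x = 0"
      and C: "\<psi> C1_differentiable_on UNIV"
      using p unfolding test_functions_halfline_iff by blast
    have pi: "integrable halfline \<psi>"
      using integrable_continuous_support_mult(2)[OF c1 C1_deriv(3)[OF C], of a b] z by auto
    \<comment> \<open>Chosen so that subtracting \<open>J\<close> bumps from \<open>\<psi>\<close>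
      leaves integral 0, the condition for having a compactly supported antiderivative.\<close>
    define J where "J = integral\<^sup>L halfline \<psi> / I"
    define \<theta> where "\<theta> x = \<psi> x - J * bump 1 2 x" for x
    have "integral\<^sup>L halfline \<theta> = integral\<^sup>L halfline \<psi> - J * I"
      unfolding \<theta>_def I_def using pi bi by (subst Bochner_Integration.integral_diff) auto
    then have i0: "integral\<^sup>L halfline \<theta> = 0" using \<open>I \<noteq> 0\<close> by (simp add: J_def)
    have tc: "continuous_on UNIV \<theta>"
      unfolding \<theta>_def by (intro continuous_intros C1_deriv[OF C] continuous_on_bump)
    have tz: "\<theta> x = 0" if "x \<notin> {min a 1..max b 2}" for x
    proof -
      have "x \<notin> {a..b}" "x \<notin> {1<..<2}" using that by auto
      then show ?thesis using z bump_outside[of 1 2 x] by (simp add: \<theta>_def)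
    qed
    have mm: "0 < min a 1" "min a 1 < max b 2" using ab by auto
    obtain \<phi> where "\<phi> \<in> test_functions {0<..}" "deriv \<phi> = \<theta>"
      by (rule antiderivative_test_function[OF tc mm tz i0])
    from test[OF this(1)] this(2) have t0: "integral\<^sup>L halfline (\<lambda>x. \<theta> x *\<^sub>R w x) = 0" by simp
    have I1: "integrable halfline (\<lambda>x. \<psi> x *\<^sub>R w x)" "integrable halfline (\<lambda>x. bump 1 2 x *\<^sub>R w x)"
      by (intro integrable_test_mult w p bt)+
    have "integral\<^sup>L halfline (\<lambda>x. \<theta> x *\<^sub>R w x) =
        integral\<^sup>L halfline (\<lambda>x. \<psi> x *\<^sub>R w x) - J *\<^sub>R integral\<^sup>L halfline (\<lambda>x. bump 1 2 x *\<^sub>R w x)"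
      unfolding \<theta>_def using I1 by (simp add: scaleR_diff_left flip: scaleR_scaleR)
    then have e: "integral\<^sup>L halfline (\<lambda>x. \<psi> x *\<^sub>R w x) = of_real (integral\<^sup>L halfline \<psi>) * c"
      using t0 \<open>I \<noteq> 0\<close> by (simp add: J_def c_def scaleR_conv_of_real)
    have "integral\<^sup>L halfline (\<lambda>x. \<psi> x *\<^sub>R (w x - c)) =
      integral\<^sup>L halfline (\<lambda>x. \<psi> x *\<^sub>R w x) - integral\<^sup>L halfline (\<lambda>x. \<psi> x *\<^sub>R c)"
      unfolding scaleR_diff_right by (rule Bochner_Integration.integral_diff) (use I1 pi in auto)
    also have "integral\<^sup>L halfline (\<lambda>x. \<psi> x *\<^sub>R c) = integral\<^sup>L halfline \<psi> *\<^sub>R c"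
      using pi by simp
    finally show "integral\<^sup>L halfline (\<lambda>x. \<psi> x *\<^sub>R (w x - c)) = 0"
      by (simp add: e[unfolded scaleR_conv_of_real] scaleR_conv_of_real)
  qed
  then show ?thesis by auto
qed

lemma indef_int_of_L2_half:
  assumes "L2_half g"
  shows "indef_int (\<lambda>x. c + integral {0..x} g) g"
  unfolding indef_int_def using L2_half_abs_integrable[OF assms] by auto

text \<open>Subtracting an antiderivative of \<open>g\<close> from \<open>u\<close> leaves a
  function with weak derivative 0, hence a constant; that constant becomes the trace of the
  representative.\<close>

lemma is_weak_deriv_imp_H1_half:
  assumes wd: "is_weak_deriv {0<..} u g" and u: "L2_half u" and g: "L2_half g"
  obtains f where "H1_half f g" "AE x in halfline. u x = f x"
proof -
  let ?v = "\<lambda>x. 0 + integral {0..x} g"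
  have v: "indef_int ?v g" by (rule indef_int_of_L2_half[OF g])
  have lv: "locally_integrable {0<..} ?v"
    unfolding locally_integrable_halfline_iff
  proof (intro allI impI)
    fix a b :: real assume "0 < a \<and> a < b"
    then have "continuous_on {a..b} ?v"
      by (intro continuous_on_subset[OF indef_int_continuous_on[OF v]]) auto
    then show "?v absolutely_integrable_on {a..b}"
      using absolutely_integrable_continuous[of a b ?v] by simp
  qed
  note A = wd[unfolded is_weak_deriv_halfline_iff]
  have "\<exists>c. AE x in halfline. u x - ?v x = c"
  proof (rule du_Bois_Reymond)
    show "locally_integrable {0<..} (\<lambda>x. u x - ?v x)"
      using A lv by (intro locally_integrable_halfline_diff) auto
    fix \<phi> assume p: "\<phi> \<in> test_functions {0<..}"
    have "integral\<^sup>L halfline (\<lambda>x. deriv \<phi> x *\<^sub>R (u x - ?v x)) =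
        integral\<^sup>L halfline (\<lambda>x. deriv \<phi> x *\<^sub>R u x) - integral\<^sup>L halfline (\<lambda>x. deriv \<phi> x *\<^sub>R ?v x)"
      unfolding scaleR_diff_right using A lv p
      by (intro Bochner_Integration.integral_diff integrable_test_mult) auto
    also have "\<dots> = 0" using indef_int_test_parts[OF v p lv] A p by auto
    finally show "integral\<^sup>L halfline (\<lambda>x. deriv \<phi> x *\<^sub>R (u x - ?v x)) = 0" .
  qed
  then obtain c where c: "AE x in halfline. u x - ?v x = c" by blast
  let ?f = "\<lambda>x. c + integral {0..x} g"
  have f: "indef_int ?f g" by (rule indef_int_of_L2_half[OF g])
  have ae: "AE x in halfline. u x = ?f x" using c by eventually_elim (auto simp: algebra_simps)
  have "?f \<in> borel_measurable halfline"
    by (rule continuous_measurable_halfline[OF indef_int_continuous_on[OF f]])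
  then have "L2_half ?f" using L2_half_cong_AE[OF u ae] by blast
  with f g have "H1_half ?f g" by (simp add: H1_half_def)
  then show ?thesis using ae that by blast
qed

section \<open>Reflection of the left half-line\<close>

lemma set_integrable_reflect:
  fixes f :: "real \<Rightarrow> 'a::euclidean_space"
  shows "set_integrable lebesgue (uminus ` S) f \<longleftrightarrow> set_integrable lebesgue S (\<lambda>x. f (- x))"
proof -
  have "(\<lambda>x. indicator S x *\<^sub>R f (- x)) = (\<lambda>x. indicator (uminus ` S) (0 + (-1) * x) *\<^sub>R f (0 + (-1) * x))"
    by (auto simp: indicator_def fun_eq_iff image_iff)
  then show ?thesis
    using lebesgue_integrable_real_affine_iff[of "-1" "\<lambda>x. indicator (uminus ` S) x *\<^sub>R f x" 0]
    by (simp add: set_integrable_def)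
qed

lemma reflect_halfline: "uminus ` {0<..} = ({..<0} :: real set)"
  by (auto simp: image_iff intro!: bexI[of _ "- x" for x])

lemma set_integrable_left:
  fixes f :: "real \<Rightarrow> 'a::euclidean_space"
  shows "set_integrable lebesgue {..<0} f \<longleftrightarrow> integrable halfline (\<lambda>x. f (- x))"
  using set_integrable_reflect[of "{0<..}" f] by (simp add: reflect_halfline integrable_halfline_iff)

lemma set_integral_left:
  fixes f :: "real \<Rightarrow> 'a::euclidean_space"
  shows "(LINT x:{..<0}|lebesgue. f x) = integral\<^sup>L halfline (\<lambda>x. f (- x))"
proof -
  have "(LINT x:{..<0}|lebesgue. f x) =
      integral\<^sup>L lebesgue (\<lambda>x. indicator {..<0} (0 + (-1) * x) *\<^sub>R f (0 + (-1) * x))"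
    unfolding set_lebesgue_integral_def
    by (subst lebesgue_integral_real_affine[of "-1" _ 0]) auto
  also have "(\<lambda>x. indicator {..<0::real} (0 + (-1) * x) *\<^sub>R f (0 + (-1) * x)) =
      (\<lambda>x. indicator {0<..} x *\<^sub>R f (- x))"
    by (auto simp: indicator_def fun_eq_iff)
  finally show ?thesis by (simp add: set_lebesgue_integral_def flip: halfline_set_integral)
qed

lemma measurable_left_iff:
  fixes f :: "real \<Rightarrow> 'a::euclidean_space"
  shows "set_borel_measurable lebesgue {..<0} f \<longleftrightarrow> (\<lambda>x. f (- x)) \<in> borel_measurable halfline"
proof -
  have *: "(\<lambda>x. h (- x)) \<in> borel_measurable lebesgue" if "h \<in> borel_measurable lebesgue"
    for h :: "real \<Rightarrow> 'a"
    using borel_measurable_affine[OF that, of "-1" 0] by simp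
  have e: "(\<lambda>x. indicator {0<..} x *\<^sub>R f (- x)) = (\<lambda>x. indicator {..<0::real} (- x) *\<^sub>R f (- x))"
    by (auto simp: indicator_def fun_eq_iff)
  show ?thesis
    unfolding measurable_halfline_iff set_borel_measurable_def e
    using *[of "\<lambda>x. indicator {..<0} x *\<^sub>R f x"] *[of "\<lambda>x. indicator {..<0} (- x) *\<^sub>R f (- x)"]
    unfolding minus_minus by blast
qed

lemma AE_reflect:
  assumes "AE x in lebesgue. P x"
  shows "AE x in lebesgue. P (- x :: real)"
proof -
  obtain N where N: "negligible N" "{x. \<not> P x} \<subseteq> N"
    using assms unfolding eventually_ae_filter_negligible by auto
  have "negligible (uminus ` N)"
    by (rule negligible_differentiable_image_negligible[OF order_refl N(1)])
       (simp add: differentiable_on_def differentiable_minus)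
  moreover have "{x. \<not> P (- x)} \<subseteq> uminus ` N"
    using N(2) by (force simp: image_iff)
  ultimately show ?thesis unfolding eventually_ae_filter_negligible by auto
qed

lemma L2_left_iff: "u \<in> L2 {..<0} \<longleftrightarrow> L2_half (\<lambda>x. u (- x))"
  by (simp add: L2_def L2_half_def measurable_left_iff set_integrable_left)

lemma C1_reflect:
  fixes \<phi> :: "real \<Rightarrow> real"
  assumes "\<phi> C1_differentiable_on UNIV"
  shows "(\<lambda>x. \<phi> (- x)) C1_differentiable_on UNIV" "deriv (\<lambda>x. \<phi> (- x)) x = - deriv \<phi> (- x)"
proof -
  have d: "((\<lambda>x. \<phi> (- x)) has_real_derivative - deriv \<phi> (- x)) (at x)" for x
    using DERIV_chain2[OF C1_deriv(1)[OF assms] DERIV_minus[OF DERIV_ident], of x] by simp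
  then show "deriv (\<lambda>x. \<phi> (- x)) x = - deriv \<phi> (- x)" by (rule DERIV_imp_deriv)
  have "continuous_on UNIV (\<lambda>x. - deriv \<phi> (- x))"
    by (intro continuous_intros continuous_on_compose2[OF C1_deriv(2)[OF assms, of UNIV]]) auto
  with d show "(\<lambda>x. \<phi> (- x)) C1_differentiable_on UNIV"
    unfolding C1_differentiable_on_def
    by (intro exI[of _ "\<lambda>x. - deriv \<phi> (- x)"]) (auto simp: has_real_derivative_iff_has_vector_derivative)
qed

lemma test_functions_reflect:
  assumes "\<phi> \<in> test_functions (uminus ` I)"
  shows "(\<lambda>x. \<phi> (- x)) \<in> test_functions I"
proof -
  obtain K where K: "\<phi> C1_differentiable_on UNIV" "compact K" "K \<subseteq> uminus ` I" "\<forall>x. x \<notin> K \<longrightarrow> \<phi> x = 0"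
    using assms unfolding test_functions_def by blast
  have "compact (uminus ` K)" using K(2) by (rule compact_negations)
  moreover have "uminus ` K \<subseteq> I" using K(3) by force
  moreover have "\<forall>x. x \<notin> uminus ` K \<longrightarrow> \<phi> (- x) = 0" using K(4) by (metis image_eqI minus_minus)
  ultimately show ?thesis using C1_reflect(1)[OF K(1)] unfolding test_functions_def by blast
qed

lemma locally_integrable_reflect:
  "locally_integrable {..<0} u \<longleftrightarrow> locally_integrable {0<..} (\<lambda>x. u (- x))"
proof -
  have ii: "uminus ` uminus ` K = K" for K :: "real set" by (simp add: image_image)
  have "set_integrable lebesgue K u \<longleftrightarrow> set_integrable lebesgue (uminus ` K) (\<lambda>x. u (- x))" for K
    using set_integrable_reflect[of "uminus ` K" u] by (simp add: ii)
  moreover have "compact (uminus ` K) \<longleftrightarrow> compact K" for K :: "real set"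
    using compact_negations[of K] compact_negations[of "uminus ` K"] by (auto simp: ii)
  moreover have "uminus ` K \<subseteq> {0<..} \<longleftrightarrow> K \<subseteq> {..<0}" for K :: "real set" by auto
  ultimately show ?thesis
    unfolding locally_integrable_def by (metis ii)
qed

text \<open>Reflection reverses the sign of the derivative of each test function, and this sign is
  moved onto \<open>g\<close>.\<close>

lemma is_weak_deriv_left_iff:
  "is_weak_deriv {..<0} u g \<longleftrightarrow> is_weak_deriv {0<..} (\<lambda>x. u (- x)) (\<lambda>x. - g (- x))"
proof -
  have 1: "locally_integrable {0<..} (\<lambda>x. - g (- x)) \<longleftrightarrow> locally_integrable {0<..} (\<lambda>x. g (- x))"
    unfolding locally_integrable_def by (simp add: set_integrable_def)
  have r: "uminus ` {..<0} = ({0<..} :: real set)"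
    using arg_cong[OF reflect_halfline, of "(`) uminus"] by (simp add: image_image)
  have t: "\<phi> \<in> test_functions {..<0} \<longleftrightarrow> (\<lambda>x. \<phi> (- x)) \<in> test_functions {0<..}" for \<phi>
    using test_functions_reflect[of \<phi> "{0<..}"] test_functions_reflect[of "\<lambda>x. \<phi> (- x)" "{..<0}"]
    by (auto simp: r reflect_halfline)
  have e: "((LINT x:{..<0}|lebesgue. deriv \<phi> x *\<^sub>R u x) = - (LINT x:{..<0}|lebesgue. \<phi> x *\<^sub>R g x)) \<longleftrightarrow>
     (integral\<^sup>L halfline (\<lambda>x. deriv (\<lambda>x. \<phi> (- x)) x *\<^sub>R u (- x)) = - integral\<^sup>L halfline (\<lambda>x. \<phi> (- x) *\<^sub>R (- g (- x))))"
    if "\<phi> \<in> test_functions {..<0}" for \<phi>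
  proof -
    have "\<phi> C1_differentiable_on UNIV" using that unfolding test_functions_def by blast
    then show ?thesis
      by (simp add: set_integral_left C1_reflect(2)) (intro iffI, simp, drule sym, simp)
  qed
  have "(\<forall>\<phi>\<in>test_functions {..<0}.
        (LINT x:{..<0}|lebesgue. deriv \<phi> x *\<^sub>R u x) = - (LINT x:{..<0}|lebesgue. \<phi> x *\<^sub>R g x)) \<longleftrightarrow>
    (\<forall>\<phi>\<in>test_functions {0<..}.
        integral\<^sup>L halfline (\<lambda>x. deriv \<phi> x *\<^sub>R u (- x)) = - integral\<^sup>L halfline (\<lambda>x. \<phi> x *\<^sub>R (- g (- x))))"
    (is "?L \<longleftrightarrow> ?R")
  proof
    assume L: ?L
    show ?R
    proof
      fix \<phi> assume "\<phi> \<in> test_functions {0<..}"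
      then have p: "(\<lambda>x. \<phi> (- x)) \<in> test_functions {..<0}" by (simp add: t)
      with L e[OF p] show "integral\<^sup>L halfline (\<lambda>x. deriv \<phi> x *\<^sub>R u (- x)) = - integral\<^sup>L halfline (\<lambda>x. \<phi> x *\<^sub>R (- g (- x)))"
        by simp
    qed
  next
    assume R: ?R
    show ?L
    proof
      fix \<phi> assume p: "\<phi> \<in> test_functions {..<0}"
      with R t show "(LINT x:{..<0}|lebesgue. deriv \<phi> x *\<^sub>R u x) = - (LINT x:{..<0}|lebesgue. \<phi> x *\<^sub>R g x)"
        unfolding e[OF p] by blast
    qed
  qed
  then show ?thesis
    unfolding is_weak_deriv_halfline_iff 1 unfolding is_weak_deriv_def locally_integrable_reflect by blast
qed

lemma integral_line_split:
  fixes h :: "real \<Rightarrow> 'a::euclidean_space"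
  assumes "integrable halfline (\<lambda>x. h (- x))" "integrable halfline h"
  shows "integral\<^sup>L lebesgue h = integral\<^sup>L halfline (\<lambda>x. h (- x)) + integral\<^sup>L halfline h"
proof -
  have i: "set_integrable lebesgue {..<0} h" "set_integrable lebesgue {0<..} h"
    using assms by (auto simp: set_integrable_left integrable_halfline_iff)
  have u: "{..<0} \<union> {0<..} = - {0::real}" by auto
  have iu: "set_integrable lebesgue (- {0}) h"
    using set_integrable_Un[OF i] by (simp add: u)
  have n: "AE x in lebesgue. x \<noteq> (0::real)"
    using AE_completion[OF AE_lborel_singleton] .
  have m: "(\<lambda>x. indicator (- {0}) x *\<^sub>R h x) \<in> borel_measurable lebesgue"
    using iu by (auto simp: set_integrable_def)
  have ae: "AE x in lebesgue. indicator (- {0}) x *\<^sub>R h x = h x"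
    using n by eventually_elim (auto simp: indicator_def)
  have "integral\<^sup>L lebesgue h = integral\<^sup>L lebesgue (\<lambda>x. indicator (- {0}) x *\<^sub>R h x)"
    by (rule integral_cong_AE) (use m borel_measurable_AE[OF m ae] ae in auto)
  also have "\<dots> = (LINT x:{..<0} \<union> {0<..}|lebesgue. h x)"
    by (simp add: u set_lebesgue_integral_def)
  also have "\<dots> = (LINT x:{..<0}|lebesgue. h x) + (LINT x:{0<..}|lebesgue. h x)"
    by (rule set_integral_Un[OF _ i]) auto
  finally show ?thesis by (simp add: set_integral_left halfline_set_integral)
qed

section \<open>Continuous representatives on both half-lines\<close>

text \<open>\<open>f1\<close> represents the reflected left part \<open>x \<mapsto> u(-x)\<close>, so that \<open>g1 = - u'(-x)\<close>.\<close>

definition rep :: "(real \<Rightarrow> complex) \<Rightarrow> (real \<Rightarrow> complex) \<Rightarrow> (real \<Rightarrow> complex) \<Rightarrow>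
    (real \<Rightarrow> complex) \<Rightarrow> (real \<Rightarrow> complex) \<Rightarrow> bool" where
  "rep u f1 g1 f2 g2 \<longleftrightarrow> H1_half f1 g1 \<and> H1_half f2 g2 \<and>
     (AE x in halfline. u (- x) = f1 x) \<and> (AE x in halfline. u x = f2 x)"

definition half_sq :: "(real \<Rightarrow> complex) \<Rightarrow> real" where
  "half_sq f = integral\<^sup>L halfline (\<lambda>x. (norm (f x))\<^sup>2)"

definition half_six :: "(real \<Rightarrow> complex) \<Rightarrow> real" where
  "half_six f = integral\<^sup>L halfline (\<lambda>x. (norm (f x)) ^ 6)"

lemma half_sq_nonneg: "half_sq f \<ge> 0"
  by (simp add: half_sq_def)

lemma half_six_nonneg: "half_six f \<ge> 0"
  by (simp add: half_six_def)

lemma weak_deriv_eqI: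
  assumes "is_weak_deriv I u g"
  shows "is_weak_deriv I u (weak_deriv I u)"
  unfolding weak_deriv_def by (rule someI[of _ g]) (rule assms)

lemma H1_right:
  assumes H: "H1_half f g" and ae: "AE x in halfline. u x = f x"
  shows "u \<in> H1 {0<..}" "AE x in halfline. weak_deriv {0<..} u x = g x"
    "u \<in> borel_measurable halfline"
proof -
  note h = H1_halfD[OF H]
  show m: "u \<in> borel_measurable halfline"
    by (rule measurable_halfline_cong_AE[OF L2_halfD(1)[OF h(1)]]) (use ae in auto)
  have wd: "is_weak_deriv {0<..} u g"
    by (rule H1_half_is_weak_deriv[OF H ae _ m L2_halfD(1)[OF h(2)]]) auto
  have "L2_half u" by (rule L2_half_cong_AE[OF h(1) _ m]) (use ae in auto)
  then show "u \<in> H1 {0<..}" using wd h(2) unfolding H1_def L2_half_iff[symmetric] by blast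
  show "AE x in halfline. weak_deriv {0<..} u x = g x"
    by (rule weak_deriv_halfline_unique[OF weak_deriv_eqI[OF wd] wd])
qed

lemma H1_left:
  assumes H: "H1_half f g" and ae: "AE x in halfline. u (- x) = f x"
  shows "u \<in> H1 {..<0}" "AE x in halfline. weak_deriv {..<0} u (- x) = - g x"
    "(\<lambda>x. u (- x)) \<in> borel_measurable halfline"
proof -
  note h = H1_halfD[OF H]
  show m: "(\<lambda>x. u (- x)) \<in> borel_measurable halfline"
    by (rule measurable_halfline_cong_AE[OF L2_halfD(1)[OF h(1)]]) (use ae in auto)
  have wd: "is_weak_deriv {..<0} u (\<lambda>x. - g (- x))"
    unfolding is_weak_deriv_left_iff
    by (rule H1_half_is_weak_deriv[OF H ae _ m]) (use L2_halfD(1)[OF h(2)] in auto)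
  have "L2_half (\<lambda>x. u (- x))" by (rule L2_half_cong_AE[OF h(1) _ m]) (use ae in auto)
  then have "u \<in> L2 {..<0}" by (simp add: L2_left_iff)
  moreover have "(\<lambda>x. - g (- x)) \<in> L2 {..<0}"
    using L2_half_cmult[OF h(2), of "-1"] by (simp add: L2_left_iff)
  ultimately show "u \<in> H1 {..<0}" using wd unfolding H1_def by blast
  have "AE x in halfline. - weak_deriv {..<0} u (- x) = - (- g (- (- x)))"
    using weak_deriv_halfline_unique weak_deriv_eqI[OF wd] wd unfolding is_weak_deriv_left_iff by blast
  then show "AE x in halfline. weak_deriv {..<0} u (- x) = - g x"
    by eventually_elim (simp add: minus_equation_iff eq_commute)
qed

lemma H1_rightE:
  assumes "u \<in> H1 {0<..}"
  obtains f g where "H1_half f g" "AE x in halfline. u x = f x"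
  using assms is_weak_deriv_imp_H1_half[of u] unfolding H1_def L2_half_iff[symmetric] by blast

lemma H1_leftE:
  assumes "u \<in> H1 {..<0}"
  obtains f g where "H1_half f g" "AE x in halfline. u (- x) = f x"
proof -
  obtain g where g: "g \<in> L2 {..<0}" "is_weak_deriv {..<0} u g" and u: "u \<in> L2 {..<0}"
    using assms unfolding H1_def by blast
  have "L2_half (\<lambda>x. - g (- x))" using L2_half_cmult[of "\<lambda>x. g (- x)" "-1"] g(1) by (simp add: L2_left_iff)
  with g(2) u show ?thesis
    using is_weak_deriv_imp_H1_half[of "\<lambda>x. u (- x)" "\<lambda>x. - g (- x)"] that
    unfolding is_weak_deriv_left_iff L2_left_iff by blast
qed

text \<open>Two continuous functions differ on an open set, and an open null set is empty.\<close>

lemma continuous_eq_if_AE: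
  fixes v w :: "real \<Rightarrow> complex"
  assumes "open S" "continuous_on S v" "continuous_on S w" "AE x in lebesgue. v x = w x" "x \<in> S"
  shows "v x = w x"
proof -
  let ?T = "S \<inter> (\<lambda>x. v x - w x) -` (- {0})"
  have "open ?T"
    by (intro continuous_open_preimage continuous_intros assms)
  moreover have "negligible ?T"
  proof -
    obtain N where N: "negligible N" "{x. v x \<noteq> w x} \<subseteq> N"
      using assms(4) unfolding eventually_ae_filter_negligible by auto
    show ?thesis by (rule negligible_subset[OF N(1)]) (use N(2) in auto)
  qed
  ultimately have "?T = {}" using open_not_negligible by blast
  then show ?thesis using assms(5) by auto
qed

lemma AE_line_iff:
  "(AE x in lebesgue. P x) \<longleftrightarrow> (AE x in halfline. P (- x)) \<and> (AE x in halfline. P (x::real))"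
proof
  assume A: "AE x in lebesgue. P x"
  show "(AE x in halfline. P (- x)) \<and> (AE x in halfline. P x)"
    unfolding AE_halfline_iff using A AE_reflect[OF A] by (auto elim: eventually_mono)
next
  assume "(AE x in halfline. P (- x)) \<and> (AE x in halfline. P x)"
  then have A: "AE x in lebesgue. x > 0 \<longrightarrow> P (- x)" and B: "AE x in lebesgue. x > 0 \<longrightarrow> P x"
    unfolding AE_halfline_iff by auto
  have n: "AE x in lebesgue. x \<noteq> (0::real)"
    using AE_completion[OF AE_lborel_singleton] .
  from AE_reflect[OF A] B n show "AE x in lebesgue. P x"
    by eventually_elim (auto simp: linorder_neq_iff)
qed

text \<open>The choice in \<open>cont_rep\<close> succeeds because gluing the two halves gives a
  witness, and it is immaterial because continuous representatives agree off 0. The traces are then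
  the values at 0 of the one-sided representatives.\<close>

lemma rep_cont_rep:
  assumes R: "rep u f1 g1 f2 g2"
  shows "x > 0 \<Longrightarrow> cont_rep u x = f2 x" "x > 0 \<Longrightarrow> cont_rep u (- x) = f1 x"
    "trace_left u = f1 0" "trace_right u = f2 0"
proof -
  define v where "v x = (if x < 0 then f1 (- x) else f2 x)" for x
  have c1: "continuous_on {0..} f1" and c2: "continuous_on {0..} f2"
    using R unfolding rep_def H1_half_def by (auto intro: indef_int_continuous_on)
  have "continuous_on ({..<0} \<union> {0<..}) v"
  proof (rule continuous_on_open_Un)
    have "continuous_on {..<0} (\<lambda>x. f1 (- x))"
      by (rule continuous_on_compose2[OF c1]) (auto intro: continuous_intros)
    then show "continuous_on {..<0} v"
      by (rule continuous_on_eq) (auto simp: v_def)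
    show "continuous_on {0<..} v"
      by (rule continuous_on_eq[OF continuous_on_subset[OF c2]]) (auto simp: v_def)
  qed auto
  moreover have "{..<0} \<union> {0<..} = - {0::real}" by auto
  ultimately have vc: "continuous_on (- {0}) v" by simp
  have vu: "AE x in lebesgue. u x = v x"
    unfolding AE_line_iff
  proof
    have "AE x in halfline. u (- x) = f1 x" "AE x in halfline. u x = f2 x"
      using R by (auto simp: rep_def)
    then show "AE x in halfline. u (- x) = v (- x)" "AE x in halfline. u x = v x"
      unfolding AE_halfline_iff v_def by (eventually_elim, simp)+
  qed
  have "continuous_on (- {0}) (cont_rep u) \<and> (AE x in lebesgue. u x = cont_rep u x)"
    unfolding cont_rep_def by (rule someI[of _ v]) (use vc vu in auto)
  then have wc: "continuous_on (- {0}) (cont_rep u)" and wu: "AE x in lebesgue. u x = cont_rep u x" by auto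
  have ae: "AE x in lebesgue. cont_rep u x = v x" using vu wu by eventually_elim simp
  have e: "cont_rep u x = v x" if "x \<noteq> 0" for x
    by (rule continuous_eq_if_AE[OF _ wc vc ae]) (use that in auto)
  show r: "cont_rep u x = f2 x" if "x > 0" for x using e[of x] that by (simp add: v_def)
  show l: "cont_rep u (- x) = f1 x" if "x > 0" for x using e[of "- x"] that by (simp add: v_def)
  have t: "(f \<longlongrightarrow> f 0) (at_right 0)" if "continuous_on {0..} f" for f :: "real \<Rightarrow> complex"
  proof -
    have "(f \<longlongrightarrow> f 0) (at 0 within {0..})" using that by (auto simp: continuous_on)
    then show ?thesis by (rule tendsto_within_subset) auto
  qed
  have p: "eventually (\<lambda>x::real. x > 0) (at_right 0)" by (simp add: eventually_at_right_less)
  have "(cont_rep u \<longlongrightarrow> f2 0) (at_right 0)"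
    by (rule Lim_transform_eventually[OF t[OF c2]]) (rule eventually_mono[OF p], simp add: r)
  then show "trace_right u = f2 0" unfolding trace_right_def by (intro tendsto_Lim) auto
  have "((\<lambda>x. cont_rep u (- x)) \<longlongrightarrow> f1 0) (at_right 0)"
    by (rule Lim_transform_eventually[OF t[OF c1]]) (rule eventually_mono[OF p], simp add: l)
  then have "(cont_rep u \<longlongrightarrow> f1 0) (at_left 0)"
    using filterlim_at_left_to_right[of "cont_rep u" "nhds (f1 0)" 0] by simp
  then show "trace_left u = f1 0" unfolding trace_left_def by (intro tendsto_Lim) auto
qed

section \<open>The function space, norms and energy in terms of representatives\<close>

lemma rep_Dspace:
  assumes "rep u f1 g1 f2 g2"
  shows "u \<in> Dspace \<tau> \<longleftrightarrow> f2 0 = of_real \<tau> * f1 0"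
  using H1_right(1)[of f2 g2 u] H1_left(1)[of f1 g1 u] rep_cont_rep(3,4)[OF assms] assms
  unfolding Dspace_def rep_def by auto

lemma Dspace_rep:
  assumes "u \<in> Dspace \<tau>"
  obtains f1 g1 f2 g2 where "rep u f1 g1 f2 g2" "f2 0 = of_real \<tau> * f1 0"
proof -
  have u: "u \<in> H1 {0<..}" "u \<in> H1 {..<0}" using assms unfolding Dspace_def by auto
  obtain f2 g2 where 2: "H1_half f2 g2" "AE x in halfline. u x = f2 x" using H1_rightE[OF u(1)] .
  obtain f1 g1 where 1: "H1_half f1 g1" "AE x in halfline. u (- x) = f1 x" using H1_leftE[OF u(2)] .
  have "rep u f1 g1 f2 g2" using 1 2 by (simp add: rep_def)
  then show ?thesis using that rep_Dspace assms by blast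
qed

lemma rep_integral:
  fixes F :: "complex \<Rightarrow> 'a::euclidean_space"
  assumes R: "rep u f1 g1 f2 g2" and F: "F \<in> borel_measurable borel"
    and i: "integrable halfline (\<lambda>x. F (f1 x))" "integrable halfline (\<lambda>x. F (f2 x))"
  shows "integral\<^sup>L lebesgue (\<lambda>x. F (u x)) = integral\<^sup>L halfline (\<lambda>x. F (f1 x)) + integral\<^sup>L halfline (\<lambda>x. F (f2 x))"
proof -
  have R': "H1_half f1 g1" "H1_half f2 g2" "AE x in halfline. u (- x) = f1 x" "AE x in halfline. u x = f2 x"
    using R by (auto simp: rep_def)
  have m: "(\<lambda>x. F (u (- x))) \<in> borel_measurable halfline" "(\<lambda>x. F (u x)) \<in> borel_measurable halfline"
    using H1_left(3)[OF R'(1,3)] H1_right(3)[OF R'(2,4)] F by measurable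
  have ae: "AE x in halfline. F (f1 x) = F (u (- x))" "AE x in halfline. F (f2 x) = F (u x)"
    using R'(3,4) by (eventually_elim, simp)+
  have i': "integrable halfline (\<lambda>x. F (u (- x)))" "integrable halfline (\<lambda>x. F (u x))"
    by (rule integrable_cong_AE_imp[OF i(1) m(1)], use ae in auto)
       (rule integrable_cong_AE_imp[OF i(2) m(2)], use ae in auto)
  show ?thesis
    unfolding integral_line_split[OF i']
    by (intro arg_cong2[where f="(+)"] integral_cong_AE) (use m i ae in auto)
qed

lemma Lp_norm_2_sq: "(Lp_norm 2 I u)\<^sup>2 = (LINT x:I|lebesgue. (norm (u x))\<^sup>2)"
proof -
  have "(LINT x:I|lebesgue. (norm (u x))\<^sup>2) \<ge> 0"
    unfolding set_lebesgue_integral_def by (intro integral_nonneg_AE) auto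
  then show ?thesis unfolding Lp_norm_def by (simp add: powr_half_sqrt)
qed

lemma Lp_norm_6_pow: "(Lp_norm 6 I u) ^ 6 = (LINT x:I|lebesgue. (norm (u x)) ^ 6)"
proof -
  have n: "(LINT x:I|lebesgue. (norm (u x)) ^ 6) \<ge> 0"
    unfolding set_lebesgue_integral_def by (intro integral_nonneg_AE) auto
  then have "((LINT x:I|lebesgue. (norm (u x)) ^ 6) powr (1 / 6)) ^ 6 = (LINT x:I|lebesgue. (norm (u x)) ^ 6)"
    by (cases "(LINT x:I|lebesgue. (norm (u x)) ^ 6) = 0") (auto simp: powr_power)
  then show ?thesis unfolding Lp_norm_def by simp
qed

lemma rep_mass:
  assumes R: "rep u f1 g1 f2 g2"
  shows "(Lp_norm 2 UNIV u)\<^sup>2 = half_sq f1 + half_sq f2"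
proof -
  have "integrable halfline (\<lambda>x. (norm (f1 x))\<^sup>2)" "integrable halfline (\<lambda>x. (norm (f2 x))\<^sup>2)"
    using R unfolding rep_def H1_half_def L2_half_def by auto
  then show ?thesis
    unfolding Lp_norm_2_sq half_sq_def
    using rep_integral[OF R, of "\<lambda>z. (norm z)\<^sup>2"] by (simp add: set_lebesgue_integral_def)
qed

lemma rep_six:
  assumes R: "rep u f1 g1 f2 g2"
  shows "(Lp_norm 6 UNIV u) ^ 6 = half_six f1 + half_six f2"
proof -
  have "integrable halfline (\<lambda>x. (norm (f1 x)) ^ 6)" "integrable halfline (\<lambda>x. (norm (f2 x)) ^ 6)"
    using R unfolding rep_def by (auto intro: H1_half_power6)
  then show ?thesis
    unfolding Lp_norm_6_pow half_six_def
    using rep_integral[OF R, of "\<lambda>z. norm z ^ 6"] by (simp add: set_lebesgue_integral_def)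
qed

lemma rep_grad:
  assumes R: "rep u f1 g1 f2 g2"
  shows "grad_sq u = half_sq g1 + half_sq g2"
proof -
  have R': "H1_half f1 g1" "H1_half f2 g2" "AE x in halfline. u (- x) = f1 x" "AE x in halfline. u x = f2 x"
    using R by (auto simp: rep_def)
  have g: "L2_half g1" "L2_half g2" using R' by (auto simp: H1_half_def)
  note W = H1_left(2)[OF R'(1,3)] H1_right(2)[OF R'(2,4)]
  have mg: "(\<lambda>x. - g1 x) \<in> borel_measurable halfline" "g2 \<in> borel_measurable halfline"
    using g by (auto simp: L2_half_def)
  have m: "(\<lambda>x. weak_deriv {..<0} u (- x)) \<in> borel_measurable halfline"
    "weak_deriv {0<..} u \<in> borel_measurable halfline"
    by (rule measurable_halfline_cong_AE[OF mg(1)], use W(1) in auto)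
       (rule measurable_halfline_cong_AE[OF mg(2)], use W(2) in auto)
  have "(Lp_norm 2 {..<0} (weak_deriv {..<0} u))\<^sup>2 = half_sq g1"
    unfolding Lp_norm_2_sq half_sq_def set_integral_left
    by (rule integral_cong_AE) (use m mg W(1) in auto)
  moreover have "(Lp_norm 2 {0<..} (weak_deriv {0<..} u))\<^sup>2 = half_sq g2"
    unfolding Lp_norm_2_sq half_sq_def halfline_set_integral
    by (rule integral_cong_AE) (use m mg W(2) in auto)
  ultimately show ?thesis by (simp add: grad_sq_def)
qed

lemma rep_E0:
  assumes "rep u f1 g1 f2 g2"
  shows "E0 u = 1/2 * (half_sq g1 + half_sq g2) - 1/6 * (half_six f1 + half_six f2)"
  by (simp add: E0_def rep_grad[OF assms] rep_six[OF assms])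

lemma rep_H1_norm:
  assumes "rep u f1 g1 f2 g2"
  shows "(H1_norm u)\<^sup>2 = (half_sq f1 + half_sq g1) + (half_sq f2 + half_sq g2)" "H1_norm u \<ge> 0"
  using half_sq_nonneg[of f1] half_sq_nonneg[of f2] half_sq_nonneg[of g1] half_sq_nonneg[of g2]
  by (auto simp: H1_norm_def rep_mass[OF assms] rep_grad[OF assms])

lemma rep_add:
  assumes "rep u f1 g1 f2 g2" "rep v k1 l1 k2 l2"
  shows "rep (\<lambda>x. u x + v x) (\<lambda>x. f1 x + k1 x) (\<lambda>x. g1 x + l1 x) (\<lambda>x. f2 x + k2 x) (\<lambda>x. g2 x + l2 x)"
  using assms unfolding rep_def by (auto intro!: H1_half_add elim: eventually_elim2)

lemma rep_cmult:
  assumes "rep u f1 g1 f2 g2"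
  shows "rep (\<lambda>x. c * u x) (\<lambda>x. c * f1 x) (\<lambda>x. c * g1 x) (\<lambda>x. c * f2 x) (\<lambda>x. c * g2 x)"
  using assms unfolding rep_def by (auto intro!: H1_half_cmult elim: eventually_mono)

definition glue :: "(real \<Rightarrow> complex) \<Rightarrow> (real \<Rightarrow> complex) \<Rightarrow> real \<Rightarrow> complex" where
  "glue f1 f2 x = (if x < 0 then f1 (- x) else f2 x)"

lemma rep_glue:
  assumes "H1_half f1 g1" "H1_half f2 g2"
  shows "rep (glue f1 f2) f1 g1 f2 g2"
  using assms unfolding rep_def by (auto simp: AE_halfline_iff glue_def)

lemma rep_inner:
  assumes R: "rep u f1 g1 f2 g2" and S: "rep v k1 l1 k2 l2"
  shows "(LINT x|lebesgue. u x * cnj (v x)) =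
    integral\<^sup>L halfline (\<lambda>x. f1 x * cnj (k1 x)) + integral\<^sup>L halfline (\<lambda>x. f2 x * cnj (k2 x))"
proof -
  have R': "H1_half f1 g1" "H1_half f2 g2" "AE x in halfline. u (- x) = f1 x" "AE x in halfline. u x = f2 x"
    using R by (auto simp: rep_def)
  have S': "H1_half k1 l1" "H1_half k2 l2" "AE x in halfline. v (- x) = k1 x" "AE x in halfline. v x = k2 x"
    using S by (auto simp: rep_def)
  have i: "integrable halfline (\<lambda>x. f1 x * cnj (k1 x))" "integrable halfline (\<lambda>x. f2 x * cnj (k2 x))"
    using R' S' by (auto simp: H1_half_def intro!: L2_half_mult L2_half_cnj)
  have ae: "AE x in halfline. f1 x * cnj (k1 x) = u (- x) * cnj (v (- x))"
    "AE x in halfline. f2 x * cnj (k2 x) = u x * cnj (v x)"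
    using R'(3) S'(3) by (eventually_elim, simp) (use R'(4) S'(4) in \<open>eventually_elim, simp\<close>)
  have m: "(\<lambda>x. u (- x) * cnj (v (- x))) \<in> borel_measurable halfline" "(\<lambda>x. u x * cnj (v x)) \<in> borel_measurable halfline"
    by (rule measurable_halfline_cong_AE[OF borel_measurable_integrable[OF i(1)] ae(1)],
        rule measurable_halfline_cong_AE[OF borel_measurable_integrable[OF i(2)] ae(2)])
  have i': "integrable halfline (\<lambda>x. u (- x) * cnj (v (- x)))" "integrable halfline (\<lambda>x. u x * cnj (v x))"
    by (rule integrable_cong_AE_imp[OF i(1) m(1)], use ae in auto)
       (rule integrable_cong_AE_imp[OF i(2) m(2)], use ae in auto)
  show ?thesis
    unfolding integral_line_split[OF i']
    by (intro arg_cong2[where f="(+)"] integral_cong_AE) (use m i ae in auto)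
qed

section \<open>The sharp inequality\<close>

lemma half_sq_cmult: "half_sq (\<lambda>x. c * f x) = (norm c)\<^sup>2 * half_sq f"
  by (simp add: half_sq_def norm_mult power_mult_distrib)

lemma half_six_cmult: "half_six (\<lambda>x. c * f x) = (norm c) ^ 6 * half_six f"
  by (simp add: half_six_def norm_mult power_mult_distrib)

text \<open>Here s = \<bar>f\<bar>, G = \<bar>g\<bar>, and r is the derivative of \<bar>f\<bar>^2.
  With the Riccati equation c' = 2 k s^2 (1 + c^2), the right side is -k/2 times the derivative of c
  s^4. After \<bar>r\<bar> \<le> 2 s G the claim reduces to (G - k \<bar>c\<bar> s^3)^2 \<ge> 0; the
  value k^2 = 1/3 is what matches the sextic terms.\<close>

lemma calibration_pointwise:
  fixes G s c r k :: real
  assumes k: "k\<^sup>2 = 1 / 3" "k \<ge> 0" and s: "s \<ge> 0" and G: "G \<ge> 0" and r: "\<bar>r\<bar> \<le> 2 * s * G"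
  shows "G\<^sup>2 - s ^ 6 / 3 \<ge> - (k / 2) * (c * (2 * s\<^sup>2 * r) + 2 * k * s\<^sup>2 * (1 + c\<^sup>2) * s ^ 4)"
proof -
  have "\<bar>k * c * s\<^sup>2 * r\<bar> = k * \<bar>c\<bar> * s\<^sup>2 * \<bar>r\<bar>" using k s by (simp add: abs_mult)
  also have "\<dots> \<le> k * \<bar>c\<bar> * s\<^sup>2 * (2 * s * G)" using k r by (intro mult_left_mono) auto
  finally have 1: "- (k * c * s\<^sup>2 * r) \<le> k * \<bar>c\<bar> * s\<^sup>2 * (2 * s * G)" by linarith
  have "0 \<le> (G - k * \<bar>c\<bar> * s ^ 3)\<^sup>2" by simp
  also have "\<dots> = G\<^sup>2 - 2 * G * (k * \<bar>c\<bar> * s ^ 3) + k\<^sup>2 * \<bar>c\<bar>\<^sup>2 * s ^ 6"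
    by (simp add: power2_diff power_mult_distrib power_mult[symmetric])
  also have "\<dots> = G\<^sup>2 - k * \<bar>c\<bar> * s\<^sup>2 * (2 * s * G) + 1/3 * c\<^sup>2 * s ^ 6"
    unfolding k by (simp add: power2_eq_square power3_eq_cube)
  finally have 2: "k * \<bar>c\<bar> * s\<^sup>2 * (2 * s * G) \<le> G\<^sup>2 + 1/3 * c\<^sup>2 * s ^ 6" by simp
  have "- (k / 2) * (c * (2 * s\<^sup>2 * r) + 2 * k * s\<^sup>2 * (1 + c\<^sup>2) * s ^ 4) =
      - (k * c * s\<^sup>2 * r) - k\<^sup>2 * (1 + c\<^sup>2) * (s\<^sup>2 * s ^ 4)"
    by (simp add: algebra_simps power2_eq_square)
  also have "\<dots> = - (k * c * s\<^sup>2 * r) - 1/3 * s ^ 6 - 1/3 * c\<^sup>2 * s ^ 6"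
    by (simp add: k power_add[symmetric] algebra_simps)
  finally show ?thesis using 1 2 by linarith
qed

text \<open>Calibration in the mass coordinate: with \<open>F(x) = \<integral>\<^sub>0\<^sup>x \<bar>f\<bar>\<^sup>2\<close>, the function
  \<open>c = cot (A - 2 F / \<surd>3)\<close> solves the Riccati equation \<open>c' = (2 / \<surd>3) \<bar>f\<bar>\<^sup>2 (1 + c\<^sup>2)\<close>, which
  turns \<open>\<bar>g\<bar>\<^sup>2 - \<bar>f\<bar>\<^sup>6 / 3 + (c \<bar>f\<bar>\<^sup>4)' / (2 \<surd>3)\<close> into something bounded below by a square.\<close>

lemma calibration:
  assumes H: "H1_half f g" and A: "2 / sqrt 3 * half_sq f < A" "A < pi"
  shows "half_sq g - half_six f / 3 \<ge> 1 / (2 * sqrt 3) * cot A * (norm (f 0)) ^ 4"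
proof -
  note h = H1_halfD[OF H]
  define \<rho> where "\<rho> x = (norm (f x))\<^sup>2" for x
  define r where "r x = Re (f x * cnj (g x) + g x * cnj (f x))" for x
  define w where "w = 2 / sqrt 3"
  have w0: "w > 0" by (simp add: w_def)
  note C = H1_half_cnj[OF H]
  have "indef_int (\<lambda>x. Re (f x * cnj (f x))) r"
    unfolding r_def
    by (rule indef_int_bounded_linear[OF bounded_linear_Re indef_int_mult[OF h(3) H1_halfD(3)[OF C]]])
  moreover have "Re (f x * cnj (f x)) = \<rho> x" for x
    by (simp add: \<rho>_def complex_norm_square[symmetric] del: of_real_power)
  ultimately have \<rho>: "indef_int \<rho> r" by simp
  have \<rho>c: "continuous_on {0..} \<rho>" by (rule indef_int_continuous_on[OF \<rho>])
  have \<rho>0: "\<rho> x \<ge> 0" for x by (simp add: \<rho>_def)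
  have \<rho>i: "integrable halfline \<rho>" using h(1) by (simp add: \<rho>_def[abs_def] L2_half_def)
  have ri: "integrable halfline r"
    unfolding r_def[abs_def] using H1_half_parts(3)[OF H C] by (rule integrable_bounded_linear[OF bounded_linear_Re])
  define F where "F x = integral {0..x} \<rho>" for x
  have \<rho>ai: "\<rho> absolutely_integrable_on {0..x}" for x by (rule halfline_abs_integrable[OF \<rho>i])
  have F: "indef_int F \<rho>" unfolding indef_int_def F_def using \<rho>ai by auto
  have Fd: "(F has_vector_derivative \<rho> x) (at x within {0..})" if "x \<ge> 0" for x
    by (rule indef_int_has_derivative[OF F \<rho>c that])
  have Fb: "0 \<le> F x" "F x \<le> half_sq f" for x
  proof -
    show "0 \<le> F x" unfolding F_def using \<rho>0 by (cases "x \<ge> 0") (auto intro!: integral_nonneg set_lebesgue_integral_eq_integral(1)[OF \<rho>ai])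
    have "F x = integral\<^sup>L halfline (\<lambda>t. indicator {..x} t *\<^sub>R \<rho> t)"
      unfolding F_def halfline_integral_Icc(1)[OF \<rho>ai] ..
    also have "\<dots> \<le> integral\<^sup>L halfline \<rho>"
      by (rule integral_mono[OF halfline_integral_Icc(2)[OF \<rho>ai] \<rho>i]) (auto simp: indicator_def \<rho>0)
    finally show "F x \<le> half_sq f" by (simp add: half_sq_def \<rho>_def[abs_def])
  qed
  \<comment> \<open>The strict mass bound confines the cotangent's argument to a compact part of (0,
    pi). Hence \<open>c\<close> is bounded, so the calibrating term and its derivative are
    integrable.\<close>
  define a where "a = A - w * half_sq f"
  have a: "0 < a" using A(1) by (simp add: a_def w_def)
  have arg: "A - w * F x \<in> {a..A}" for x
    using Fb[of x] w0 by (simp add: a_def mult_left_mono)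
  have sn: "sin y \<noteq> 0" if "y \<in> {a..A}" for y
    using sin_gt_zero[of y] that a A(2) by auto
  define c where "c x = cot (A - w * F x)" for x
  have cotc: "continuous_on {a..A} cot"
    unfolding cot_def by (intro continuous_intros) (use sn in auto)
  have cc: "continuous_on {0..} c"
    unfolding c_def using arg
    by (intro continuous_on_compose2[OF cotc] continuous_intros indef_int_continuous_on[OF F]) auto
  have "bounded (cot ` {a..A})" by (intro compact_imp_bounded compact_continuous_image cotc) auto
  then obtain B where "\<forall>y\<in>cot ` {a..A}. norm y \<le> B" unfolding bounded_iff by blast
  then have B: "\<bar>c x\<bar> \<le> B" for x using arg[of x] by (auto simp: c_def)
  define c' where "c' x = w * \<rho> x * (1 + (c x)\<^sup>2)" for x
  have ci: "indef_int c c'"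
  proof (rule indef_int_C1)
    fix x :: real assume x: "x \<ge> 0"
    let ?y = "A - w * F x"
    have s: "sin ?y \<noteq> 0" using arg[of x] sn by blast
    have "inverse ((sin ?y)\<^sup>2) = 1 + (cot ?y)\<^sup>2"
      using s sin_cos_squared_add[of ?y] by (simp add: cot_def field_simps)
    then have e: "- inverse ((sin ?y)\<^sup>2) * (- (w * \<rho> x)) = c' x"
      by (simp add: c'_def c_def algebra_simps)
    have "((\<lambda>x. A - w * F x) has_real_derivative (- (w * \<rho> x))) (at x within {0..})"
      using Fd[OF x] unfolding has_real_derivative_iff_has_vector_derivative[symmetric]
      by (auto intro!: derivative_eq_intros)
    from DERIV_chain[OF DERIV_cot[OF s] this] have "(c has_real_derivative c' x) (at x within {0..})"
      unfolding e by (simp add: o_def c_def[abs_def])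
    then show "(c has_vector_derivative c' x) (at x within {0..})"
      by (simp add: has_real_derivative_iff_has_vector_derivative)
  next
    show "continuous_on {0..} c'"
      unfolding c'_def by (intro continuous_intros \<rho>c cc)
  qed
  define h' where "h' x = c x * (\<rho> x * r x + r x * \<rho> x) + c' x * (\<rho> x * \<rho> x)" for x
  have hi: "indef_int (\<lambda>x. c x * (\<rho> x * \<rho> x)) h'"
    unfolding h'_def by (rule indef_int_mult[OF ci indef_int_mult[OF \<rho> \<rho>]])
  obtain M where M: "M > 0" "\<And>x. x \<ge> 0 \<Longrightarrow> norm (f x) \<le> M" using H1_half_bounded[OF H] by metis
  have \<rho>M: "\<rho> x \<le> M\<^sup>2" if "x \<ge> 0" for x
    unfolding \<rho>_def using M that by (intro power_mono) auto
  have m: "c \<in> borel_measurable halfline" "\<rho> \<in> borel_measurable halfline" "r \<in> borel_measurable halfline"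
    using continuous_measurable_halfline[OF cc] \<rho>i ri by auto
  have B0: "B \<ge> 0" using B[of 0] by linarith
  have i1: "integrable halfline (\<lambda>x. c x * (\<rho> x * \<rho> x))"
  proof (rule Bochner_Integration.integrable_bound)
    show "integrable halfline (\<lambda>x. B * M\<^sup>2 * \<rho> x)" using \<rho>i by auto
    show "AE x in halfline. norm (c x * (\<rho> x * \<rho> x)) \<le> norm (B * M\<^sup>2 * \<rho> x)"
    proof (rule AE_I2)
      fix x assume "x \<in> space halfline"
      then have "\<bar>c x\<bar> * (\<rho> x * \<rho> x) \<le> B * (M\<^sup>2 * \<rho> x)"
        using B[of x] B0 \<rho>M[of x] \<rho>0[of x] by (intro mult_mono) auto
      then show "norm (c x * (\<rho> x * \<rho> x)) \<le> norm (B * M\<^sup>2 * \<rho> x)"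
        using B0 \<rho>0[of x] by (simp add: abs_mult mult.assoc)
    qed
  qed (use m in auto)
  have i2: "integrable halfline h'"
  proof -
    have "integrable halfline (\<lambda>x. c x * \<rho> x * r x)"
    proof (rule Bochner_Integration.integrable_bound)
      show "integrable halfline (\<lambda>x. B * M\<^sup>2 * r x)" using ri by auto
      show "AE x in halfline. norm (c x * \<rho> x * r x) \<le> norm (B * M\<^sup>2 * r x)"
      proof (rule AE_I2)
        fix x assume "x \<in> space halfline"
        then have "\<bar>c x\<bar> * \<rho> x * \<bar>r x\<bar> \<le> B * M\<^sup>2 * \<bar>r x\<bar>"
          using B[of x] B0 \<rho>M[of x] \<rho>0[of x] by (intro mult_mono) auto
        then show "norm (c x * \<rho> x * r x) \<le> norm (B * M\<^sup>2 * r x)"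
          using B0 \<rho>0[of x] by (simp add: abs_mult)
      qed
    qed (use m in auto)
    moreover have "integrable halfline (\<lambda>x. (w * (1 + (c x)\<^sup>2) * \<rho> x * \<rho> x) * \<rho> x)"
    proof (rule Bochner_Integration.integrable_bound)
      show "integrable halfline (\<lambda>x. (w * (1 + B\<^sup>2) * M\<^sup>2 * M\<^sup>2) * \<rho> x)" using \<rho>i by auto
      show "AE x in halfline. norm ((w * (1 + (c x)\<^sup>2) * \<rho> x * \<rho> x) * \<rho> x) \<le>
          norm ((w * (1 + B\<^sup>2) * M\<^sup>2 * M\<^sup>2) * \<rho> x)"
      proof (rule AE_I2)
        fix x assume x: "x \<in> space halfline"
        have "\<bar>c x\<bar>\<^sup>2 \<le> B\<^sup>2" by (rule power_mono[OF B]) simp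
        then have "w * (1 + (c x)\<^sup>2) * \<rho> x * \<rho> x * \<rho> x \<le> w * (1 + B\<^sup>2) * M\<^sup>2 * M\<^sup>2 * \<rho> x"
          using w0 \<rho>M[of x] \<rho>0[of x] x by (intro mult_mono) auto
        then show "norm ((w * (1 + (c x)\<^sup>2) * \<rho> x * \<rho> x) * \<rho> x) \<le> norm ((w * (1 + B\<^sup>2) * M\<^sup>2 * M\<^sup>2) * \<rho> x)"
          using w0 \<rho>0[of x] by (simp add: abs_mult)
      qed
    qed (use m in auto)
    ultimately have "integrable halfline (\<lambda>x. 2 * (c x * \<rho> x * r x) + (w * (1 + (c x)\<^sup>2) * \<rho> x * \<rho> x) * \<rho> x)"
      by auto
    moreover have "h' = (\<lambda>x. 2 * (c x * \<rho> x * r x) + (w * (1 + (c x)\<^sup>2) * \<rho> x * \<rho> x) * \<rho> x)"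
      by (auto simp: h'_def c'_def fun_eq_iff algebra_simps)
    ultimately show ?thesis by simp
  qed
  \<comment> \<open>No mass has been used up at 0, so \<open>c 0 = cot A\<close>; the sign is that
    of the lower endpoint.\<close>
  have I: "integral\<^sup>L halfline h' = - (cot A * (norm (f 0)) ^ 4)"
    using indef_int_vanishes_at_infinity(2)[OF hi i1 i2]
    by (simp add: c_def F_def \<rho>_def power_add[symmetric])
  have G: "integrable halfline (\<lambda>x. (norm (g x))\<^sup>2)" using h(2) by (simp add: L2_half_def)
  note S = H1_half_power6[OF H]
  have "integral\<^sup>L halfline (\<lambda>x. - (w / 4) * h' x) \<le> integral\<^sup>L halfline (\<lambda>x. (norm (g x))\<^sup>2 - (norm (f x)) ^ 6 / 3)"
  proof (rule integral_mono)
    show "integrable halfline (\<lambda>x. - (w / 4) * h' x)" using i2 by auto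
    show "integrable halfline (\<lambda>x. (norm (g x))\<^sup>2 - (norm (f x)) ^ 6 / 3)" using G S by auto
    fix x
    have "\<bar>r x\<bar> \<le> norm (f x * cnj (g x) + g x * cnj (f x))" unfolding r_def by (rule abs_Re_le_cmod)
    also have "\<dots> \<le> norm (f x * cnj (g x)) + norm (g x * cnj (f x))" by (rule norm_triangle_ineq)
    also have "\<dots> = 2 * norm (f x) * norm (g x)" by (simp add: norm_mult)
    finally have "\<bar>r x\<bar> \<le> 2 * norm (f x) * norm (g x)" .
    from calibration_pointwise[OF _ _ _ _ this, of "w / 2" "c x"]
    have "- (w / 4) * (c x * (2 * (norm (f x))\<^sup>2 * r x) + w * (norm (f x))\<^sup>2 * (1 + (c x)\<^sup>2) * norm (f x) ^ 4)
        \<le> (norm (g x))\<^sup>2 - (norm (f x)) ^ 6 / 3"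
      using w0 by (simp add: w_def power_divide mult.commute[of 2 "sqrt 3"])
    moreover have "h' x = c x * (2 * (norm (f x))\<^sup>2 * r x) + w * (norm (f x))\<^sup>2 * (1 + (c x)\<^sup>2) * norm (f x) ^ 4"
      by (simp add: h'_def c'_def \<rho>_def algebra_simps power_add[symmetric])
    ultimately show "- (w / 4) * h' x \<le> (norm (g x))\<^sup>2 - (norm (f x)) ^ 6 / 3" by simp
  qed
  also have "\<dots> = half_sq g - half_six f / 3"
    unfolding half_sq_def half_six_def using G S by simp
  finally show ?thesis using I by (simp add: w_def)
qed

text \<open>For \<tau> > 1 this is the angle in (0, pi/4) whose tangent is 1/\<tau>^2.\<close>

definition angle :: "real \<Rightarrow> real" where
  "angle \<tau> = arcsin (1 / sqrt (1 + \<tau> ^ 4))"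


lemma angle:
  assumes "\<tau> > 1"
  shows "sin (angle \<tau>) = 1 / sqrt (1 + \<tau> ^ 4)" "cos (angle \<tau>) = \<tau>\<^sup>2 / sqrt (1 + \<tau> ^ 4)"
    "cos (2 * angle \<tau>) = (\<tau> ^ 4 - 1) / (\<tau> ^ 4 + 1)" "0 < angle \<tau>" "angle \<tau> < pi / 4"
proof -
  have t4: "\<tau> ^ 4 > 1" using assms by (simp add: one_less_power)
  have s1: "sqrt (1 + \<tau> ^ 4) > 1" using assms by simp
  have q: "(sqrt (1 + \<tau> ^ 4))\<^sup>2 = 1 + \<tau> ^ 4" using t4 by simp
  have b: "0 < 1 / sqrt (1 + \<tau> ^ 4)" "1 / sqrt (1 + \<tau> ^ 4) < 1"
  proof -
    have *: "0 < 1 / y \<and> 1 / y < 1" if "y > 1" for y :: real using that by simp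
    show "0 < 1 / sqrt (1 + \<tau> ^ 4)" "1 / sqrt (1 + \<tau> ^ 4) < 1" using *[OF s1] by blast+
  qed
  have b': "- 1 < 1 / sqrt (1 + \<tau> ^ 4)" using b(1) by linarith
  show s: "sin (angle \<tau>) = 1 / sqrt (1 + \<tau> ^ 4)" unfolding angle_def by (rule sin_arcsin[OF less_imp_le[OF b'] less_imp_le[OF b(2)]])
  have "cos (angle \<tau>) = sqrt (1 - (1 / sqrt (1 + \<tau> ^ 4))\<^sup>2)"
    unfolding angle_def by (rule cos_arcsin[OF less_imp_le[OF b'] less_imp_le[OF b(2)]])
  also have "1 - (1 / sqrt (1 + \<tau> ^ 4))\<^sup>2 = (\<tau>\<^sup>2 / sqrt (1 + \<tau> ^ 4))\<^sup>2"
    using t4 unfolding power_divide q by (simp add: field_simps)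
  also have "sqrt \<dots> = \<tau>\<^sup>2 / sqrt (1 + \<tau> ^ 4)" by (subst real_sqrt_abs) (use s1 in auto)
  finally show "cos (angle \<tau>) = \<tau>\<^sup>2 / sqrt (1 + \<tau> ^ 4)" .
  have c2: "cos (2 * angle \<tau>) = 1 - 2 * (sin (angle \<tau>))\<^sup>2" by (rule cos_double_sin)
  also have "\<dots> = (\<tau> ^ 4 - 1) / (\<tau> ^ 4 + 1)"
    unfolding s power_divide q using t4 by (simp add: field_simps)
  finally show c2': "cos (2 * angle \<tau>) = (\<tau> ^ 4 - 1) / (\<tau> ^ 4 + 1)" .
  show p: "0 < angle \<tau>" unfolding angle_def using arcsin_less_arcsin[of 0 "1 / sqrt (1 + \<tau> ^ 4)"] b(1) less_imp_le[OF b(2)] by simp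
  have "angle \<tau> \<le> pi / 2" unfolding angle_def using arcsin_bounded[OF less_imp_le[OF b'] less_imp_le[OF b(2)]] by blast
  moreover have "cos (2 * angle \<tau>) > 0" unfolding c2' using t4 by simp
  ultimately have "2 * angle \<tau> < pi / 2"
    using p cos_monotone_0_pi_le[of "pi / 2" "2 * angle \<tau>"] by (cases "2 * angle \<tau> < pi / 2") auto
  then show "angle \<tau> < pi / 4" by simp
qed

text \<open>Multiplication by 2 sin A1 sin A2 > 0 turns the sum into (1 + \<tau>^4) sin (A1 + A2) +
  (\<tau>^4 - 1) sin (A1 - A2). The prescribed sum makes the first term equal to \<tau>^4 - 1, and
  the second is at least its negative.\<close>

lemma cot_weighted_sum_nonneg:
  assumes t: "\<tau> > 1" and A: "0 < A1" "A1 < pi" "0 < A2" "A2 < pi" "A1 + A2 = pi / 2 + 2 * angle \<tau>"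
  shows "cot A1 + \<tau> ^ 4 * cot A2 \<ge> 0"
proof -
  have t4: "\<tau> ^ 4 > 1" using t by (simp add: one_less_power)
  have s: "sin A1 > 0" "sin A2 > 0" using A by (auto intro: sin_gt_zero)
  have "sin (A1 + A2) = cos (2 * angle \<tau>)"
    unfolding A(5) by (simp add: sin_add)
  then have "sin (A1 + A2) = (\<tau> ^ 4 - 1) / (\<tau> ^ 4 + 1)" by (simp only: angle(3)[OF t])
  then have S: "(1 + \<tau> ^ 4) * sin (A1 + A2) = \<tau> ^ 4 - 1"
    using t4 by (simp add: field_simps)
  have "(\<tau> ^ 4 - 1) * (-1) \<le> (\<tau> ^ 4 - 1) * sin (A1 - A2)"
    using t4 by (intro mult_left_mono) auto
  then have "0 \<le> (1 + \<tau> ^ 4) * sin (A1 + A2) + (\<tau> ^ 4 - 1) * sin (A1 - A2)"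
    unfolding S by simp
  also have "\<dots> = 2 * (cos A1 * sin A2 + \<tau> ^ 4 * (cos A2 * sin A1))"
    unfolding sin_add sin_diff by (simp add: algebra_simps)
  also have "\<dots> = 2 * (sin A1 * sin A2) * (cot A1 + \<tau> ^ 4 * cot A2)"
    using s by (simp add: cot_def field_simps)
  finally show ?thesis
    using mult_pos_pos[OF s] by (simp add: zero_le_mult_iff)
qed

definition crit_mass :: "real \<Rightarrow> real" where
  "crit_mass \<tau> = sqrt 3 / 2 * (pi / 2 + 2 * angle \<tau>)"

lemma crit_mass_pos: "\<tau> > 1 \<Longrightarrow> crit_mass \<tau> > 0"
  using angle(4)[of \<tau>] by (simp add: crit_mass_def add_pos_pos)

text \<open>Missing mass leaves room to choose both calibration angles strictly above their
  thresholds while they add up to the critical sum. The boundary terms involve fourth powers of the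
  traces, so the jump contributes the weight \<tau>^4.\<close>

lemma subcritical_energy:
  assumes t: "\<tau> > 1" and H: "H1_half f1 g1" "H1_half f2 g2" and j: "f2 0 = of_real \<tau> * f1 0"
    and m: "half_sq f1 + half_sq f2 < crit_mass \<tau>"
  shows "half_six f1 + half_six f2 \<le> 3 * (half_sq g1 + half_sq g2)"
proof -
  define w where "w = 2 / sqrt 3"
  \<comment> \<open>Half of the available slack: each angle receives the same share, and the sum
    comes out exactly. Both angles are then below pi because they are positive and their sum is less
    than pi.\<close>
  define d where "d = (pi / 2 + 2 * angle \<tau> - w * (half_sq f1 + half_sq f2)) / 2"
  have w0: "w > 0" by (simp add: w_def)
  have "w * (half_sq f1 + half_sq f2) < w * crit_mass \<tau>" using m w0 by simp
  also have "\<dots> = pi / 2 + 2 * angle \<tau>" by (simp add: w_def crit_mass_def)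
  finally have d0: "d > 0" by (simp add: d_def)
  have n: "w * half_sq f1 \<ge> 0" "w * half_sq f2 \<ge> 0" using w0 half_sq_nonneg by auto
  define A1 A2 where "A1 = w * half_sq f1 + d" and "A2 = w * half_sq f2 + d"
  have sum: "A1 + A2 = pi / 2 + 2 * angle \<tau>"
    by (simp add: A1_def A2_def d_def distrib_left)
  have pos: "0 < A1" "0 < A2" using n d0 by (auto simp: A1_def A2_def)
  then have lt: "A1 < pi" "A2 < pi" using sum angle(5)[OF t] by auto
  have lo: "2 / sqrt 3 * half_sq f1 < A1" "2 / sqrt 3 * half_sq f2 < A2"
    using d0 by (auto simp: A1_def A2_def w_def)
  have "norm (f2 0) ^ 4 = \<tau> ^ 4 * norm (f1 0) ^ 4"
    using t by (simp add: j norm_mult power_mult_distrib)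
  then have "1 / (2 * sqrt 3) * cot A1 * norm (f1 0) ^ 4 + 1 / (2 * sqrt 3) * cot A2 * norm (f2 0) ^ 4 =
      1 / (2 * sqrt 3) * norm (f1 0) ^ 4 * (cot A1 + \<tau> ^ 4 * cot A2)"
    by (simp add: algebra_simps add_divide_distrib)
  also have "\<dots> \<ge> 0"
    using cot_weighted_sum_nonneg[OF t pos(1) lt(1) pos(2) lt(2) sum] by (intro mult_nonneg_nonneg) auto
  finally show ?thesis
    using calibration[OF H(1) lo(1) lt(1)] calibration[OF H(2) lo(2) lt(2)] by argo
qed

text \<open>Multiplication by sqrt y scales mass and gradient term by y and the sextic term by y^3,
  so y^2 S \<le> 3 G whenever y m is subcritical. Letting y approach \<open>crit_mass \<tau>\<close>
  / m from below gives the constant; for m = 0 every y is allowed and S must vanish.\<close>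

lemma sharp_inequality:
  assumes t: "\<tau> > 1" and R: "rep u f1 g1 f2 g2" and j: "f2 0 = of_real \<tau> * f1 0"
  shows "half_six f1 + half_six f2 \<le>
    3 / (crit_mass \<tau>)\<^sup>2 * (half_sq g1 + half_sq g2) * (half_sq f1 + half_sq f2)\<^sup>2"
proof -
  define m G S where "m = half_sq f1 + half_sq f2" and "G = half_sq g1 + half_sq g2"
    and "S = half_six f1 + half_six f2"
  have n: "m \<ge> 0" "G \<ge> 0" "S \<ge> 0"
    unfolding m_def G_def S_def by (auto intro!: add_nonneg_nonneg half_sq_nonneg half_six_nonneg)
  have cm: "crit_mass \<tau> > 0" by (rule crit_mass_pos[OF t])
  have scaled: "y\<^sup>2 * S \<le> 3 * G" if y: "y > 0" "y * m < crit_mass \<tau>" for y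
  proof -
    define c where "c = complex_of_real (sqrt y)"
    have nc: "(norm c)\<^sup>2 = y" using y by (simp add: c_def)
    have "(norm c) ^ 6 = ((norm c)\<^sup>2) ^ 3" by (simp flip: power_mult)
    then have nc6: "(norm c) ^ 6 = y ^ 3" by (simp add: nc)
    have H: "H1_half (\<lambda>x. c * f1 x) (\<lambda>x. c * g1 x)" "H1_half (\<lambda>x. c * f2 x) (\<lambda>x. c * g2 x)"
      using R unfolding rep_def by (auto intro: H1_half_cmult)
    have "y ^ 3 * S \<le> 3 * (y * G)"
      using subcritical_energy[OF t H] j y
      by (simp add: half_sq_cmult half_six_cmult nc nc6 m_def G_def S_def algebra_simps)
    then have "y * (y\<^sup>2 * S) \<le> y * (3 * G)" by (simp add: power3_eq_cube power2_eq_square algebra_simps)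
    then show ?thesis using y by simp
  qed
  have "S \<le> 3 / (crit_mass \<tau>)\<^sup>2 * G * m\<^sup>2"
  proof (cases "m = 0")
    case True
    have "S = 0"
    proof (rule ccontr)
      assume "S \<noteq> 0"
      then have S: "S > 0" using n by simp
      \<comment> \<open>Solves y^2 S = 3 G + 1, which violates the scaled inequality.\<close>
      define y where "y = sqrt ((3 * G + 1) / S)"
      have q: "(3 * G + 1) / S > 0" using S n by auto
      have "y\<^sup>2 * S \<le> 3 * G" by (rule scaled) (use True cm q in \<open>auto simp: y_def\<close>)
      then show False using q S by (simp add: y_def)
    qed
    then show ?thesis using True by simp
  next
    case False
    then have m: "m > 0" using n by simp
    have *: "z * S \<le> 3 / (crit_mass \<tau>)\<^sup>2 * G * m\<^sup>2" if z: "0 < z" "z < 1" for z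
    proof -
      define y where "y = sqrt z * crit_mass \<tau> / m"
      have "sqrt z < 1" using z by simp
      then have "y\<^sup>2 * S \<le> 3 * G"
        using z cm m by (intro scaled) (auto simp: y_def)
      moreover have "y\<^sup>2 = z * (crit_mass \<tau>)\<^sup>2 / m\<^sup>2" using z by (simp add: y_def power_mult_distrib power_divide)
      ultimately show ?thesis using cm m by (simp add: field_simps)
    qed
    show ?thesis by (rule field_le_mult_one_interval) (rule *)
  qed
  then show ?thesis by (simp add: m_def G_def S_def)
qed

section \<open>Positive solutions of the stationary equation on the half-line\<close>

abbreviation cr :: "(real \<Rightarrow> real) \<Rightarrow> real \<Rightarrow> complex" where
  "cr f \<equiv> (\<lambda>x. complex_of_real (f x))"

text \<open>The equation a'' = lam a - a^5 as a first-order system with b = a'. Decay at infinity is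
  encoded in square integrability, and positivity at the endpoint itself is a consequence
  (\<open>half_ode_pos\<close>).\<close>

definition half_ode :: "real \<Rightarrow> (real \<Rightarrow> real) \<Rightarrow> (real \<Rightarrow> real) \<Rightarrow> bool" where
  "half_ode lam a b \<longleftrightarrow> H1_half (cr a) (cr b) \<and> H1_half (cr b) (cr (\<lambda>x. lam * a x - a x ^ 5)) \<and>
     (\<forall>x>0. a x > 0)"

lemma indef_int_of_real_iff: "indef_int (cr f) (cr g) \<longleftrightarrow> indef_int f g"
proof
  assume "indef_int (cr f) (cr g)"
  from indef_int_bounded_linear[OF bounded_linear_Re this] show "indef_int f g" by simp
qed (rule indef_int_bounded_linear[OF bounded_linear_of_real])

lemma half_ode_deriv:
  assumes "half_ode lam a b" "x \<ge> 0"
  shows "(a has_real_derivative b x) (at x within {0..})"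
    "(b has_real_derivative (lam * a x - a x ^ 5)) (at x within {0..})"
proof -
  have "indef_int (cr a) (cr b)" "indef_int (cr b) (cr (\<lambda>x. lam * a x - a x ^ 5))"
    using assms(1) unfolding half_ode_def H1_half_def by blast+
  then have a: "indef_int a b" and b: "indef_int b (\<lambda>x. lam * a x - a x ^ 5)"
    by (simp_all only: indef_int_of_real_iff)
  have c: "continuous_on {0..} a" "continuous_on {0..} b"
    by (rule indef_int_continuous_on[OF a], rule indef_int_continuous_on[OF b])
  then have c': "continuous_on {0..} (\<lambda>x. lam * a x - a x ^ 5)" by (intro continuous_intros)
  show "(a has_real_derivative b x) (at x within {0..})"
    "(b has_real_derivative (lam * a x - a x ^ 5)) (at x within {0..})"
    using indef_int_has_derivative[OF a c(2) assms(2)] indef_int_has_derivative[OF b c' assms(2)]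
    by (auto simp: has_real_derivative_iff_has_vector_derivative)
qed

lemma half_ode_integrable:
  assumes "half_ode lam a b"
  shows "integrable halfline (\<lambda>x. (a x)\<^sup>2)" "integrable halfline (\<lambda>x. (b x)\<^sup>2)"
    "integrable halfline (\<lambda>x. a x ^ 6)"
proof -
  have H: "H1_half (cr a) (cr b)" using assms by (simp add: half_ode_def)
  have "norm (cr a x) ^ 6 = a x ^ 6" for x
    using power_even_abs[of 6 "a x"] by simp
  then show "integrable halfline (\<lambda>x. (a x)\<^sup>2)" "integrable halfline (\<lambda>x. (b x)\<^sup>2)"
    "integrable halfline (\<lambda>x. a x ^ 6)"
    using H1_halfD(1,2)[OF H] H1_half_power6[OF H] by (auto simp: L2_half_def)
qed

lemma half_sq_cr: "half_sq (cr f) = integral\<^sup>L halfline (\<lambda>x. (f x)\<^sup>2)"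
  by (simp add: half_sq_def)

lemma half_six_cr: "half_six (cr f) = integral\<^sup>L halfline (\<lambda>x. f x ^ 6)"
  using power_even_abs[of 6] by (simp add: half_six_def)

text \<open>The conserved quantity \<open>E\<close> is integrable over a half-line of infinite
  length, so its constant value can only be 0.\<close>

lemma half_ode_first_integral:
  assumes ode: "half_ode lam a b" and x: "x \<ge> 0"
  shows "(b x)\<^sup>2 = lam * (a x)\<^sup>2 - a x ^ 6 / 3"
proof -
  define E where "E x = (b x)\<^sup>2 - lam * (a x)\<^sup>2 + a x ^ 6 / 3" for x
  have "(E has_real_derivative 0) (at x within {0..})" if "x \<ge> 0" for x
  proof -
    note d = half_ode_deriv[OF ode that]
    have "(E has_real_derivative 2 * b x * (lam * a x - a x ^ 5) - lam * (2 * a x * b x) + (6 * a x ^ 5 * b x) / 3)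
        (at x within {0..})"
      unfolding E_def by (auto intro!: derivative_eq_intros d simp: algebra_simps)
    moreover have "2 * b x * (lam * a x - a x ^ 5) - lam * (2 * a x * b x) + (6 * a x ^ 5 * b x) / 3 = 0"
      by (simp add: algebra_simps)
    ultimately show ?thesis by simp
  qed
  then obtain K where K: "\<And>x. x \<ge> 0 \<Longrightarrow> E x = K"
    using has_field_derivative_zero_constant[of "{0..}" E] by (auto simp: convex_real_interval)
  have "integrable halfline E"
    unfolding E_def[abs_def] using half_ode_integrable[OF ode] by auto
  moreover have "integrable halfline E \<longleftrightarrow> integrable halfline (\<lambda>x. K)"
    by (rule Bochner_Integration.integrable_cong) (use K in auto)
  ultimately have "integrable halfline (\<lambda>x. K)" by blast
  then have "K = 0" by (rule not_integrable_halfline_const)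
  then show ?thesis using K[OF x] by (simp add: E_def)
qed

lemma half_ode_lam_pos:
  assumes ode: "half_ode lam a b"
  shows "lam > 0"
proof -
  have a: "a 1 > 0" using ode by (simp add: half_ode_def)
  have "0 \<le> lam * (a 1)\<^sup>2 - a 1 ^ 6 / 3"
    using half_ode_first_integral[OF ode, of 1] zero_le_power2[of "b 1"] by simp
  moreover have "a 1 ^ 6 > 0" using a by simp
  ultimately have "0 < lam * (a 1)\<^sup>2" by linarith
  then show ?thesis using a by (simp add: zero_less_mult_iff)
qed

text \<open>Positivity at the endpoint: the first integral gives \<open>\<bar>a'\<bar> \<le> \<surd>\<lambda> a\<close>, so \<open>a(x) exp (-\<surd>\<lambda> x)\<close>
  is nonincreasing.\<close>

lemma half_ode_pos:
  assumes ode: "half_ode lam a b" and x: "x \<ge> 0"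
  shows "a x > 0"
proof -
  have p: "a x > 0" if "x > 0" for x using ode that by (simp add: half_ode_def)
  have l: "lam > 0" by (rule half_ode_lam_pos[OF ode])
  have "a 0 > 0"
  proof -
    have bl: "b x \<le> sqrt lam * a x" if "x > 0" for x
    proof -
      have "(b x)\<^sup>2 \<le> (sqrt lam * a x)\<^sup>2"
        using half_ode_first_integral[OF ode, of x] that l p[OF that] by (simp add: power_mult_distrib)
      then show ?thesis
        by (rule power2_le_imp_le) (use p[OF that] l in \<open>simp add: less_imp_le\<close>)
    qed
    define h where "h x = a x * exp (- sqrt lam * x)" for x
    have c: "continuous_on {0..1} a"
    proof -
      have "indef_int a b" using ode by (auto simp: half_ode_def H1_half_def indef_int_of_real_iff)
      then show ?thesis by (rule indef_int_continuous)
    qed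
    have "h 1 \<le> h 0"
    proof (rule DERIV_nonpos_imp_decreasing_open[where f=h and a=0 and b=1])
      show "continuous_on {0..1} h" unfolding h_def by (intro continuous_intros c)
      fix x :: real assume x: "0 < x" "x < 1"
      have "(a has_real_derivative b x) (at x)"
        using half_ode_deriv(1)[OF ode, of x] x at_within_interior[of x "{0..}"] by simp
      then have "(h has_real_derivative (b x * exp (- sqrt lam * x) + a x * (exp (- sqrt lam * x) * (- sqrt lam)))) (at x)"
        unfolding h_def by (auto intro!: derivative_eq_intros)
      moreover have "b x * exp (- sqrt lam * x) + a x * (exp (- sqrt lam * x) * (- sqrt lam)) =
          (b x - sqrt lam * a x) * exp (- sqrt lam * x)" by (simp add: algebra_simps)
      moreover have "\<dots> \<le> 0" using bl[OF x(1)] by (intro mult_nonpos_nonneg) auto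
      ultimately show "\<exists>y. (h has_real_derivative y) (at x) \<and> y \<le> 0" by auto
    qed simp
    moreover have "h 1 > 0" using p[of 1] by (simp add: h_def)
    ultimately show ?thesis by (simp add: h_def)
  qed
  with p x show ?thesis by (cases "x = 0") auto
qed

text \<open>The logarithmic slope \<open>p = a' / (\<surd>\<lambda> a)\<close> decreases from \<open>p(0)\<close> to \<open>-1\<close>, and
  \<open>(arccos p)' = (2 / \<surd>3) a\<^sup>2\<close>.\<close>

lemma half_ode_mass:
  assumes ode: "half_ode lam a b"
  shows "2 / sqrt 3 * half_sq (cr a) = pi - arccos (b 0 / (sqrt lam * a 0))"
    "(b 0 / (sqrt lam * a 0))\<^sup>2 = 1 - a 0 ^ 4 / (3 * lam)"
proof -
  define p where "p x = b x / (sqrt lam * a x)" for x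
  have l: "lam > 0" by (rule half_ode_lam_pos[OF ode])
  have pos: "a x > 0" if "x \<ge> 0" for x by (rule half_ode_pos[OF ode that])
  have p2: "(p x)\<^sup>2 = 1 - a x ^ 4 / (3 * lam)" if x: "x \<ge> 0" for x
  proof -
    have "a x ^ 6 = a x ^ 4 * (a x)\<^sup>2" by (simp flip: power_add)
    then show ?thesis
      using half_ode_first_integral[OF ode x] pos[OF x] l
      by (simp add: p_def power_divide power_mult_distrib field_simps)
  qed
  then show "(b 0 / (sqrt lam * a 0))\<^sup>2 = 1 - a 0 ^ 4 / (3 * lam)" by (auto simp: p_def)
  have pb: "-1 < p x" "p x < 1" if x: "x \<ge> 0" for x
  proof -
    have "a x ^ 4 / (3 * lam) > 0" using pos[OF x] l by simp
    then have "(p x)\<^sup>2 < 1" using p2[OF x] by linarith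
    then have "\<bar>p x\<bar> < 1" by (simp add: abs_square_less_1)
    then show "-1 < p x" "p x < 1" by auto
  qed
  have pd: "(p has_real_derivative (- 2 / 3 * a x ^ 4 / sqrt lam)) (at x within {0..})" if x: "x \<ge> 0" for x
  proof -
    note d = half_ode_deriv[OF ode x]
    have a: "a x > 0" by (rule pos[OF x])
    have "(p has_real_derivative ((lam * a x - a x ^ 5) * (sqrt lam * a x) - b x * (sqrt lam * b x)) /
        ((sqrt lam * a x) * (sqrt lam * a x))) (at x within {0..})"
      unfolding p_def using a l by (auto intro!: derivative_eq_intros d)
    moreover have "((lam * a x - a x ^ 5) * (sqrt lam * a x) - b x * (sqrt lam * b x)) =
      sqrt lam * (lam * (a x)\<^sup>2 - a x ^ 6 - (b x)\<^sup>2)"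
      by (simp add: algebra_simps power2_eq_square power_Suc[symmetric] eval_nat_numeral)
    moreover have "\<dots> = sqrt lam * (- 2 / 3 * a x ^ 6)"
      by (simp add: half_ode_first_integral[OF ode x])
    moreover have "sqrt lam * (- 2 / 3 * a x ^ 6) / ((sqrt lam * a x) * (sqrt lam * a x)) = - 2 / 3 * a x ^ 4 / sqrt lam"
      using a l by (simp add: field_simps eval_nat_numeral)
    ultimately show ?thesis by simp
  qed
  have ac: "((\<lambda>x. arccos (p x)) has_real_derivative (2 / sqrt 3 * (a x)\<^sup>2)) (at x within {0..})" if x: "x \<ge> 0" for x
  proof -
    have a: "a x > 0" by (rule pos[OF x])
    \<comment> \<open>By the first integral the denominator in the derivative of arccos is a
      multiple of a^2, and lam cancels from the rate. This is why the mass depends only on the slope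
      at 0.\<close>
    have "sqrt (1 - (p x)\<^sup>2) = sqrt (((a x)\<^sup>2)\<^sup>2 / (3 * lam))"
      using p2[OF x] by (simp flip: power_mult)
    also have "\<dots> = (a x)\<^sup>2 / (sqrt 3 * sqrt lam)"
      unfolding real_sqrt_divide real_sqrt_abs real_sqrt_mult by simp
    finally have s: "sqrt (1 - (p x)\<^sup>2) = (a x)\<^sup>2 / (sqrt 3 * sqrt lam)" .
    have "((\<lambda>x. arccos (p x)) has_real_derivative (inverse (- sqrt (1 - (p x)\<^sup>2)) * (- 2 / 3 * a x ^ 4 / sqrt lam)))
        (at x within {0..})"
      by (rule DERIV_chain2[OF DERIV_arccos[OF pb(1)[OF x] pb(2)[OF x]] pd[OF x]])
    moreover have "inverse (- sqrt (1 - (p x)\<^sup>2)) * (- 2 / 3 * a x ^ 4 / sqrt lam) = 2 / 3 * sqrt 3 * (a x)\<^sup>2"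
      unfolding s using a l by (simp add: field_simps eval_nat_numeral)
    moreover have "2 / 3 * sqrt 3 = 2 / sqrt (3::real)"
      by (simp add: field_simps)
    ultimately show ?thesis by (simp only:)
  qed
  have ai: "integrable halfline (\<lambda>x. (a x)\<^sup>2)" by (rule half_ode_integrable[OF ode])
  have int: "integral {0..x} (\<lambda>x. 2 / sqrt 3 * (a x)\<^sup>2) = arccos (p x) - arccos (p 0)" if "x \<ge> 0" for x
  proof (rule integral_unique, rule fundamental_theorem_of_calculus[OF that])
    fix y assume "y \<in> {0..x}"
    then have "((\<lambda>x. arccos (p x)) has_vector_derivative 2 / sqrt 3 * (a y)\<^sup>2) (at y within {0..})"
      using ac[of y] by (simp only: has_real_derivative_iff_has_vector_derivative atLeastAtMost_iff)
    then show "((\<lambda>x. arccos (p x)) has_vector_derivative 2 / sqrt 3 * (a y)\<^sup>2) (at y within {0..x})"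
      by (rule has_vector_derivative_within_subset) auto
  qed
  have "((\<lambda>x. integral {0..x} (\<lambda>x. 2 / sqrt 3 * (a x)\<^sup>2)) \<longlongrightarrow> integral\<^sup>L halfline (\<lambda>x. 2 / sqrt 3 * (a x)\<^sup>2)) at_top"
    by (rule integral_tendsto_halfline) (use ai in auto)
  then have lim1: "((\<lambda>x. arccos (p x) - arccos (p 0)) \<longlongrightarrow> integral\<^sup>L halfline (\<lambda>x. 2 / sqrt 3 * (a x)\<^sup>2)) at_top"
    by (rule Lim_transform_eventually) (rule eventually_mono[OF eventually_ge_at_top[of 0]], rule int)
  have pdec: "p x \<le> p 0" if "x \<ge> 0" for x
  proof -
    have "arccos (p x) - arccos (p 0) \<ge> 0"
      unfolding int[OF that, symmetric]
      by (rule integral_nonneg, rule set_lebesgue_integral_eq_integral(1), rule halfline_abs_integrable) (use ai in auto)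
    then show ?thesis
      using arccos_less_mono[of "p 0" "p x"] pb[of 0] pb[OF that] arccos_less_arccos[of "p 0" "p x"]
      by (cases "p x \<le> p 0") auto
  qed
  have a0: "(a \<longlongrightarrow> 0) at_top"
  proof -
    have "(cr a \<longlongrightarrow> 0) at_top" using ode unfolding half_ode_def by (blast intro: H1_half_tendsto_0)
    from tendsto_Re[OF this] show ?thesis by simp
  qed
  \<comment> \<open>Since (1 + p) (1 - p) = a^4 / (3 lam) tends to 0, \<open>p\<close> can only
    approach 1 or -1. Monotonicity keeps 1 - p above 1 - p(0) > 0, which selects -1.\<close>
  have "(p \<longlongrightarrow> -1) at_top"
  proof -
    have z: "((\<lambda>x. a x ^ 4 / (3 * lam) / (1 - p 0)) \<longlongrightarrow> 0 ^ 4 / (3 * lam) / (1 - p 0)) at_top"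
      using l pb[of 0] by (intro tendsto_intros a0) auto
    have "((\<lambda>x. p x + 1) \<longlongrightarrow> 0) at_top"
    proof (rule Lim_null_comparison)
      show "\<forall>\<^sub>F x in at_top. norm (p x + 1) \<le> a x ^ 4 / (3 * lam) / (1 - p 0)"
      proof (rule eventually_mono[OF eventually_ge_at_top[of 0]])
        fix x :: real assume x: "0 \<le> x"
        have "(p x + 1) * (1 - p 0) \<le> (p x + 1) * (1 - p x)"
          using pdec[OF x] pb[OF x] by (intro mult_left_mono) auto
        also have "\<dots> = a x ^ 4 / (3 * lam)" using p2[OF x] by (simp add: algebra_simps power2_eq_square)
        finally have "p x + 1 \<le> a x ^ 4 / (3 * lam) / (1 - p 0)"
          using pb(2)[of 0] by (subst pos_le_divide_eq) auto
        moreover have "norm (p x + 1) = p x + 1" using pb[OF x] by simp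
        ultimately show "norm (p x + 1) \<le> a x ^ 4 / (3 * lam) / (1 - p 0)" by (simp only:)
      qed
      show "((\<lambda>x. a x ^ 4 / (3 * lam) / (1 - p 0)) \<longlongrightarrow> 0) at_top" using z by simp
    qed
    from tendsto_add[OF this tendsto_const[of "-1"]] show ?thesis by simp
  qed
  then have "((\<lambda>x. arccos (p x)) \<longlongrightarrow> arccos (-1)) at_top"
    by (rule continuous_on_tendsto_compose[OF continuous_on_arccos'])
       (auto intro!: eventually_mono[OF eventually_ge_at_top[of 0]] less_imp_le pb)
  then have "((\<lambda>x. arccos (p x) - arccos (p 0)) \<longlongrightarrow> arccos (-1) - arccos (p 0)) at_top"
    by (intro tendsto_intros)
  from tendsto_unique[OF _ lim1 this]
  have "integral\<^sup>L halfline (\<lambda>x. 2 / sqrt 3 * (a x)\<^sup>2) = pi - arccos (p 0)" by simp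
  then show "2 / sqrt 3 * half_sq (cr a) = pi - arccos (b 0 / (sqrt lam * a 0))"
    by (simp add: half_sq_cr p_def)
qed

lemma half_ode_energy:
  assumes ode: "half_ode lam a b"
  shows "half_sq (cr b) = lam * half_sq (cr a) - half_six (cr a) / 3"
proof -
  note I = half_ode_integrable[OF ode]
  have "half_sq (cr b) = integral\<^sup>L halfline (\<lambda>x. lam * (a x)\<^sup>2 - a x ^ 6 / 3)"
    unfolding half_sq_cr
    by (rule Bochner_Integration.integral_cong) (use half_ode_first_integral[OF ode] in auto)
  also have "\<dots> = lam * half_sq (cr a) - half_six (cr a) / 3"
    using I by (simp add: half_sq_cr half_six_cr)
  finally show ?thesis .
qed

section \<open>Explicit profiles with prescribed slope at the origin\<close>

lemma tanh_surj:
  assumes "-1 < q" "q < 1"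
  obtains y :: real where "tanh y = q"
proof -
  define y where "y = - ln ((1 - q) / (1 + q)) / 2"
  have e: "exp (- 2 * y) = (1 - q) / (1 + q)" using assms by (simp add: y_def)
  have "tanh y = q"
    unfolding tanh_real_altdef e using assms by (simp add: field_simps)
  then show ?thesis by (rule that)
qed

lemma integrable_exp_halfline:
  assumes "c > 0"
  shows "integrable halfline (\<lambda>x. exp (- c * x))"
proof -
  have "(\<lambda>x. exp (- c * x)) absolutely_integrable_on {0..}"
    by (rule nonnegative_absolutely_integrable_1)
       (use has_integral_exp_minus_to_infinity[OF assms, of 0] in auto)
  then show ?thesis
    unfolding integrable_halfline_iff by (rule set_integrable_subset) auto
qed

text \<open>The profile is the translated soliton a^2 = sqrt (3 lam) / cosh (2 sqrt lam x + z). Its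
  logarithmic slope b / (sqrt lam a) is -tanh (2 sqrt lam x + z), so the shift \<open>z\<close> can
  be tuned to any slope in (-1, 1) at 0.\<close>

lemma half_ode_profile:
  assumes lam: "lam > 0" and q: "-1 < q" "q < 1"
  obtains a b where "half_ode lam a b" "b 0 = q * (sqrt lam * a 0)"
proof -
  obtain z where z: "tanh z = - q" using tanh_surj[of "- q"] q by auto
  define y where "y x = 2 * sqrt lam * x + z" for x
  define a where "a x = sqrt (sqrt (3 * lam) / cosh (y x))" for x
  define b where "b x = - sqrt lam * tanh (y x) * a x" for x
  have a2: "(a x)\<^sup>2 = sqrt (3 * lam) / cosh (y x)" for x using lam by (simp add: a_def)
  have ap: "a x > 0" for x using lam by (simp add: a_def)
  have t2: "(tanh (y x))\<^sup>2 = 1 - a x ^ 4 / (3 * lam)" for x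
  proof -
    have "a x ^ 4 = (sqrt (3 * lam) / cosh (y x))\<^sup>2" unfolding a2[symmetric] by (simp flip: power_mult)
    also have "\<dots> = 3 * lam / (cosh (y x))\<^sup>2" using lam by (simp add: power_divide)
    finally have 1: "a x ^ 4 / (3 * lam) = 1 / (cosh (y x))\<^sup>2" using lam by simp
    have "(sinh (y x))\<^sup>2 = (cosh (y x))\<^sup>2 - 1" using cosh_square_eq[of "y x"] by simp
    then have "(tanh (y x))\<^sup>2 = ((cosh (y x))\<^sup>2 - 1) / (cosh (y x))\<^sup>2" by (simp add: tanh_def power_divide)
    then show ?thesis unfolding 1 by (simp only: diff_divide_distrib) simp
  qed
  have yd: "(y has_real_derivative 2 * sqrt lam) (at x)" for x
    unfolding y_def by (auto intro!: derivative_eq_intros)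
  have ad: "(a has_real_derivative b x) (at x)" for x
  proof -
    let ?s' = "- (sqrt (3 * lam) * (sinh (y x) * (2 * sqrt lam))) / (cosh (y x) * cosh (y x))"
    have "((\<lambda>x. sqrt (3 * lam) / cosh (y x)) has_real_derivative ?s') (at x)"
      by (auto intro!: derivative_eq_intros yd)
    from DERIV_chain2[OF DERIV_real_sqrt this]
    have "(a has_real_derivative (inverse (sqrt (sqrt (3 * lam) / cosh (y x))) / 2 * ?s')) (at x)"
      using lam by (simp add: a_def[abs_def])
    moreover have "inverse (a x) / 2 * ?s' = b x"
    proof -
      have "?s' = - 2 * sqrt lam * tanh (y x) * (a x)\<^sup>2"
        by (simp add: a2 tanh_def)
      then show ?thesis using ap[of x] by (simp add: b_def power2_eq_square)
    qed
    ultimately show ?thesis by (simp add: a_def)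
  qed
  have bd: "(b has_real_derivative (lam * a x - a x ^ 5)) (at x)" for x
  proof -
    have "(b has_real_derivative (- sqrt lam * ((1 - (tanh (y x))\<^sup>2) * (2 * sqrt lam)) * a x + b x * (- sqrt lam * tanh (y x)))) (at x)"
      unfolding b_def by (auto intro!: derivative_eq_intros yd ad[unfolded b_def] simp: algebra_simps)
    moreover have "- sqrt lam * ((1 - (tanh (y x))\<^sup>2) * (2 * sqrt lam)) * a x + b x * (- sqrt lam * tanh (y x)) =
        (sqrt lam)\<^sup>2 * ((- 2 + 3 * (tanh (y x))\<^sup>2) * a x)"
      by (simp add: b_def algebra_simps power2_eq_square del: real_sqrt_mult_self real_sqrt_pow2_iff)
    moreover have "\<dots> = lam * a x - a x ^ 5"
      unfolding t2 using lam by (simp add: field_simps eval_nat_numeral)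
    ultimately show ?thesis by (simp only:)
  qed
  have ac: "continuous_on S a" and bc: "continuous_on S b" for S
    using ad bd by (meson DERIV_isCont continuous_at_imp_continuous_on)+
  have ab: "indef_int a b"
    by (rule indef_int_C1)
       (use ad bc in \<open>auto simp: has_real_derivative_iff_has_vector_derivative has_vector_derivative_at_within\<close>)
  have bP: "indef_int b (\<lambda>x. lam * a x - a x ^ 5)"
  proof (rule indef_int_C1)
    show "(b has_vector_derivative lam * a x - a x ^ 5) (at x within {0..})" for x
      using bd[of x] by (simp add: has_real_derivative_iff_has_vector_derivative has_vector_derivative_at_within)
    show "continuous_on {0..} (\<lambda>x. lam * a x - a x ^ 5)" by (intro continuous_intros ac)
  qed
  have La: "L2_half (cr a)"
    unfolding L2_half_def
  proof
    show "cr a \<in> borel_measurable halfline"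
      by (intro continuous_measurable_halfline continuous_intros ac)
    show "integrable halfline (\<lambda>x. (norm (cr a x))\<^sup>2)"
    proof (rule Bochner_Integration.integrable_bound)
      show "integrable halfline (\<lambda>x. 2 * sqrt (3 * lam) * exp (- z) * exp (- (2 * sqrt lam) * x))"
        using integrable_exp_halfline[of "2 * sqrt lam"] lam by auto
      show "(\<lambda>x. (norm (cr a x))\<^sup>2) \<in> borel_measurable halfline"
        by (intro continuous_measurable_halfline continuous_intros ac)
      have "(a x)\<^sup>2 \<le> 2 * sqrt (3 * lam) * exp (- z) * exp (- (2 * sqrt lam) * x)" for x
      proof -
        have "exp (y x) / 2 \<le> cosh (y x)" by (simp add: cosh_def)
        then have "sqrt (3 * lam) / cosh (y x) \<le> sqrt (3 * lam) / (exp (y x) / 2)"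
          using lam by (intro divide_left_mono) auto
        also have "\<dots> = 2 * sqrt (3 * lam) * exp (- y x)" by (simp add: exp_minus field_simps)
        also have "exp (- y x) = exp (- z) * exp (- (2 * sqrt lam) * x)" by (simp add: y_def flip: exp_add)
        finally show ?thesis by (simp add: a2)
      qed
      then show "AE x in halfline. norm ((norm (cr a x))\<^sup>2) \<le> norm (2 * sqrt (3 * lam) * exp (- z) * exp (- (2 * sqrt lam) * x))"
        by (intro AE_I2) (auto intro: order_trans[OF _ abs_ge_self])
    qed
  qed
  have tb: "\<bar>tanh (y x)\<bar> \<le> 1" for x using tanh_real_bounds[of "y x"] by auto
  have Lb: "L2_half (cr b)"
  proof (rule L2_half_bound[OF La])
    show "cr b \<in> borel_measurable halfline"
      by (intro continuous_measurable_halfline continuous_intros bc)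
    have "\<bar>b x\<bar> \<le> sqrt lam * \<bar>a x\<bar>" for x
    proof -
      have "\<bar>b x\<bar> = sqrt lam * (\<bar>tanh (y x)\<bar> * \<bar>a x\<bar>)" using lam by (simp add: b_def abs_mult)
      also have "\<dots> \<le> sqrt lam * \<bar>a x\<bar>"
        using lam tb[of x] by (intro mult_left_mono mult_left_le_one_le) auto
      finally show ?thesis .
    qed
    then show "AE x in halfline. norm (cr b x) \<le> sqrt lam * norm (cr a x)"
      by (intro AE_I2) (simp only: norm_of_real)
  qed
  have LP: "L2_half (cr (\<lambda>x. lam * a x - a x ^ 5))"
  proof (rule L2_half_bound[OF La])
    show "cr (\<lambda>x. lam * a x - a x ^ 5) \<in> borel_measurable halfline"
      by (intro continuous_measurable_halfline continuous_intros ac)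
    have "\<bar>lam * a x - a x ^ 5\<bar> \<le> 4 * lam * \<bar>a x\<bar>" for x
    proof -
      have "a x ^ 4 / (3 * lam) \<le> 1" using t2[of x] zero_le_power2[of "tanh (y x)"] by linarith
      then have "a x ^ 4 \<le> 3 * lam" using lam by simp
      moreover have "a x ^ 4 \<ge> 0" by simp
      ultimately have "\<bar>lam - a x ^ 4\<bar> \<le> 4 * lam" using lam by linarith
      then have "\<bar>lam - a x ^ 4\<bar> * \<bar>a x\<bar> \<le> 4 * lam * \<bar>a x\<bar>" by (rule mult_right_mono) simp
      moreover have "lam * a x - a x ^ 5 = (lam - a x ^ 4) * a x" by (simp add: algebra_simps eval_nat_numeral)
      ultimately show ?thesis by (simp only: abs_mult)
    qed
    then show "AE x in halfline. norm (cr (\<lambda>x. lam * a x - a x ^ 5) x) \<le> (4 * lam) * norm (cr a x)"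
      by (intro AE_I2) (simp only: norm_of_real)
  qed
  have "half_ode lam a b"
    unfolding half_ode_def H1_half_def indef_int_of_real_iff using La Lb LP ab bP ap by auto
  moreover have "b 0 = q * (sqrt lam * a 0)" by (simp add: b_def y_def z)
  ultimately show ?thesis by (rule that)
qed

section \<open>The differential of the energy\<close>

definition ip :: "(real \<Rightarrow> complex) \<Rightarrow> (real \<Rightarrow> complex) \<Rightarrow> real" where
  "ip f k = integral\<^sup>L halfline (\<lambda>x. Re (f x * cnj (k x)))"

definition ip_six :: "(real \<Rightarrow> complex) \<Rightarrow> (real \<Rightarrow> complex) \<Rightarrow> real" where
  "ip_six f k = integral\<^sup>L halfline (\<lambda>x. norm (f x) ^ 4 * Re (f x * cnj (k x)))"

definition half_energy :: "(real \<Rightarrow> complex) \<Rightarrow> (real \<Rightarrow> complex) \<Rightarrow> real" where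
  "half_energy f g = half_sq g / 2 - half_six f / 6"

text \<open>The candidate for the differential of \<open>half_energy\<close> at
  \<open>(f, g)\<close> in the direction \<open>(k, l)\<close>; \<open>half_taylor\<close> confirms
  it.\<close>

definition half_diff ::
    "(real \<Rightarrow> complex) \<Rightarrow> (real \<Rightarrow> complex) \<Rightarrow> (real \<Rightarrow> complex) \<Rightarrow> (real \<Rightarrow> complex) \<Rightarrow> real" where
  "half_diff f g k l = ip g l - ip_six f k"

lemma integrable_ip:
  assumes "L2_half f" "L2_half k"
  shows "integrable halfline (\<lambda>x. Re (f x * cnj (k x)))"
  using L2_half_mult[OF assms(1) L2_half_cnj[OF assms(2)]]
  by (rule integrable_bounded_linear[OF bounded_linear_Re])

lemma integrable_ip_six:
  assumes H: "H1_half f g" and k: "L2_half k"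
  shows "integrable halfline (\<lambda>x. norm (f x) ^ 4 * Re (f x * cnj (k x)))"
proof -
  obtain B where B: "B > 0" "\<And>x. x \<ge> 0 \<Longrightarrow> norm (f x) \<le> B" using H1_half_bounded[OF H] by metis
  note i = integrable_ip[OF H1_halfD(1)[OF H] k]
  show ?thesis
  proof (rule Bochner_Integration.integrable_bound)
    show "integrable halfline (\<lambda>x. B ^ 4 * Re (f x * cnj (k x)))" using i by auto
    show "(\<lambda>x. norm (f x) ^ 4 * Re (f x * cnj (k x))) \<in> borel_measurable halfline"
      using i H1_halfD(1)[OF H] by (auto simp: L2_half_def)
    show "AE x in halfline. norm (norm (f x) ^ 4 * Re (f x * cnj (k x))) \<le> norm (B ^ 4 * Re (f x * cnj (k x)))"
    proof (rule AE_I2)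
      fix x assume "x \<in> space halfline"
      then have "norm (f x) ^ 4 \<le> B ^ 4" using B by (intro power_mono) auto
      then have "norm (f x) ^ 4 * \<bar>Re (f x * cnj (k x))\<bar> \<le> B ^ 4 * \<bar>Re (f x * cnj (k x))\<bar>"
        by (rule mult_right_mono) simp
      then show "norm (norm (f x) ^ 4 * Re (f x * cnj (k x))) \<le> norm (B ^ 4 * Re (f x * cnj (k x)))"
        using B(1) by (simp only: real_norm_def abs_mult abs_of_nonneg[OF zero_le_power[OF norm_ge_zero]]
            abs_of_nonneg[OF zero_le_power[OF less_imp_le[OF B(1)]]])
    qed
  qed
qed

lemma ip_add: "L2_half f \<Longrightarrow> L2_half k \<Longrightarrow> L2_half k' \<Longrightarrow> ip f (\<lambda>x. k x + k' x) = ip f k + ip f k'"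
proof -
  assume L: "L2_half f" "L2_half k" "L2_half k'"
  have "Re (f x * cnj (k x + k' x)) = Re (f x * cnj (k x)) + Re (f x * cnj (k' x))" for x
    by (simp add: algebra_simps)
  then show ?thesis
    unfolding ip_def using integrable_ip[OF L(1,2)] integrable_ip[OF L(1,3)]
    by (simp only: Bochner_Integration.integral_add)
qed

lemma ip_scale: "ip f (\<lambda>x. complex_of_real c * k x) = c * ip f k"
  unfolding ip_def by (subst integral_mult_right_zero[symmetric]) (simp add: algebra_simps)

lemma ip_self: "ip f f = half_sq f"
  unfolding ip_def half_sq_def by (simp add: complex_norm_square[symmetric] del: of_real_power)

section \<open>Expansion of the energy with quadratic remainder\<close>

lemma norm_sq_add: "(norm (u + h :: complex))\<^sup>2 = (norm u)\<^sup>2 + 2 * Re (u * cnj h) + (norm h)\<^sup>2"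
  unfolding cmod_power2 by (simp add: power2_eq_square algebra_simps)

lemma half_sq_add:
  assumes "L2_half f" "L2_half k"
  shows "half_sq (\<lambda>x. f x + k x) = half_sq f + 2 * ip f k + half_sq k"
proof -
  define r where "r x = Re (f x * cnj (k x))" for x
  have "integrable halfline r" unfolding r_def[abs_def] by (rule integrable_ip[OF assms])
  then show ?thesis
    using L2_halfD(2)[OF assms(1)] L2_halfD(2)[OF assms(2)]
    unfolding half_sq_def ip_def norm_sq_add r_def[symmetric] by simp
qed

text \<open>Weighted Young inequality. The constant is not sharp, but it suffices for the
  boundedness of the linear functional built from \<open>ip\<close>.\<close>

lemma ip_le:
  assumes f: "L2_half f" and k: "L2_half k" and n: "half_sq k \<le> n\<^sup>2" "n \<ge> 0"
  shows "\<bar>ip f k\<bar> \<le> (half_sq f + 1) * n"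
proof (rule field_le_epsilon)
  fix e :: real assume e: "e > 0"
  have F: "half_sq f \<ge> 0" by (rule half_sq_nonneg)
  \<comment> \<open>The ideal weight is \<open>n\<close>, which may be 0. The positive surplus
    permits division, and its contribution to the estimate stays below \<open>e\<close>.\<close>
  define s where "s = n + e / (half_sq f + 1)"
  have e': "e / (half_sq f + 1) > 0" using e F by (simp add: add_nonneg_pos)
  then have s: "s > 0" "n \<le> s" using n by (auto simp: s_def)
  note i = integrable_ip[OF f k]
  have "\<bar>ip f k\<bar> \<le> integral\<^sup>L halfline (\<lambda>x. \<bar>Re (f x * cnj (k x))\<bar>)"
    unfolding ip_def by (rule integral_abs_bound)
  also have "\<dots> \<le> integral\<^sup>L halfline (\<lambda>x. s * (norm (f x))\<^sup>2 + (norm (k x))\<^sup>2 / s)"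
  proof (rule integral_mono)
    show "integrable halfline (\<lambda>x. \<bar>Re (f x * cnj (k x))\<bar>)" using i by auto
    show "integrable halfline (\<lambda>x. s * (norm (f x))\<^sup>2 + (norm (k x))\<^sup>2 / s)"
      using L2_halfD(2)[OF f] L2_halfD(2)[OF k] by auto
    fix x
    have "\<bar>Re (f x * cnj (k x))\<bar> \<le> norm (f x) * norm (k x)"
      using abs_Re_le_cmod[of "f x * cnj (k x)"] by (simp add: norm_mult)
    also have "\<dots> = (sqrt s * norm (f x)) * (norm (k x) / sqrt s)" using s by simp
    also have "\<dots> \<le> (sqrt s * norm (f x))\<^sup>2 + (norm (k x) / sqrt s)\<^sup>2"
    proof -
      have "2 * ((sqrt s * norm (f x)) * (norm (k x) / sqrt s)) \<le> (sqrt s * norm (f x))\<^sup>2 + (norm (k x) / sqrt s)\<^sup>2"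
        using sum_squares_bound[of "sqrt s * norm (f x)" "norm (k x) / sqrt s"] by (simp only: mult.assoc)
      moreover have "(sqrt s * norm (f x)) * (norm (k x) / sqrt s) \<ge> 0" using s by simp
      ultimately show ?thesis by linarith
    qed
    also have "\<dots> = s * (norm (f x))\<^sup>2 + (norm (k x))\<^sup>2 / s"
      using s by (simp add: power_mult_distrib power_divide)
    finally show "\<bar>Re (f x * cnj (k x))\<bar> \<le> s * (norm (f x))\<^sup>2 + (norm (k x))\<^sup>2 / s" .
  qed
  also have "\<dots> = s * half_sq f + half_sq k / s"
    using L2_halfD(2)[OF f] L2_halfD(2)[OF k] by (simp add: half_sq_def)
  also have "half_sq k / s \<le> n"
  proof -
    have "half_sq k \<le> n * s" using n s mult_left_mono[OF s(2) n(2)] by (simp add: power2_eq_square)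
    then show ?thesis using s by (simp add: pos_divide_le_eq)
  qed
  also have "s * half_sq f + n = (half_sq f + 1) * n + e * (half_sq f / (half_sq f + 1))"
    by (simp add: s_def algebra_simps)
  also have "\<dots> \<le> (half_sq f + 1) * n + e"
  proof -
    have "half_sq f / (half_sq f + 1) \<le> 1" using F by simp
    then have "e * (half_sq f / (half_sq f + 1)) \<le> e * 1" using e by (intro mult_left_mono) auto
    then show ?thesis by simp
  qed
  finally show "\<bar>ip f k\<bar> \<le> (half_sq f + 1) * n + e" by simp
qed

text \<open>With A = \<bar>u\<bar>^2 and B = \<bar>u + h\<bar>^2 - A, the sixth power is (A + B)^3.
  Its linear part in \<open>h\<close> cancels exactly, and each of the three remaining terms carries
  a factor \<bar>h\<bar>^2, because \<bar>B\<bar> is at most a constant times \<bar>h\<bar>.\<close>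

lemma sextic_taylor:
  fixes u h :: complex
  assumes M: "norm u \<le> M" and N: "norm h \<le> N"
  shows "\<bar>norm (u + h) ^ 6 - norm u ^ 6 - 6 * (norm u ^ 4 * Re (u * cnj h))\<bar> \<le>
    (3 * M ^ 4 + 3 * M\<^sup>2 * (2 * M + N)\<^sup>2 + (2 * M + N) ^ 3 * N) * (norm h)\<^sup>2"
proof -
  define A D R B where "A = (norm u)\<^sup>2" and "D = (norm h)\<^sup>2" and "R = Re (u * cnj h)" and "B = 2 * R + D"
  have M0: "M \<ge> 0" "N \<ge> 0" using M N norm_ge_zero order_trans by blast+
  have uh: "(norm (u + h))\<^sup>2 = A + B"
    unfolding norm_sq_add by (simp add: A_def B_def D_def R_def)
  have p6: "norm z ^ 6 = ((norm z)\<^sup>2) ^ 3" for z :: complex by (simp flip: power_mult)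
  have p4: "norm u ^ 4 = A\<^sup>2" by (simp add: A_def flip: power_mult)
  have id: "norm (u + h) ^ 6 - norm u ^ 6 - 6 * (norm u ^ 4 * Re (u * cnj h)) = 3 * A\<^sup>2 * D + 3 * A * B\<^sup>2 + B ^ 3"
    unfolding p6 p4 uh A_def[symmetric] R_def[symmetric]
    by (simp add: B_def power2_eq_square power3_eq_cube algebra_simps)
  have R: "\<bar>R\<bar> \<le> norm u * norm h"
    using abs_Re_le_cmod[of "u * cnj h"] by (simp add: R_def norm_mult)
  have "\<bar>B\<bar> \<le> 2 * (norm u * norm h) + norm h * norm h"
  proof -
    have "norm h * norm h \<ge> 0" by simp
    then show ?thesis using R unfolding B_def D_def power2_eq_square by linarith
  qed
  also have "\<dots> \<le> 2 * (M * norm h) + N * norm h"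
    using M N by (intro add_mono mult_left_mono mult_right_mono) auto
  finally have B: "\<bar>B\<bar> \<le> (2 * M + N) * norm h" by (simp add: algebra_simps)
  have A: "0 \<le> A" "A \<le> M\<^sup>2" using M by (auto simp: A_def intro: power_mono)
  have D: "D \<ge> 0" by (simp add: D_def)
  have "3 * A\<^sup>2 * D \<le> 3 * M ^ 4 * D"
  proof -
    have "A\<^sup>2 \<le> (M\<^sup>2)\<^sup>2" using A by (intro power_mono) auto
    then show ?thesis using D by (intro mult_right_mono) (auto simp flip: power_mult)
  qed
  moreover have B2: "B\<^sup>2 \<le> (2 * M + N)\<^sup>2 * D"
    using power_mono[OF B, of 2] by (simp add: D_def power_mult_distrib)
  then have "3 * A * B\<^sup>2 \<le> 3 * M\<^sup>2 * ((2 * M + N)\<^sup>2 * D)" using A by (intro mult_mono) auto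
  moreover have "\<bar>B ^ 3\<bar> \<le> (2 * M + N) ^ 3 * N * D"
  proof -
    have "\<bar>B ^ 3\<bar> = \<bar>B\<bar> ^ 3" by (rule power_abs)
    also have "\<dots> \<le> ((2 * M + N) * norm h) ^ 3" by (rule power_mono[OF B]) simp
    also have "\<dots> = (2 * M + N) ^ 3 * (norm h * D)"
      by (simp add: D_def power_mult_distrib power3_eq_cube power2_eq_square)
    also have "\<dots> \<le> (2 * M + N) ^ 3 * (N * D)"
      using N M0 D by (intro mult_left_mono mult_right_mono) auto
    finally show ?thesis by (simp only: mult.assoc)
  qed
  moreover have "3 * A\<^sup>2 * D \<ge> 0" "3 * A * B\<^sup>2 \<ge> 0" using A D by auto
  ultimately have "\<bar>3 * A\<^sup>2 * D + 3 * A * B\<^sup>2 + B ^ 3\<bar> \<le>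
      3 * M ^ 4 * D + 3 * M\<^sup>2 * ((2 * M + N)\<^sup>2 * D) + (2 * M + N) ^ 3 * N * D" by linarith
  also have "\<dots> = (3 * M ^ 4 + 3 * M\<^sup>2 * (2 * M + N)\<^sup>2 + (2 * M + N) ^ 3 * N) * D"
    by (simp add: distrib_right mult.assoc)
  finally show ?thesis unfolding id D_def .
qed

text \<open>The gradient term is exactly quadratic, so only the sextic term needs the pointwise
  expansion. The restriction to the unit ball supplies, via \<open>H1_half_bound\<close>, the
  uniform bound 2 on the perturbation.\<close>

lemma half_taylor:
  assumes H: "H1_half f g"
  obtains C where "C \<ge> 0" "\<And>k l. H1_half k l \<Longrightarrow> half_sq k + half_sq l \<le> 1 \<Longrightarrow>
    \<bar>half_energy (\<lambda>x. f x + k x) (\<lambda>x. g x + l x) - half_energy f g - half_diff f g k l\<bar> \<le> C * (half_sq k + half_sq l)"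
proof -
  obtain M where M: "M > 0" "\<And>x. x \<ge> 0 \<Longrightarrow> norm (f x) \<le> M" using H1_half_bounded[OF H] by metis
  define K where "K = 3 * M ^ 4 + 3 * M\<^sup>2 * (2 * M + 2)\<^sup>2 + (2 * M + 2) ^ 3 * 2"
  have K: "K \<ge> 0" unfolding K_def using M by (intro add_nonneg_nonneg mult_nonneg_nonneg) auto
  show ?thesis
  proof (rule that[of "1 / 2 + K / 6"])
    fix k l assume kl: "H1_half k l" and small: "half_sq k + half_sq l \<le> 1"
    have N: "norm (k x) \<le> 2" if "x \<ge> 0" for x
    proof (rule power2_le_imp_le)
      have "(norm (k x))\<^sup>2 \<le> 2 * (half_sq k + half_sq l)"
        using H1_half_bound[OF kl that] by (simp add: half_sq_def)
      then show "(norm (k x))\<^sup>2 \<le> 2\<^sup>2" using small by simp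
    qed simp
    note fk = H1_half_add[OF H kl]
    note I6 = H1_half_power6[OF fk] H1_half_power6[OF H] integrable_ip_six[OF H H1_halfD(1)[OF kl]]
    have "\<bar>half_six (\<lambda>x. f x + k x) - half_six f - 6 * ip_six f k\<bar> =
        \<bar>integral\<^sup>L halfline (\<lambda>x. norm (f x + k x) ^ 6 - norm (f x) ^ 6 - 6 * (norm (f x) ^ 4 * Re (f x * cnj (k x))))\<bar>"
      using I6 by (simp add: half_six_def ip_six_def)
    also have "\<dots> \<le> integral\<^sup>L halfline (\<lambda>x. \<bar>norm (f x + k x) ^ 6 - norm (f x) ^ 6 - 6 * (norm (f x) ^ 4 * Re (f x * cnj (k x)))\<bar>)"
      by (rule integral_abs_bound)
    also have "\<dots> \<le> integral\<^sup>L halfline (\<lambda>x. K * (norm (k x))\<^sup>2)"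
    proof (rule integral_mono)
      show "integrable halfline (\<lambda>x. \<bar>norm (f x + k x) ^ 6 - norm (f x) ^ 6 - 6 * (norm (f x) ^ 4 * Re (f x * cnj (k x)))\<bar>)"
        using I6 by (intro integrable_abs Bochner_Integration.integrable_diff integrable_mult_right) auto
      show "integrable halfline (\<lambda>x. K * (norm (k x))\<^sup>2)"
        using L2_halfD(2)[OF H1_halfD(1)[OF kl]] by auto
      fix x assume "x \<in> space halfline"
      then have "norm (f x) \<le> M" "norm (k x) \<le> 2" using M N by auto
      from sextic_taylor[OF this]
      show "\<bar>norm (f x + k x) ^ 6 - norm (f x) ^ 6 - 6 * (norm (f x) ^ 4 * Re (f x * cnj (k x)))\<bar> \<le> K * (norm (k x))\<^sup>2"
        by (simp only: K_def)
    qed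
    also have "\<dots> = K * half_sq k" by (simp add: half_sq_def)
    finally have 6: "\<bar>half_six (\<lambda>x. f x + k x) - half_six f - 6 * ip_six f k\<bar> \<le> K * half_sq k" .
    have 2: "half_sq (\<lambda>x. g x + l x) = half_sq g + 2 * ip g l + half_sq l"
      by (rule half_sq_add[OF H1_halfD(2)[OF H] H1_halfD(2)[OF kl]])
    have "half_energy (\<lambda>x. f x + k x) (\<lambda>x. g x + l x) - half_energy f g - half_diff f g k l =
        half_sq l / 2 - (half_six (\<lambda>x. f x + k x) - half_six f - 6 * ip_six f k) / 6"
      by (simp add: half_energy_def half_diff_def 2 field_simps)
    also have "\<bar>\<dots>\<bar> \<le> half_sq l / 2 + K * half_sq k / 6"
    proof -
      have *: "\<bar>p / 2 - D / 6\<bar> \<le> p / 2 + q / 6" if "\<bar>D\<bar> \<le> q" "p \<ge> 0" for p q D :: real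
        using that by linarith
      show ?thesis by (rule *[OF 6 half_sq_nonneg])
    qed
    also have "\<dots> \<le> (1 / 2 + K / 6) * (half_sq k + half_sq l)"
    proof -
      have "K * half_sq l \<ge> 0" using K half_sq_nonneg by simp
      then show ?thesis using half_sq_nonneg[of k] by (simp add: field_simps)
    qed
    finally show "\<bar>half_energy (\<lambda>x. f x + k x) (\<lambda>x. g x + l x) - half_energy f g - half_diff f g k l\<bar> \<le> (1 / 2 + K / 6) * (half_sq k + half_sq l)" .
  qed (use K in simp)
qed

lemma rep_half_energy:
  assumes "rep u f1 g1 f2 g2"
  shows "E0 u = half_energy f1 g1 + half_energy f2 g2"
  by (simp add: rep_E0[OF assms] half_energy_def field_simps)

lemma rep_taylor:
  assumes R: "rep u f1 g1 f2 g2"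
  obtains C where "C \<ge> 0" "\<And>h k1 l1 k2 l2. rep h k1 l1 k2 l2 \<Longrightarrow> H1_norm h \<le> 1 \<Longrightarrow>
    \<bar>E0 (\<lambda>x. u x + h x) - E0 u - (half_diff f1 g1 k1 l1 + half_diff f2 g2 k2 l2)\<bar> \<le> C * (H1_norm h)\<^sup>2"
proof -
  have H: "H1_half f1 g1" "H1_half f2 g2" using R by (auto simp: rep_def)
  obtain C1 where C1: "C1 \<ge> 0" "\<And>k l. H1_half k l \<Longrightarrow> half_sq k + half_sq l \<le> 1 \<Longrightarrow>
    \<bar>half_energy (\<lambda>x. f1 x + k x) (\<lambda>x. g1 x + l x) - half_energy f1 g1 - half_diff f1 g1 k l\<bar> \<le> C1 * (half_sq k + half_sq l)"
    by (rule half_taylor[OF H(1)]) blast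
  obtain C2 where C2: "C2 \<ge> 0" "\<And>k l. H1_half k l \<Longrightarrow> half_sq k + half_sq l \<le> 1 \<Longrightarrow>
    \<bar>half_energy (\<lambda>x. f2 x + k x) (\<lambda>x. g2 x + l x) - half_energy f2 g2 - half_diff f2 g2 k l\<bar> \<le> C2 * (half_sq k + half_sq l)"
    by (rule half_taylor[OF H(2)]) blast
  show ?thesis
  proof (rule that[of "C1 + C2"])
    fix h k1 l1 k2 l2 assume S: "rep h k1 l1 k2 l2" and n: "H1_norm h \<le> 1"
    have kl: "H1_half k1 l1" "H1_half k2 l2" using S by (auto simp: rep_def)
    note N = rep_H1_norm[OF S]
    define n1 n2 where "n1 = half_sq k1 + half_sq l1" and "n2 = half_sq k2 + half_sq l2"
    have nn: "n1 \<ge> 0" "n2 \<ge> 0" by (auto simp: n1_def n2_def half_sq_nonneg)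
    have N': "(H1_norm h)\<^sup>2 = n1 + n2" using N(1) by (simp add: n1_def n2_def)
    have "(H1_norm h)\<^sup>2 \<le> 1" using n N(2) by (simp add: power_le_one)
    then have "n1 \<le> 1" "n2 \<le> 1" using N' nn by auto
    then have "\<bar>half_energy (\<lambda>x. f1 x + k1 x) (\<lambda>x. g1 x + l1 x) - half_energy f1 g1 - half_diff f1 g1 k1 l1\<bar> \<le> C1 * n1"
      "\<bar>half_energy (\<lambda>x. f2 x + k2 x) (\<lambda>x. g2 x + l2 x) - half_energy f2 g2 - half_diff f2 g2 k2 l2\<bar> \<le> C2 * n2"
      using C1(2)[OF kl(1)] C2(2)[OF kl(2)] by (auto simp: n1_def n2_def)
    moreover have "C1 * n2 \<ge> 0" "C2 * n1 \<ge> 0" using C1 C2 nn by auto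
    ultimately show "\<bar>E0 (\<lambda>x. u x + h x) - E0 u - (half_diff f1 g1 k1 l1 + half_diff f2 g2 k2 l2)\<bar> \<le> (C1 + C2) * (H1_norm h)\<^sup>2"
      unfolding N' rep_half_energy[OF R] rep_half_energy[OF rep_add[OF R S]] distrib_left distrib_right
      by linarith
  qed (use C1 C2 in simp)
qed

text \<open>The Euler-Lagrange equation tested against all pairs that satisfy the jump condition.
  The multiplier is written as -lam so that the strong form reads u'' = lam u - u^5.\<close>

definition weak_eq ::
    "real \<Rightarrow> real \<Rightarrow> (real \<Rightarrow> complex) \<Rightarrow> (real \<Rightarrow> complex) \<Rightarrow> (real \<Rightarrow> complex) \<Rightarrow> (real \<Rightarrow> complex) \<Rightarrow> bool" where
  "weak_eq \<tau> lam f1 g1 f2 g2 \<longleftrightarrow> (\<forall>k1 l1 k2 l2. H1_half k1 l1 \<longrightarrow> H1_half k2 l2 \<longrightarrow> k2 0 = of_real \<tau> * k1 0 \<longrightarrow>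
     half_diff f1 g1 k1 l1 + half_diff f2 g2 k2 l2 = - lam * (ip f1 k1 + ip f2 k2))"

lemma rep_Re_inner:
  assumes R: "rep u f1 g1 f2 g2" and S: "rep v k1 l1 k2 l2"
  shows "Re (LINT x|lebesgue. u x * cnj (v x)) = ip f1 k1 + ip f2 k2"
proof -
  have i: "integrable halfline (\<lambda>x. f1 x * cnj (k1 x))" "integrable halfline (\<lambda>x. f2 x * cnj (k2 x))"
    using R S by (auto simp: rep_def H1_half_def intro!: L2_half_mult L2_half_cnj)
  show ?thesis
    unfolding rep_inner[OF R S] ip_def
    using integral_bounded_linear[OF bounded_linear_Re i(1)] integral_bounded_linear[OF bounded_linear_Re i(2)]
    by simp
qed

lemma weak_eq_imp_stationary:
  assumes R: "rep u f1 g1 f2 g2" and u: "u \<in> Dmass \<tau> \<mu>" and W: "weak_eq \<tau> lam f1 g1 f2 g2"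
  shows "stationary_state \<tau> \<mu> u"
proof -
  \<comment> \<open>Defined through the integral rather than through representatives, so
    \<open>L\<close> is a function of \<open>\<eta>\<close> alone and vanishes on the orthogonal
    complement of \<open>u\<close> by construction. The weak equation identifies it with
    \<open>half_diff\<close>.\<close>
  define L where "L \<eta> = - lam * Re (LINT x|lebesgue. u x * cnj (\<eta> x))" for \<eta> :: "real \<Rightarrow> complex"
  have Lr: "L \<eta> = - lam * (ip f1 k1 + ip f2 k2)" if "rep \<eta> k1 l1 k2 l2" for \<eta> k1 l1 k2 l2
    using rep_Re_inner[OF R that] by (simp add: L_def)
  have f: "L2_half f1" "L2_half f2" using R by (auto simp: rep_def H1_half_def)
  have "has_differential \<tau> E0 L u"
    unfolding has_differential_def
  proof (intro conjI)
    show "\<forall>v\<in>Dspace \<tau>. \<forall>w\<in>Dspace \<tau>. L (\<lambda>x. v x + w x) = L v + L w"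
    proof (intro ballI)
      fix v w assume "v \<in> Dspace \<tau>" "w \<in> Dspace \<tau>"
      obtain k1 l1 k2 l2 where S: "rep v k1 l1 k2 l2" using Dspace_rep[OF \<open>v \<in> Dspace \<tau>\<close>] by metis
      obtain p1 q1 p2 q2 where T: "rep w p1 q1 p2 q2" using Dspace_rep[OF \<open>w \<in> Dspace \<tau>\<close>] by metis
      have "L2_half k1" "L2_half k2" "L2_half p1" "L2_half p2"
        using S T by (auto simp: rep_def H1_half_def)
      then show "L (\<lambda>x. v x + w x) = L v + L w"
        using f unfolding Lr[OF S] Lr[OF T] Lr[OF rep_add[OF S T]] by (simp add: ip_add algebra_simps)
    qed
    show "\<forall>c::real. \<forall>v\<in>Dspace \<tau>. L (\<lambda>x. c *\<^sub>R v x) = c * L v"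
    proof (intro allI ballI)
      fix c :: real and v assume "v \<in> Dspace \<tau>"
      obtain k1 l1 k2 l2 where S: "rep v k1 l1 k2 l2" using Dspace_rep[OF \<open>v \<in> Dspace \<tau>\<close>] by metis
      show "L (\<lambda>x. c *\<^sub>R v x) = c * L v"
        unfolding Lr[OF S] scaleR_conv_of_real Lr[OF rep_cmult[OF S]] by (simp add: ip_scale algebra_simps)
    qed
    show "\<exists>C. \<forall>v\<in>Dspace \<tau>. \<bar>L v\<bar> \<le> C * H1_norm v"
    proof (intro exI ballI)
      fix v assume "v \<in> Dspace \<tau>"
      obtain k1 l1 k2 l2 where S: "rep v k1 l1 k2 l2" using Dspace_rep[OF \<open>v \<in> Dspace \<tau>\<close>] by metis
      have k: "L2_half k1" "L2_half k2" using S by (auto simp: rep_def H1_half_def)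
      note N = rep_H1_norm[OF S]
      have "half_sq k1 \<le> (H1_norm v)\<^sup>2" "half_sq k2 \<le> (H1_norm v)\<^sup>2"
        unfolding N(1) using half_sq_nonneg[of k1] half_sq_nonneg[of k2] half_sq_nonneg[of l1] half_sq_nonneg[of l2] by auto
      then have "\<bar>ip f1 k1 + ip f2 k2\<bar> \<le> (half_sq f1 + 1 + (half_sq f2 + 1)) * H1_norm v"
        using ip_le[OF f(1) k(1) _ N(2)] ip_le[OF f(2) k(2) _ N(2)] unfolding distrib_right[of _ _ "H1_norm v"] by linarith
      then have "\<bar>lam\<bar> * \<bar>ip f1 k1 + ip f2 k2\<bar> \<le> \<bar>lam\<bar> * ((half_sq f1 + 1 + (half_sq f2 + 1)) * H1_norm v)"
        by (rule mult_left_mono) simp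
      then show "\<bar>L v\<bar> \<le> (\<bar>lam\<bar> * (half_sq f1 + 1 + (half_sq f2 + 1))) * H1_norm v"
        unfolding Lr[OF S] by (simp add: abs_mult mult.assoc)
    qed
    show "\<forall>\<epsilon>>0. \<exists>\<delta>>0. \<forall>h\<in>Dspace \<tau>. H1_norm h < \<delta> \<longrightarrow>
        \<bar>E0 (\<lambda>x. u x + h x) - E0 u - L h\<bar> \<le> \<epsilon> * H1_norm h"
    proof (intro allI impI)
      fix \<epsilon> :: real assume e: "\<epsilon> > 0"
      obtain C where C: "C \<ge> 0" "\<And>h k1 l1 k2 l2. rep h k1 l1 k2 l2 \<Longrightarrow> H1_norm h \<le> 1 \<Longrightarrow>
          \<bar>E0 (\<lambda>x. u x + h x) - E0 u - (half_diff f1 g1 k1 l1 + half_diff f2 g2 k2 l2)\<bar> \<le> C * (H1_norm h)\<^sup>2"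
        by (rule rep_taylor[OF R]) blast
      show "\<exists>\<delta>>0. \<forall>h\<in>Dspace \<tau>. H1_norm h < \<delta> \<longrightarrow> \<bar>E0 (\<lambda>x. u x + h x) - E0 u - L h\<bar> \<le> \<epsilon> * H1_norm h"
      proof (intro exI[of _ "min 1 (\<epsilon> / (C + 1))"] conjI ballI impI)
        show "min 1 (\<epsilon> / (C + 1)) > 0" using e C by simp
        fix h assume h: "h \<in> Dspace \<tau>" and n: "H1_norm h < min 1 (\<epsilon> / (C + 1))"
        obtain k1 l1 k2 l2 where S: "rep h k1 l1 k2 l2" "k2 0 = of_real \<tau> * k1 0" using Dspace_rep[OF h] by metis
        have kl: "H1_half k1 l1" "H1_half k2 l2" using S by (auto simp: rep_def)
        have d: "half_diff f1 g1 k1 l1 + half_diff f2 g2 k2 l2 = L h"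
          unfolding Lr[OF S(1)] using W kl S(2) unfolding weak_eq_def by blast
        have n0: "H1_norm h \<ge> 0" by (rule rep_H1_norm[OF S(1)])
        have "H1_norm h * (C + 1) \<le> \<epsilon>" using n C(1) by (simp add: pos_less_divide_eq less_imp_le)
        then have "C * H1_norm h \<le> \<epsilon>" using n0 by (simp add: algebra_simps)
        then have "C * H1_norm h * H1_norm h \<le> \<epsilon> * H1_norm h" using n0 by (rule mult_right_mono)
        moreover have "\<bar>E0 (\<lambda>x. u x + h x) - E0 u - L h\<bar> \<le> C * (H1_norm h)\<^sup>2"
          using C(2)[OF S(1)] n unfolding d by simp
        ultimately show "\<bar>E0 (\<lambda>x. u x + h x) - E0 u - L h\<bar> \<le> \<epsilon> * H1_norm h"
          by (simp add: power2_eq_square mult.assoc)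
      qed
    qed
  qed
  moreover have "\<forall>\<eta>\<in>Dspace \<tau>. Re (LINT x|lebesgue. u x * cnj (\<eta> x)) = 0 \<longrightarrow> L \<eta> = 0"
    by (simp add: L_def)
  ultimately show ?thesis using u unfolding stationary_state_def by blast
qed

text \<open>Uniqueness of the differential: along t \<eta> both linear functionals approximate the
  same energy increment, so their difference is o(t) and, being linear in t, is 0.\<close>

lemma differential_E0_eq:
  assumes R: "rep u f1 g1 f2 g2" and D: "has_differential \<tau> E0 L u"
    and S: "rep \<eta> k1 l1 k2 l2" and \<eta>: "\<eta> \<in> Dspace \<tau>"
  shows "L \<eta> = half_diff f1 g1 k1 l1 + half_diff f2 g2 k2 l2"
proof -
  define d where "d = half_diff f1 g1 k1 l1 + half_diff f2 g2 k2 l2"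
  define n where "n = H1_norm \<eta>"
  have n0: "n \<ge> 0" unfolding n_def by (rule rep_H1_norm[OF S])
  obtain C where C: "C \<ge> 0" "\<And>h k1 l1 k2 l2. rep h k1 l1 k2 l2 \<Longrightarrow> H1_norm h \<le> 1 \<Longrightarrow>
      \<bar>E0 (\<lambda>x. u x + h x) - E0 u - (half_diff f1 g1 k1 l1 + half_diff f2 g2 k2 l2)\<bar> \<le> C * (H1_norm h)\<^sup>2"
    by (rule rep_taylor[OF R]) blast
  have "\<bar>L \<eta> - d\<bar> \<le> 0"
  proof (rule field_le_epsilon)
    fix e :: real assume e: "e > 0"
    define \<epsilon> where "\<epsilon> = e / 2 / (n + 1)"
    have e': "\<epsilon> > 0" using e n0 by (simp add: \<epsilon>_def)
    obtain \<delta> where \<delta>: "\<delta> > 0" "\<And>h. h \<in> Dspace \<tau> \<Longrightarrow> H1_norm h < \<delta> \<Longrightarrow>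
        \<bar>E0 (\<lambda>x. u x + h x) - E0 u - L h\<bar> \<le> \<epsilon> * H1_norm h"
      using D e' unfolding has_differential_def by metis
    \<comment> \<open>The three bounds place t \<eta> inside the \<open>\<delta>\<close>-ball of the
      differential, inside the unit ball of the expansion, and make the quadratic error at most e/2
      after division by \<open>t\<close>.\<close>
    define t where "t = min (min (\<delta> / 2 / (n + 1)) (1 / (n + 1))) (e / 2 / (C * n\<^sup>2 + 1))"
    have t0: "t > 0" unfolding t_def using \<delta> e n0 C by (auto intro!: divide_pos_pos add_nonneg_pos)
    have "t \<le> \<delta> / 2 / (n + 1)" "t \<le> 1 / (n + 1)" "t \<le> e / 2 / (C * n\<^sup>2 + 1)"
      by (auto simp: t_def)
    moreover have "n + 1 > 0" "C * n\<^sup>2 + 1 > 0" using n0 C by (auto intro: add_nonneg_pos)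
    ultimately have t: "t * (n + 1) \<le> \<delta> / 2" "t * (n + 1) \<le> 1" "t * (C * n\<^sup>2 + 1) \<le> e / 2"
      by (auto simp only: pos_le_divide_eq)
    have t': "t * n < \<delta>" "t * n \<le> 1" "t * (C * n\<^sup>2) \<le> e / 2"
      using t t0 \<delta>(1) unfolding distrib_left by auto
    have S': "rep (\<lambda>x. t *\<^sub>R \<eta> x) (\<lambda>x. of_real t * k1 x) (\<lambda>x. of_real t * l1 x) (\<lambda>x. of_real t * k2 x) (\<lambda>x. of_real t * l2 x)"
      unfolding scaleR_conv_of_real by (rule rep_cmult[OF S])
    have nt: "H1_norm (\<lambda>x. t *\<^sub>R \<eta> x) = t * n"
    proof -
      have "(H1_norm (\<lambda>x. t *\<^sub>R \<eta> x))\<^sup>2 = (t * n)\<^sup>2"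
        using rep_H1_norm(1)[OF S'] rep_H1_norm(1)[OF S] by (simp add: half_sq_cmult n_def power_mult_distrib algebra_simps)
      then show ?thesis using rep_H1_norm(2)[OF S'] t0 n0 by (simp add: power2_eq_iff_nonneg)
    qed
    have tD: "(\<lambda>x. t *\<^sub>R \<eta> x) \<in> Dspace \<tau>"
      using \<eta> unfolding rep_Dspace[OF S'] rep_Dspace[OF S] by simp
    have Lt: "L (\<lambda>x. t *\<^sub>R \<eta> x) = t * L \<eta>" using D \<eta> unfolding has_differential_def by blast
    have scale6: "ip_six f (\<lambda>x. complex_of_real t * k x) = t * ip_six f k" for f k
      unfolding ip_six_def by (subst integral_mult_right_zero[symmetric]) (simp add: algebra_simps)
    have dt: "half_diff f1 g1 (\<lambda>x. of_real t * k1 x) (\<lambda>x. of_real t * l1 x) +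
        half_diff f2 g2 (\<lambda>x. of_real t * k2 x) (\<lambda>x. of_real t * l2 x) = t * d"
      by (simp add: half_diff_def ip_scale scale6 d_def algebra_simps)
    define X where "X = E0 (\<lambda>x. u x + t *\<^sub>R \<eta> x) - E0 u"
    have 1: "\<bar>X - t * d\<bar> \<le> C * (t * n)\<^sup>2"
      using C(2)[OF S'] t'(2) unfolding nt dt X_def by simp
    have 2: "\<bar>X - t * L \<eta>\<bar> \<le> \<epsilon> * (t * n)"
      using \<delta>(2)[OF tD] t'(1) unfolding nt Lt X_def by simp
    have "t * \<bar>L \<eta> - d\<bar> = \<bar>(X - t * d) - (X - t * L \<eta>)\<bar>"
      using t0 by (simp add: abs_mult flip: right_diff_distrib)
    also have "\<dots> \<le> C * (t * n)\<^sup>2 + \<epsilon> * (t * n)" using 1 2 by linarith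
    also have "\<dots> = t * (t * (C * n\<^sup>2) + \<epsilon> * n)" by (simp add: algebra_simps power2_eq_square)
    finally have "\<bar>L \<eta> - d\<bar> \<le> t * (C * n\<^sup>2) + \<epsilon> * n" using t0 by simp
    moreover have "\<epsilon> * n \<le> \<epsilon> * (n + 1)" using e' by simp
    moreover have "\<epsilon> * (n + 1) = e / 2"
    proof -
      have "n + 1 \<noteq> 0" using n0 by simp
      then show ?thesis unfolding \<epsilon>_def by (rule nonzero_eq_divide_eq[THEN iffD1, OF _ refl])
    qed
    ultimately show "\<bar>L \<eta> - d\<bar> \<le> 0 + e" using t'(3) by linarith
  qed
  then show ?thesis by (simp add: d_def)
qed

text \<open>Lagrange multiplier by projection: subtracting from a test function its component along
  \<open>u\<close> makes it orthogonal to \<open>u\<close>, so \<open>L\<close> vanishes there.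
  Positive mass permits the normalization, and lam = -L(u)/\<mu>.\<close>

lemma stationary_imp_weak_eq:
  assumes st: "stationary_state \<tau> \<mu> u" and \<mu>: "\<mu> > 0"
  obtains lam where "\<And>f1 g1 f2 g2. rep u f1 g1 f2 g2 \<Longrightarrow> weak_eq \<tau> lam f1 g1 f2 g2"
proof -
  obtain L where u: "u \<in> Dspace \<tau>" and m: "(Lp_norm 2 UNIV u)\<^sup>2 = \<mu>" and D: "has_differential \<tau> E0 L u"
    and z: "\<And>\<eta>. \<eta> \<in> Dspace \<tau> \<Longrightarrow> Re (LINT x|lebesgue. u x * cnj (\<eta> x)) = 0 \<Longrightarrow> L \<eta> = 0"
    using st unfolding stationary_state_def Dmass_def by blast
  show ?thesis
  proof (rule that[of "- L u / \<mu>"])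
    fix f1 g1 f2 g2 assume R: "rep u f1 g1 f2 g2"
    have f: "L2_half f1" "L2_half f2" using R by (auto simp: rep_def H1_half_def)
    show "weak_eq \<tau> (- L u / \<mu>) f1 g1 f2 g2"
      unfolding weak_eq_def
    proof (intro allI impI)
      fix k1 l1 k2 l2 assume kl: "H1_half k1 l1" "H1_half k2 l2" and j: "k2 0 = of_real \<tau> * k1 0"
      define \<eta> where "\<eta> = glue k1 k2"
      have S: "rep \<eta> k1 l1 k2 l2" unfolding \<eta>_def by (rule rep_glue[OF kl])
      have \<eta>: "\<eta> \<in> Dspace \<tau>" using rep_Dspace[OF S] j by blast
      define s where "s = (ip f1 k1 + ip f2 k2) / \<mu>"
      define w where "w = (\<lambda>x. (- s) *\<^sub>R u x)"
      have Rw: "rep w (\<lambda>x. of_real (- s) * f1 x) (\<lambda>x. of_real (- s) * g1 x) (\<lambda>x. of_real (- s) * f2 x) (\<lambda>x. of_real (- s) * g2 x)"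
        unfolding w_def scaleR_conv_of_real by (rule rep_cmult[OF R])
      have w: "w \<in> Dspace \<tau>"
        using u unfolding rep_Dspace[OF Rw] rep_Dspace[OF R] by simp
      note SW = rep_add[OF S Rw]
      have sum: "(\<lambda>x. \<eta> x + w x) \<in> Dspace \<tau>"
        using w \<eta> unfolding rep_Dspace[OF SW] rep_Dspace[OF Rw] rep_Dspace[OF S] by (auto simp: algebra_simps)
      have k: "L2_half k1" "L2_half k2" using kl by (auto simp: H1_half_def)
      have "Re (LINT x|lebesgue. u x * cnj (\<eta> x + w x)) =
          ip f1 (\<lambda>x. k1 x + of_real (- s) * f1 x) + ip f2 (\<lambda>x. k2 x + of_real (- s) * f2 x)"
        by (rule rep_Re_inner[OF R SW])
      also have "\<dots> = ip f1 k1 + ip f2 k2 - s * (half_sq f1 + half_sq f2)"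
        using f k L2_half_cmult[OF f(1), of "of_real (- s)"] L2_half_cmult[OF f(2), of "of_real (- s)"]
        by (simp only: ip_add ip_scale ip_self) (simp add: algebra_simps)
      also have "half_sq f1 + half_sq f2 = \<mu>" using m rep_mass[OF R] by simp
      finally have "Re (LINT x|lebesgue. u x * cnj (\<eta> x + w x)) = 0" using \<mu> by (simp add: s_def)
      from z[OF sum this] have "L \<eta> + L w = 0" using D \<eta> w unfolding has_differential_def by metis
      moreover have "L w = - s * L u" unfolding w_def using D u unfolding has_differential_def by blast
      ultimately have "L \<eta> = s * L u" by simp
      then show "half_diff f1 g1 k1 l1 + half_diff f2 g2 k2 l2 = - (- L u / \<mu>) * (ip f1 k1 + ip f2 k2)"
        unfolding differential_E0_eq[OF R D S \<eta>, symmetric] by (simp add: s_def)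
    qed
  qed
qed

section \<open>Solitons on the line\<close>

lemma norm_cr_power4: "norm (complex_of_real y) ^ 4 = y ^ 4"
  using power_even_abs[of 4 y] by simp

text \<open>Integration by parts turns the pointwise equation into the weak one on a half-line; the
  boundary term is kept because only the sum over both half-lines cancels.\<close>

lemma half_ode_diff:
  assumes ode: "half_ode lam a b" and kl: "H1_half k l"
  shows "half_diff (cr a) (cr b) k l = - lam * ip (cr a) k - b 0 * Re (k 0)"
proof -
  let ?P = "\<lambda>x. lam * a x - a x ^ 5"
  have ab: "H1_half (cr a) (cr b)" and bP: "H1_half (cr b) (cr ?P)" using ode by (auto simp: half_ode_def)
  note k = H1_halfD[OF kl]
  note N = H1_half_parts[OF bP H1_half_cnj[OF kl]]
  have i: "integrable halfline (\<lambda>x. Re (cr b x * cnj (l x)))" "integrable halfline (\<lambda>x. Re (cr a x * cnj (k x)))"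
    "integrable halfline (\<lambda>x. norm (cr a x) ^ 4 * Re (cr a x * cnj (k x)))"
    by (rule integrable_ip[OF H1_halfD(1)[OF bP] k(2)], rule integrable_ip[OF H1_halfD(1)[OF ab] k(1)],
        rule integrable_ip_six[OF ab k(1)])
  have e: "Re (cr b x * cnj (l x) + cr ?P x * cnj (k x)) =
      Re (cr b x * cnj (l x)) + lam * Re (cr a x * cnj (k x)) - norm (cr a x) ^ 4 * Re (cr a x * cnj (k x))" for x
    unfolding norm_cr_power4 by (simp add: algebra_simps eval_nat_numeral)
  have "Re (integral\<^sup>L halfline (\<lambda>x. cr b x * cnj (l x) + cr ?P x * cnj (k x))) =
      integral\<^sup>L halfline (\<lambda>x. Re (cr b x * cnj (l x)) + lam * Re (cr a x * cnj (k x)) - norm (cr a x) ^ 4 * Re (cr a x * cnj (k x)))"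
    unfolding integral_bounded_linear[OF bounded_linear_Re N(3), symmetric] e ..
  also have "\<dots> = ip (cr b) l + lam * ip (cr a) k - ip_six (cr a) k"
    unfolding ip_def ip_six_def using i
    by (simp only: Bochner_Integration.integral_add Bochner_Integration.integral_diff
        Bochner_Integration.integrable_add integrable_mult_right integral_mult_right_zero)
  finally have "ip (cr b) l + lam * ip (cr a) k - ip_six (cr a) k = - (b 0 * Re (k 0))"
    unfolding N(1) by simp
  then show ?thesis by (simp add: half_diff_def)
qed

lemma half_diff_self: "half_diff f g f g = half_sq g - half_six f"
proof -
  have "norm z ^ 4 * Re (z * cnj z) = norm z ^ 6" for z :: complex
  proof -
    have "Re (z * cnj z) = (norm z)\<^sup>2" by (simp add: complex_norm_square[symmetric] del: of_real_power)
    then show ?thesis by (simp flip: power_add)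
  qed
  then show ?thesis by (simp add: half_diff_def ip_self ip_six_def half_six_def)
qed

text \<open>The equation tested with its own solution, a Nehari identity with a boundary
  term.\<close>

lemma half_ode_energy':
  assumes "half_ode lam a b"
  shows "half_sq (cr b) - half_six (cr a) = - lam * half_sq (cr a) - b 0 * a 0"
  using half_ode_diff[OF assms, of "cr a" "cr b"] assms
  by (simp add: half_diff_self ip_self half_ode_def)

text \<open>The left half is reflected, so \<open>b1 0\<close> is -u'(0-). The derivative condition
  is the natural one dual to the jump: for test pairs with k2(0) = \<tau> k1(0) it cancels the two
  boundary terms.\<close>

definition soliton :: "real \<Rightarrow> real \<Rightarrow> (real \<Rightarrow> real) \<Rightarrow> (real \<Rightarrow> real) \<Rightarrow> (real \<Rightarrow> real) \<Rightarrow> (real \<Rightarrow> real) \<Rightarrow> bool" where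
  "soliton \<tau> lam a1 b1 a2 b2 \<longleftrightarrow> half_ode lam a1 b1 \<and> half_ode lam a2 b2 \<and>
     a2 0 = \<tau> * a1 0 \<and> b1 0 = - \<tau> * b2 0"

lemma soliton_weak_eq:
  assumes "soliton \<tau> lam a1 b1 a2 b2"
  shows "weak_eq \<tau> lam (cr a1) (cr b1) (cr a2) (cr b2)"
  unfolding weak_eq_def
proof (intro allI impI)
  fix k1 l1 k2 l2 assume kl: "H1_half k1 l1" "H1_half k2 l2" and j: "k2 0 = of_real \<tau> * k1 0"
  have o: "half_ode lam a1 b1" "half_ode lam a2 b2" "b1 0 = - \<tau> * b2 0"
    using assms by (auto simp: soliton_def)
  show "half_diff (cr a1) (cr b1) k1 l1 + half_diff (cr a2) (cr b2) k2 l2 =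
      - lam * (ip (cr a1) k1 + ip (cr a2) k2)"
    unfolding half_ode_diff[OF o(1) kl(1)] half_ode_diff[OF o(2) kl(2)] o(3) j by (simp add: algebra_simps)
qed

text \<open>The boundary products a1 b1 and a2 b2 at 0 cancel. Summing the integrated first integral
  and the Nehari identity over both sides gives two linear relations between mass, gradient and
  sextic term, which determine the last two from the first.\<close>

lemma soliton_energy:
  assumes "soliton \<tau> lam a1 b1 a2 b2"
  shows "half_six (cr a1) + half_six (cr a2) = 3 * (half_sq (cr b1) + half_sq (cr b2))"
    "half_sq (cr b1) + half_sq (cr b2) = lam * (half_sq (cr a1) + half_sq (cr a2)) / 2"
proof -
  have o: "half_ode lam a1 b1" "half_ode lam a2 b2" and j: "b1 0 = - \<tau> * b2 0" "a2 0 = \<tau> * a1 0"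
    using assms by (auto simp: soliton_def)
  have "b1 0 * a1 0 + b2 0 * a2 0 = 0" by (simp add: j)
  then show "half_six (cr a1) + half_six (cr a2) = 3 * (half_sq (cr b1) + half_sq (cr b2))"
    "half_sq (cr b1) + half_sq (cr b2) = lam * (half_sq (cr a1) + half_sq (cr a2)) / 2"
    using half_ode_energy[OF o(1)] half_ode_energy[OF o(2)] half_ode_energy'[OF o(1)] half_ode_energy'[OF o(2)]
    by (simp_all add: algebra_simps)
qed

definition excited_mass :: "real \<Rightarrow> real" where
  "excited_mass \<tau> = sqrt 3 / 2 * (3 * pi / 2 - 2 * angle \<tau>)"

text \<open>The conditions at 0 give p1 = -\<tau>^2 p2, and the first integral gives p1^2 = 1 - s
  and p2^2 = 1 - \<tau>^4 s; together they fix the slopes up to one common sign. A positive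
  \<open>b2 0\<close> puts the peak on the right half-line, a negative one on the left.\<close>

lemma soliton_mass:
  assumes t: "\<tau> > 1" and S: "soliton \<tau> lam a1 b1 a2 b2"
  shows "b2 0 \<noteq> 0"
    "half_sq (cr a1) + half_sq (cr a2) = (if b2 0 > 0 then crit_mass \<tau> else excited_mass \<tau>)"
proof -
  have o: "half_ode lam a1 b1" "half_ode lam a2 b2" and j: "b1 0 = - \<tau> * b2 0" "a2 0 = \<tau> * a1 0"
    using S by (auto simp: soliton_def)
  define p1 p2 s where "p1 = b1 0 / (sqrt lam * a1 0)" and "p2 = b2 0 / (sqrt lam * a2 0)"
    and "s = a1 0 ^ 4 / (3 * lam)"
  have a: "a1 0 > 0" "a2 0 > 0" using half_ode_pos[OF o(1)] half_ode_pos[OF o(2)] by auto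
  have l: "lam > 0" by (rule half_ode_lam_pos[OF o(1)])
  have t4: "\<tau> ^ 4 > 1" using t by (simp add: one_less_power)
  have p12: "p1 = - (\<tau>\<^sup>2 * p2)"
    using a l t by (simp add: p1_def p2_def j power2_eq_square)
  have q: "p1\<^sup>2 = 1 - s" "p2\<^sup>2 = 1 - \<tau> ^ 4 * s"
    using half_ode_mass(2)[OF o(1)] half_ode_mass(2)[OF o(2)]
    by (simp_all add: p1_def p2_def s_def j(2) power_mult_distrib)
  have "p1\<^sup>2 = \<tau> ^ 4 * p2\<^sup>2" unfolding p12 by (simp add: power_mult_distrib flip: power_mult)
  then have "1 - s = \<tau> ^ 4 - \<tau> ^ 4 * \<tau> ^ 4 * s" using q by (simp add: right_diff_distrib)
  \<comment> \<open>The relation between the slopes factors, and \<tau> > 1 rules out the first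
    factor, leaving a single value of \<open>s\<close>.\<close>
  then have "(\<tau> ^ 4 - 1) * ((1 + \<tau> ^ 4) * s - 1) = 0" by (simp add: algebra_simps)
  then have "(1 + \<tau> ^ 4) * s = 1" using t4 by simp
  then have s: "s = 1 / (1 + \<tau> ^ 4)" using t4 by (simp add: field_simps)
  have "p2\<^sup>2 = (sin (angle \<tau>))\<^sup>2"
    unfolding q s angle(1)[OF t] power_divide using t4 by (simp add: field_simps)
  then have pm: "p2 = sin (angle \<tau>) \<or> p2 = - sin (angle \<tau>)" by (simp add: power2_eq_iff)
  have sp: "sin (angle \<tau>) > 0" using angle(4,5)[OF t] by (intro sin_gt_zero) auto
  have sc: "\<tau>\<^sup>2 * sin (angle \<tau>) = cos (angle \<tau>)" unfolding angle(1)[OF t] angle(2)[OF t] by simp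
  have sgn: "b2 0 = p2 * (sqrt lam * a2 0)" using a l by (simp add: p2_def)
  have sq: "sqrt lam * a2 0 > 0" using a l by simp
  show "b2 0 \<noteq> 0" using pm sp sq unfolding sgn by auto
  have m: "half_sq (cr a1) + half_sq (cr a2) = sqrt 3 / 2 * (2 * pi - arccos p1 - arccos p2)"
    using half_ode_mass(1)[OF o(1)] half_ode_mass(1)[OF o(2)]
    by (simp add: p1_def p2_def field_simps)
  from pm show "half_sq (cr a1) + half_sq (cr a2) = (if b2 0 > 0 then crit_mass \<tau> else excited_mass \<tau>)"
  proof
    assume p: "p2 = sin (angle \<tau>)"
    have "arccos p2 = pi / 2 - angle \<tau>"
      unfolding p using angle(4,5)[OF t] by (intro arccos_unique) (auto simp: cos_diff)
    moreover have "arccos p1 = pi - angle \<tau>"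
      unfolding p12 p sc using angle(4,5)[OF t] by (intro arccos_unique) (auto simp: cos_diff)
    moreover have "b2 0 > 0" unfolding sgn p using sp sq by simp
    ultimately show ?thesis by (simp add: m crit_mass_def)
  next
    assume p: "p2 = - sin (angle \<tau>)"
    have "arccos p2 = pi / 2 + angle \<tau>"
      unfolding p using angle(4,5)[OF t] by (intro arccos_unique) (auto simp: cos_add)
    moreover have "arccos p1 = angle \<tau>"
      unfolding p12 p using sc angle(4,5)[OF t] by (intro arccos_unique) auto
    moreover have "b2 0 < 0" unfolding sgn p using sp sq by (simp add: mult_neg_pos)
    ultimately show ?thesis by (simp add: m excited_mass_def)
  qed
qed

text \<open>Only the two slopes at 0 are prescribed. The jump condition then comes for free: the
  first integral gives each a(0)^4 as 3 lam (1 - slope^2), and the slopes satisfy 1 - q^2 = \<tau>^4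
  (1 - p^2).\<close>

lemma soliton_exists:
  assumes t: "\<tau> > 1" and l: "lam > 0" and q: "\<bar>q\<bar> = sin (angle \<tau>)"
  obtains a1 b1 a2 b2 where "soliton \<tau> lam a1 b1 a2 b2" "sgn (b2 0) = sgn q"
proof -
  have t4: "\<tau> ^ 4 > 1" using t by (simp add: one_less_power)
  have "q\<^sup>2 = (sin (angle \<tau>))\<^sup>2" using q by (metis power2_abs)
  also have "\<dots> = 1 / (1 + \<tau> ^ 4)" unfolding angle(1)[OF t] power_divide using t4 by simp
  finally have q2: "q\<^sup>2 = 1 / (1 + \<tau> ^ 4)" .
  have lt1: "y / (1 + y) < 1" "1 / (1 + y) < 1" if "y > 1" for y :: real using that by auto
  have "q\<^sup>2 < 1" unfolding q2 by (rule lt1(2)[OF t4])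
  then have qb: "-1 < q" "q < 1" by (auto simp: abs_square_less_1)
  define p where "p = - (\<tau>\<^sup>2 * q)"
  have p2: "p\<^sup>2 = \<tau> ^ 4 / (1 + \<tau> ^ 4)" by (simp add: p_def power_mult_distrib q2 flip: power_mult)
  have "p\<^sup>2 < 1" unfolding p2 by (rule lt1(1)[OF t4])
  then have pb: "-1 < p" "p < 1" by (auto simp: abs_square_less_1)
  obtain a1 b1 where 1: "half_ode lam a1 b1" "b1 0 = p * (sqrt lam * a1 0)" by (rule half_ode_profile[OF l pb])
  obtain a2 b2 where 2: "half_ode lam a2 b2" "b2 0 = q * (sqrt lam * a2 0)" by (rule half_ode_profile[OF l qb])
  have a: "a1 0 > 0" "a2 0 > 0" using half_ode_pos[OF 1(1)] half_ode_pos[OF 2(1)] by auto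
  have e1: "p\<^sup>2 = 1 - a1 0 ^ 4 / (3 * lam)" and e2: "q\<^sup>2 = 1 - a2 0 ^ 4 / (3 * lam)"
    using half_ode_mass(2)[OF 1(1)] half_ode_mass(2)[OF 2(1)] a l 1(2) 2(2) by auto
  have "a1 0 ^ 4 = 3 * lam * (1 - p\<^sup>2)" "a2 0 ^ 4 = 3 * lam * (1 - q\<^sup>2)" using e1 e2 l by auto
  moreover have "1 - q\<^sup>2 = \<tau> ^ 4 * (1 - p\<^sup>2)" unfolding p2 q2 using t4 by (simp add: field_simps)
  ultimately have "a2 0 ^ 4 = (\<tau> * a1 0) ^ 4" by (simp add: power_mult_distrib)
  then have j: "a2 0 = \<tau> * a1 0" by (rule power_eq_imp_eq_base) (use a t in \<open>auto simp: less_imp_le\<close>)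
  have "b1 0 = - \<tau> * b2 0" unfolding 1(2) 2(2) j by (simp add: p_def power2_eq_square)
  then have "soliton \<tau> lam a1 b1 a2 b2" using 1 2 j by (simp add: soliton_def)
  moreover have "sgn (b2 0) = sgn q" unfolding 2(2) using a l by (simp add: sgn_mult)
  ultimately show ?thesis by (rule that)
qed

lemma soliton_glue:
  assumes S: "soliton \<tau> lam a1 b1 a2 b2"
  defines "u \<equiv> glue (cr a1) (cr a2)"
  shows "rep u (cr a1) (cr b1) (cr a2) (cr b2)" "u \<in> Dspace \<tau>" "positive_fun u"
proof -
  have o: "half_ode lam a1 b1" "half_ode lam a2 b2" and j: "a2 0 = \<tau> * a1 0"
    using S by (auto simp: soliton_def)
  show R: "rep u (cr a1) (cr b1) (cr a2) (cr b2)"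
    unfolding u_def using o by (intro rep_glue) (auto simp: half_ode_def)
  show "u \<in> Dspace \<tau>" unfolding rep_Dspace[OF R] by (simp add: j)
  have p: "x > 0 \<Longrightarrow> a1 x > 0" "x > 0 \<Longrightarrow> a2 x > 0" for x using o by (auto simp: half_ode_def)
  show "positive_fun u"
    unfolding positive_fun_def
  proof (intro allI impI)
    fix x :: real assume "x \<noteq> 0"
    then consider "x > 0" | "- x > 0" by linarith
    then show "Im (cont_rep u x) = 0 \<and> Re (cont_rep u x) > 0"
    proof cases
      case 1
      then show ?thesis using rep_cont_rep(1)[OF R 1] p by simp
    next
      case 2
      then show ?thesis using rep_cont_rep(2)[OF R 2] p(1)[OF 2] by simp
    qed
  qed
qed

lemma soliton_E0:
  assumes "soliton \<tau> lam a1 b1 a2 b2" "rep u (cr a1) (cr b1) (cr a2) (cr b2)"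
  shows "E0 u = 0"
  using soliton_energy(1)[OF assms(1)] by (simp add: rep_E0[OF assms(2)])

section \<open>Positive stationary states are solitons\<close>

lemma H1_half_test_function:
  assumes "\<phi> \<in> test_functions {0<..}"
  shows "H1_half (cr \<phi>) (cr (deriv \<phi>))" "\<phi> 0 = 0"
proof -
  obtain a b where ab: "0 < a" "a < b" and z: "\<forall>x. x \<notin> {a..b} \<longrightarrow> \<phi> x = 0"
    and c: "\<phi> C1_differentiable_on UNIV"
    using assms unfolding test_functions_halfline_iff by blast
  show "\<phi> 0 = 0" using z ab by auto
  have L: "L2_half (cr \<psi>)" if "continuous_on UNIV \<psi>" "\<And>x. x \<notin> {a..b} \<Longrightarrow> \<psi> x = 0" for \<psi>
    unfolding L2_half_def
  proof
    have c: "continuous_on S \<psi>" for S by (rule continuous_on_subset[OF that(1)]) auto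
    show "cr \<psi> \<in> borel_measurable halfline" by (intro continuous_measurable_halfline continuous_intros c)
    have "integrable halfline (\<lambda>x. (\<psi> x)\<^sup>2 *\<^sub>R (1::real))"
    proof (rule integrable_continuous_support_mult(2))
      show "(\<lambda>x. 1::real) absolutely_integrable_on {a..b}" by (auto simp: absolutely_integrable_on_const)
      show "continuous_on {a..b} (\<lambda>x. (\<psi> x)\<^sup>2)" by (intro continuous_intros c)
      show "(\<psi> x)\<^sup>2 = 0" if "x \<notin> {a..b}" for x using \<open>\<And>x. x \<notin> {a..b} \<Longrightarrow> \<psi> x = 0\<close>[OF that] by simp
    qed
    then show "integrable halfline (\<lambda>x. (norm (cr \<psi> x))\<^sup>2)" by simp
  qed
  have "indef_int \<phi> (deriv \<phi>)"
  proof (rule indef_int_C1)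
    show "(\<phi> has_vector_derivative deriv \<phi> x) (at x within {0..})" for x
      using C1_deriv(1)[OF c, of x]
      by (simp add: has_real_derivative_iff_has_vector_derivative has_vector_derivative_at_within)
    show "continuous_on {0..} (deriv \<phi>)" by (rule C1_deriv(2)[OF c])
  qed
  moreover have "L2_half (cr \<phi>)" by (rule L[OF C1_deriv(3)[OF c]]) (use z in blast)
  moreover have "L2_half (cr (deriv \<phi>))" by (rule L[OF C1_deriv(2)[OF c]]) (rule deriv_outside_support[OF c z])
  ultimately show "H1_half (cr \<phi>) (cr (deriv \<phi>))" by (simp add: H1_half_def indef_int_of_real_iff)
qed

lemma H1_half_cong_deriv:
  assumes H: "H1_half f g" and ae: "AE x in halfline. g x = g' x" and g': "L2_half g'"
  shows "H1_half f g'"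
proof -
  obtain N where N: "negligible N" "{x. \<not> (x > 0 \<longrightarrow> g x = g' x)} \<subseteq> N"
    using ae unfolding AE_halfline_iff eventually_ae_filter_negligible by auto
  have "integral {0..b} g = integral {0..b} g'" for b
  proof (rule integral_spike)
    show "negligible (N \<union> {0})" using N(1) by simp
    show "g' x = g x" if "x \<in> {0..b} - (N \<union> {0})" for x
    proof -
      have "x > 0" "x \<notin> N" using that by auto
      then show ?thesis using N(2) by auto
    qed
  qed
  then have "indef_int f g'"
    using indef_intD(2)[OF H1_halfD(3)[OF H]] L2_half_abs_integrable[OF g'] unfolding indef_int_def by metis
  then show ?thesis using H g' by (simp add: H1_half_def)
qed

text \<open>The weak equation says that lam a - a^5 is a weak derivative of \<open>c\<close>. Since
  \<open>a\<close> is bounded, it is square integrable, so \<open>c\<close> has an H1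
  representative, which then replaces \<open>c\<close> as the derivative of
  \<open>a\<close>.\<close>

lemma half_ode_if_weak:
  assumes H: "H1_half (cr a) (cr c)" and pos: "\<And>x. x > 0 \<Longrightarrow> a x > 0"
    and W: "\<And>\<phi>. \<phi> \<in> test_functions {0<..} \<Longrightarrow>
      half_diff (cr a) (cr c) (cr \<phi>) (cr (deriv \<phi>)) = - lam * ip (cr a) (cr \<phi>)"
  obtains b where "half_ode lam a b"
proof -
  let ?P = "\<lambda>x. lam * a x - a x ^ 5"
  note h = H1_halfD[OF H]
  obtain B where B: "B > 0" "\<And>x. x \<ge> 0 \<Longrightarrow> norm (cr a x) \<le> B" using H1_half_bounded[OF H] by metis
  have LP: "L2_half (cr ?P)"
  proof (rule L2_half_bound[OF h(1)])
    have "continuous_on {0..} a"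
      using h(3) unfolding indef_int_of_real_iff by (rule indef_int_continuous_on)
    then show "cr ?P \<in> borel_measurable halfline"
      by (intro continuous_measurable_halfline continuous_intros)
    show "AE x in halfline. norm (cr ?P x) \<le> (\<bar>lam\<bar> + B ^ 4) * norm (cr a x)"
    proof (rule AE_I2)
      fix x assume "x \<in> space halfline"
      then have "\<bar>a x\<bar> ^ 4 \<le> B ^ 4" using B(2)[of x] by (intro power_mono) auto
      then have "\<bar>lam - a x ^ 4\<bar> \<le> \<bar>lam\<bar> + B ^ 4"
      proof -
        have "a x ^ 4 \<ge> 0" "a x ^ 4 = \<bar>a x\<bar> ^ 4" using power_even_abs[of 4 "a x"] by simp_all
        with \<open>\<bar>a x\<bar> ^ 4 \<le> B ^ 4\<close> show ?thesis by linarith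
      qed
      then have "\<bar>lam - a x ^ 4\<bar> * \<bar>a x\<bar> \<le> (\<bar>lam\<bar> + B ^ 4) * \<bar>a x\<bar>" by (rule mult_right_mono) simp
      moreover have "lam * a x - a x ^ 5 = (lam - a x ^ 4) * a x" by (simp add: algebra_simps eval_nat_numeral)
      ultimately show "norm (cr ?P x) \<le> (\<bar>lam\<bar> + B ^ 4) * norm (cr a x)"
        by (simp only: norm_of_real abs_mult)
    qed
  qed
  have "is_weak_deriv {0<..} (cr c) (cr ?P)"
    unfolding is_weak_deriv_halfline_iff
  proof (intro conjI ballI L2_half_locally_integrable h LP)
    fix \<phi> assume p: "\<phi> \<in> test_functions {0<..}"
    note \<phi> = H1_halfD[OF H1_half_test_function(1)[OF p]]
    have i: "integrable halfline (\<lambda>x. a x * \<phi> x)" "integrable halfline (\<lambda>x. a x ^ 4 * (a x * \<phi> x))"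
      using integrable_ip[OF h(1) \<phi>(1)] integrable_ip_six[OF H \<phi>(1)] unfolding norm_cr_power4 by simp_all
    have "integral\<^sup>L halfline (\<lambda>x. c x * deriv \<phi> x) - integral\<^sup>L halfline (\<lambda>x. a x ^ 4 * (a x * \<phi> x)) =
        - lam * integral\<^sup>L halfline (\<lambda>x. a x * \<phi> x)"
      using W[OF p] unfolding half_diff_def ip_def ip_six_def norm_cr_power4 by simp
    then have "integral\<^sup>L halfline (\<lambda>x. c x * deriv \<phi> x) =
        - (lam * integral\<^sup>L halfline (\<lambda>x. a x * \<phi> x) - integral\<^sup>L halfline (\<lambda>x. a x ^ 4 * (a x * \<phi> x)))" by simp
    also have "\<dots> = - integral\<^sup>L halfline (\<lambda>x. lam * (a x * \<phi> x) - a x ^ 4 * (a x * \<phi> x))"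
      using i by simp
    also have "(\<lambda>x. lam * (a x * \<phi> x) - a x ^ 4 * (a x * \<phi> x)) = (\<lambda>x. ?P x * \<phi> x)"
      by (simp add: fun_eq_iff algebra_simps eval_nat_numeral)
    finally have e: "integral\<^sup>L halfline (\<lambda>x. c x * deriv \<phi> x) = - integral\<^sup>L halfline (\<lambda>x. ?P x * \<phi> x)" .
    have "integral\<^sup>L halfline (\<lambda>x. deriv \<phi> x *\<^sub>R cr c x) = complex_of_real (integral\<^sup>L halfline (\<lambda>x. c x * deriv \<phi> x))"
      unfolding integral_complex_of_real[symmetric] by (simp add: scaleR_conv_of_real mult.commute)
    also have "\<dots> = - complex_of_real (integral\<^sup>L halfline (\<lambda>x. ?P x * \<phi> x))" unfolding e by simp
    also have "complex_of_real (integral\<^sup>L halfline (\<lambda>x. ?P x * \<phi> x)) = integral\<^sup>L halfline (\<lambda>x. \<phi> x *\<^sub>R cr ?P x)"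
      unfolding integral_complex_of_real[symmetric] by (simp add: scaleR_conv_of_real mult.commute)
    finally show "integral\<^sup>L halfline (\<lambda>x. deriv \<phi> x *\<^sub>R cr c x) = - integral\<^sup>L halfline (\<lambda>x. \<phi> x *\<^sub>R cr ?P x)" .
  qed
  then obtain f where f: "H1_half f (cr ?P)" and cf: "AE x in halfline. cr c x = f x"
    using is_weak_deriv_imp_H1_half[OF _ h(2) LP] by metis
  \<comment> \<open>The representative is known to be real only almost everywhere; its real part is
    real everywhere and still agrees with \<open>c\<close> almost everywhere.\<close>
  define b where "b x = Re (f x)" for x
  have b: "H1_half (cr b) (cr ?P)" using H1_half_Re[OF f] by (simp add: b_def)
  have "AE x in halfline. cr c x = cr b x"
    using cf by eventually_elim (metis Re_complex_of_real b_def)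
  then have "H1_half (cr a) (cr b)" by (rule H1_half_cong_deriv[OF H _ H1_halfD(1)[OF b]])
  then have "half_ode lam a b" using b pos by (simp add: half_ode_def)
  then show ?thesis by (rule that)
qed

lemma H1_half_0: "H1_half (\<lambda>x. 0) (\<lambda>x. 0)"
  by (simp add: H1_half_def L2_half_def indef_int_def)

lemma half_diff_0: "half_diff f g (\<lambda>x. 0) (\<lambda>x. 0) = 0" "ip f (\<lambda>x. 0) = 0"
  by (simp_all add: half_diff_def ip_def ip_six_def)

text \<open>Test functions supported on one side give the equation there, and membership in
  \<open>Dspace\<close> gives the jump. Testing with \<open>u\<close> itself is enough for the
  derivative condition, because the boundary term is a1(0) (b1(0) + \<tau> b2(0)) and a1(0) >
  0.\<close>

lemma positive_stationary_soliton:
  assumes st: "stationary_state \<tau> \<mu> u" and \<mu>: "\<mu> > 0" and pos: "positive_fun u"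
  obtains lam a1 b1 a2 b2 where "soliton \<tau> lam a1 b1 a2 b2" "rep u (cr a1) (cr b1) (cr a2) (cr b2)"
proof -
  have u: "u \<in> Dspace \<tau>" using st unfolding stationary_state_def Dmass_def by blast
  obtain lam where W: "\<And>f1 g1 f2 g2. rep u f1 g1 f2 g2 \<Longrightarrow> weak_eq \<tau> lam f1 g1 f2 g2"
    by (rule stationary_imp_weak_eq[OF st \<mu>]) blast
  obtain f1 g1 f2 g2 where R: "rep u f1 g1 f2 g2" using Dspace_rep[OF u] by metis
  define a1 a2 c1 c2 where "a1 x = Re (f1 x)" and "a2 x = Re (f2 x)"
    and "c1 x = Re (g1 x)" and "c2 x = Re (g2 x)" for x
  have f: "f1 x = cr a1 x" "a1 x > 0" "f2 x = cr a2 x" "a2 x > 0" if x: "x > 0" for x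
  proof -
    have "- x \<noteq> 0" "x \<noteq> 0" using x by auto
    then have "Im (cont_rep u (- x)) = 0 \<and> Re (cont_rep u (- x)) > 0" "Im (cont_rep u x) = 0 \<and> Re (cont_rep u x) > 0"
      using pos unfolding positive_fun_def by blast+
    then show "f1 x = cr a1 x" "a1 x > 0" "f2 x = cr a2 x" "a2 x > 0"
      unfolding rep_cont_rep(1)[OF R x] rep_cont_rep(2)[OF R x] by (auto simp: a1_def a2_def complex_eq_iff)
  qed
  have H: "H1_half (cr a1) (cr c1)" "H1_half (cr a2) (cr c2)"
    using R unfolding rep_def a1_def a2_def c1_def c2_def by (auto intro: H1_half_Re)
  have ae: "AE x in halfline. u (- x) = cr a1 x" "AE x in halfline. u x = cr a2 x"
    using R f unfolding rep_def AE_halfline_iff by (auto elim!: eventually_mono)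
  have R1: "rep u (cr a1) (cr c1) (cr a2) (cr c2)" using H ae by (simp add: rep_def)
  note W1 = W[OF R1, unfolded weak_eq_def, rule_format]
  obtain b1 where b1: "half_ode lam a1 b1"
  proof (rule half_ode_if_weak[OF H(1)])
    show "a1 x > 0" if "x > 0" for x using f that by blast
    fix \<phi> assume p: "\<phi> \<in> test_functions {0<..}"
    show "half_diff (cr a1) (cr c1) (cr \<phi>) (cr (deriv \<phi>)) = - lam * ip (cr a1) (cr \<phi>)"
      using W1[OF H1_half_test_function(1)[OF p] H1_half_0] H1_half_test_function(2)[OF p]
      by (simp add: half_diff_0)
  qed
  obtain b2 where b2: "half_ode lam a2 b2"
  proof (rule half_ode_if_weak[OF H(2)])
    show "a2 x > 0" if "x > 0" for x using f that by blast
    fix \<phi> assume p: "\<phi> \<in> test_functions {0<..}"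
    show "half_diff (cr a2) (cr c2) (cr \<phi>) (cr (deriv \<phi>)) = - lam * ip (cr a2) (cr \<phi>)"
      using W1[OF H1_half_0 H1_half_test_function(1)[OF p]] H1_half_test_function(2)[OF p]
      by (simp add: half_diff_0)
  qed
  have H2: "H1_half (cr a1) (cr b1)" "H1_half (cr a2) (cr b2)" using b1 b2 by (auto simp: half_ode_def)
  have R2: "rep u (cr a1) (cr b1) (cr a2) (cr b2)" using H2 ae by (simp add: rep_def)
  have j: "cr a2 0 = of_real \<tau> * cr a1 0" using u rep_Dspace[OF R2] by blast
  then have j': "a2 0 = \<tau> * a1 0" by (metis Re_complex_of_real of_real_mult)
  have "half_diff (cr a1) (cr b1) (cr a1) (cr b1) + half_diff (cr a2) (cr b2) (cr a2) (cr b2) =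
      - lam * (ip (cr a1) (cr a1) + ip (cr a2) (cr a2))"
    using W[OF R2] H2 j unfolding weak_eq_def by blast
  then have "a1 0 * (b1 0 + \<tau> * b2 0) = 0"
    unfolding half_ode_diff[OF b1 H2(1)] half_ode_diff[OF b2 H2(2)] by (simp add: j' algebra_simps)
  moreover have "a1 0 > 0" by (rule half_ode_pos[OF b1]) simp
  ultimately have "b1 0 = - \<tau> * b2 0" by simp
  then have "soliton \<tau> lam a1 b1 a2 b2" using b1 b2 j' by (simp add: soliton_def)
  then show ?thesis using R2 by (rule that)
qed

section \<open>The variational problem\<close>

lemma Dspace_sharp_inequality:
  assumes t: "\<tau> > 1" and u: "u \<in> Dspace \<tau>"
  shows "(Lp_norm 6 UNIV u) ^ 6 \<le> 3 / (crit_mass \<tau>)\<^sup>2 * grad_sq u * (Lp_norm 2 UNIV u) ^ 4"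
proof -
  obtain f1 g1 f2 g2 where R: "rep u f1 g1 f2 g2" "f2 0 = of_real \<tau> * f1 0" using Dspace_rep[OF u] by metis
  have 4: "(Lp_norm 2 UNIV u) ^ 4 = ((Lp_norm 2 UNIV u)\<^sup>2)\<^sup>2" by (simp flip: power_mult)
  show ?thesis
    unfolding 4 rep_six[OF R(1)] rep_grad[OF R(1)] rep_mass[OF R(1)] by (rule sharp_inequality[OF t R])
qed

lemma grad_sq_nonneg: "grad_sq u \<ge> 0"
  by (simp add: grad_sq_def)

lemma ground_soliton:
  assumes t: "\<tau> > 1" and l: "lam > 0"
  obtains a1 b1 a2 b2 where "soliton \<tau> lam a1 b1 a2 b2"
    "half_sq (cr a1) + half_sq (cr a2) = crit_mass \<tau>"
proof -
  have s: "sin (angle \<tau>) > 0" using angle(4,5)[OF t] by (intro sin_gt_zero) auto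
  obtain a1 b1 a2 b2 where S: "soliton \<tau> lam a1 b1 a2 b2" "sgn (b2 0) = sgn (sin (angle \<tau>))"
    by (rule soliton_exists[OF t l, of "sin (angle \<tau>)"]) (use s in auto)
  then have "b2 0 > 0" using s by (metis sgn_1_pos sgn_pos)
  then show ?thesis using soliton_mass(2)[OF t S(1)] that[OF S(1)] by simp
qed

lemma excited_soliton:
  assumes t: "\<tau> > 1"
  obtains a1 b1 a2 b2 where "soliton \<tau> 1 a1 b1 a2 b2"
    "half_sq (cr a1) + half_sq (cr a2) = excited_mass \<tau>"
proof -
  have s: "sin (angle \<tau>) > 0" using angle(4,5)[OF t] by (intro sin_gt_zero) auto
  obtain a1 b1 a2 b2 where S: "soliton \<tau> 1 a1 b1 a2 b2" "sgn (b2 0) = sgn (- sin (angle \<tau>))"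
    by (rule soliton_exists[OF t zero_less_one, of "- sin (angle \<tau>)"]) (use s in auto)
  then have "\<not> b2 0 > 0" using s by (auto simp: sgn_if split: if_splits)
  then show ?thesis using soliton_mass(2)[OF t S(1)] that[OF S(1)] by simp
qed

lemma Lp_norm_2_AE_0:
  assumes "AE x in lebesgue. u x = 0"
  shows "(Lp_norm 2 UNIV u)\<^sup>2 = 0"
proof -
  have "AE x in lebesgue. (norm (u x))\<^sup>2 = 0" using assms by eventually_elim simp
  then show ?thesis
    unfolding Lp_norm_2_sq set_lebesgue_integral_def by (simp add: integral_eq_zero_AE)
qed

text \<open>The supremum is a maximum: on the ground state soliton the sextic term is three times
  the gradient term, which saturates the sharp inequality at the critical mass.\<close>

lemma K_GN_eq:
  assumes t: "\<tau> > 1"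
  shows "K_GN \<tau> = 3 / (crit_mass \<tau>)\<^sup>2"
  unfolding K_GN_def
proof (rule cSup_eq_maximum)
  have cm: "crit_mass \<tau> > 0" by (rule crit_mass_pos[OF t])
  obtain a1 b1 a2 b2 where S: "soliton \<tau> 1 a1 b1 a2 b2" and m: "half_sq (cr a1) + half_sq (cr a2) = crit_mass \<tau>"
    by (rule ground_soliton[OF t zero_less_one])
  define u where "u = glue (cr a1) (cr a2)"
  note G = soliton_glue[OF S, folded u_def]
  have M: "(Lp_norm 2 UNIV u)\<^sup>2 = crit_mass \<tau>" using m rep_mass[OF G(1)] by simp
  have 4: "(Lp_norm 2 UNIV u) ^ 4 = ((Lp_norm 2 UNIV u)\<^sup>2)\<^sup>2" by (simp flip: power_mult)
  have g: "grad_sq u = crit_mass \<tau> / 2" using soliton_energy(2)[OF S] m rep_grad[OF G(1)] by simp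
  have s: "(Lp_norm 6 UNIV u) ^ 6 = 3 * grad_sq u"
    using soliton_energy(1)[OF S] rep_grad[OF G(1)] rep_six[OF G(1)] by simp
  have "\<not> (AE x in lebesgue. u x = 0)" using Lp_norm_2_AE_0 M cm by force
  moreover have "(Lp_norm 6 UNIV u) ^ 6 / (grad_sq u * (Lp_norm 2 UNIV u) ^ 4) = 3 / (crit_mass \<tau>)\<^sup>2"
    unfolding s 4 M using g cm by simp
  ultimately show "3 / (crit_mass \<tau>)\<^sup>2 \<in> (\<lambda>u. (Lp_norm 6 UNIV u) ^ 6 / (grad_sq u * (Lp_norm 2 UNIV u) ^ 4)) `
      {u \<in> Dspace \<tau>. \<not> (AE x in lebesgue. u x = 0)}"
    using G(2) by (intro image_eqI[of _ _ u]) auto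
  fix y assume "y \<in> (\<lambda>u. (Lp_norm 6 UNIV u) ^ 6 / (grad_sq u * (Lp_norm 2 UNIV u) ^ 4)) `
      {u \<in> Dspace \<tau>. \<not> (AE x in lebesgue. u x = 0)}"
  then obtain v where v: "v \<in> Dspace \<tau>" and y: "y = (Lp_norm 6 UNIV v) ^ 6 / (grad_sq v * (Lp_norm 2 UNIV v) ^ 4)"
    by auto
  have n: "grad_sq v * (Lp_norm 2 UNIV v) ^ 4 \<ge> 0" using grad_sq_nonneg[of v] by (intro mult_nonneg_nonneg) auto
  show "y \<le> 3 / (crit_mass \<tau>)\<^sup>2"
  proof (cases "grad_sq v * (Lp_norm 2 UNIV v) ^ 4 = 0")
    \<comment> \<open>Division by zero yields 0, so a vanishing denominator makes the bound
      trivial.\<close>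
    case True
    then show ?thesis unfolding y True by simp
  next
    case False
    then have "grad_sq v * (Lp_norm 2 UNIV v) ^ 4 > 0" using n by linarith
    then show ?thesis
      using Dspace_sharp_inequality[OF t v] unfolding y by (simp only: pos_divide_le_eq mult.assoc)
  qed
qed

lemma mu_star_eq:
  assumes "\<tau> > 1"
  shows "mu_star \<tau> = crit_mass \<tau>"
  using crit_mass_pos[OF assms] by (simp add: mu_star_def K_GN_eq[OF assms])

section \<open>Energy bounds and the infimum\<close>

lemma E0_lower_bound:
  assumes t: "\<tau> > 1" and v: "v \<in> Dmass \<tau> \<mu>"
  shows "E0 v \<ge> grad_sq v / 2 * (1 - (\<mu> / crit_mass \<tau>)\<^sup>2)"
proof -
  have v': "v \<in> Dspace \<tau>" "(Lp_norm 2 UNIV v)\<^sup>2 = \<mu>" using v by (auto simp: Dmass_def)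
  have "(Lp_norm 2 UNIV v) ^ 4 = \<mu>\<^sup>2" unfolding v'(2)[symmetric] by (simp flip: power_mult)
  then have "(Lp_norm 6 UNIV v) ^ 6 \<le> 3 / (crit_mass \<tau>)\<^sup>2 * grad_sq v * \<mu>\<^sup>2"
    using Dspace_sharp_inequality[OF t v'(1)] by simp
  moreover have "3 / (crit_mass \<tau>)\<^sup>2 * grad_sq v * \<mu>\<^sup>2 = 3 * grad_sq v * (\<mu> / crit_mass \<tau>)\<^sup>2"
    by (simp add: power_divide)
  ultimately show ?thesis unfolding E0_def by (simp add: right_diff_distrib)
qed

lemma E0_nonneg:
  assumes t: "\<tau> > 1" and \<mu>: "0 < \<mu>" "\<mu> \<le> crit_mass \<tau>" and v: "v \<in> Dmass \<tau> \<mu>"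
  shows "E0 v \<ge> 0"
proof -
  have "\<mu> / crit_mass \<tau> \<le> 1" "0 \<le> \<mu> / crit_mass \<tau>" using \<mu> by auto
  then have "(\<mu> / crit_mass \<tau>)\<^sup>2 \<le> 1" by (simp add: power_le_one)
  then have "grad_sq v / 2 * (1 - (\<mu> / crit_mass \<tau>)\<^sup>2) \<ge> 0"
    using grad_sq_nonneg[of v] by (intro mult_nonneg_nonneg) auto
  then show ?thesis using E0_lower_bound[OF t v] by linarith
qed

text \<open>Put r = \<mu> / \<open>crit_mass \<tau>\<close>. Scaling the amplitude of the frequency
  1 soliton by sqrt r multiplies its gradient term \<open>crit_mass \<tau>\<close> / 2 by r and its
  sextic term, three times as large, by r^3.\<close>

definition energy_rate :: "real \<Rightarrow> real \<Rightarrow> real" where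
  "energy_rate \<tau> \<mu> = crit_mass \<tau> / 4 * (\<mu> / crit_mass \<tau> - (\<mu> / crit_mass \<tau>) ^ 3)"

text \<open>Varying the frequency \<open>lam\<close> dilates the soliton at constant mass; the amplitude then adjusts the
  mass to \<open>\<mu>\<close>. The energy is therefore linear in \<open>lam\<close>, with the sign of \<open>energy_rate\<close>.\<close>

lemma scaled_soliton:
  assumes t: "\<tau> > 1" and \<mu>: "\<mu> > 0" and l: "lam > 0"
  obtains v where "v \<in> Dmass \<tau> \<mu>" "E0 v = lam * energy_rate \<tau> \<mu>"
proof -
  have cm: "crit_mass \<tau> > 0" by (rule crit_mass_pos[OF t])
  obtain a1 b1 a2 b2 where S: "soliton \<tau> lam a1 b1 a2 b2" and m: "half_sq (cr a1) + half_sq (cr a2) = crit_mass \<tau>"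
    by (rule ground_soliton[OF t l])
  define r where "r = \<mu> / crit_mass \<tau>"
  define c where "c = complex_of_real (sqrt r)"
  have r: "r > 0" using \<mu> cm by (simp add: r_def)
  have nc: "(norm c)\<^sup>2 = r" using r by (simp add: c_def)
  have "(norm c) ^ 6 = ((norm c)\<^sup>2) ^ 3" by (simp flip: power_mult)
  then have nc6: "(norm c) ^ 6 = r ^ 3" by (simp add: nc)
  note G = soliton_glue[OF S]
  note R = rep_cmult[OF G(1), of c]
  let ?v = "\<lambda>x. c * glue (cr a1) (cr a2) x"
  have "?v \<in> Dspace \<tau>" using G(2) unfolding rep_Dspace[OF R] rep_Dspace[OF G(1)] by simp
  moreover have "(Lp_norm 2 UNIV ?v)\<^sup>2 = \<mu>"
    unfolding rep_mass[OF R] half_sq_cmult nc distrib_left[symmetric] m using cm by (simp add: r_def)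
  ultimately have v: "?v \<in> Dmass \<tau> \<mu>" by (simp add: Dmass_def)
  have "E0 ?v = 1 / 2 * (r * (half_sq (cr b1) + half_sq (cr b2))) - 1 / 6 * (r ^ 3 * (half_six (cr a1) + half_six (cr a2)))"
    unfolding rep_E0[OF R] half_sq_cmult half_six_cmult nc nc6 by (simp add: distrib_left)
  also have "\<dots> = lam * energy_rate \<tau> \<mu>"
    unfolding soliton_energy(1)[OF S] unfolding soliton_energy(2)[OF S] m
    by (simp add: energy_rate_def r_def[symmetric] algebra_simps)
  finally show ?thesis using that v by blast
qed

lemma energy_rate_nonneg:
  assumes t: "\<tau> > 1" and \<mu>: "0 < \<mu>" "\<mu> \<le> crit_mass \<tau>"
  shows "energy_rate \<tau> \<mu> \<ge> 0"
proof -
  have cm: "crit_mass \<tau> > 0" by (rule crit_mass_pos[OF t])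
  define r where "r = \<mu> / crit_mass \<tau>"
  have "0 \<le> r" "r \<le> 1" using \<mu> cm by (auto simp: r_def)
  then have "r ^ 3 \<le> r ^ 1" by (intro power_decreasing) auto
  then show ?thesis using cm by (simp add: energy_rate_def r_def[symmetric])
qed

lemma energy_rate_neg:
  assumes t: "\<tau> > 1" and \<mu>: "\<mu> > crit_mass \<tau>"
  shows "energy_rate \<tau> \<mu> < 0"
proof -
  have cm: "crit_mass \<tau> > 0" by (rule crit_mass_pos[OF t])
  define r where "r = \<mu> / crit_mass \<tau>"
  have "r > 1" using \<mu> cm by (simp add: r_def)
  then have "r ^ 1 < r ^ 3" by (intro power_strict_increasing) auto
  then show ?thesis using cm by (simp add: energy_rate_def r_def[symmetric] mult_pos_neg)
qed

lemma unbounded_below: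
  assumes t: "\<tau> > 1" and \<mu>: "\<mu> > crit_mass \<tau>"
  obtains v where "v \<in> Dmass \<tau> \<mu>" "E0 v < B"
proof -
  note e = energy_rate_neg[OF t \<mu>]
  define lam where "lam = (\<bar>B\<bar> + 1) / (- energy_rate \<tau> \<mu>)"
  have l: "lam > 0" unfolding lam_def using e by (intro divide_pos_pos) auto
  have \<mu>0: "\<mu> > 0" using \<mu> crit_mass_pos[OF t] by linarith
  obtain v where "v \<in> Dmass \<tau> \<mu>" "E0 v = lam * energy_rate \<tau> \<mu>" by (rule scaled_soliton[OF t \<mu>0 l])
  moreover have "lam * energy_rate \<tau> \<mu> = - (\<bar>B\<bar> + 1)" using e by (simp add: lam_def)
  ultimately show ?thesis using that[of v] by simp
qed

lemma small_energy:
  assumes t: "\<tau> > 1" and \<mu>: "0 < \<mu>" "\<mu> \<le> crit_mass \<tau>" and e: "e > 0"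
  obtains v where "v \<in> Dmass \<tau> \<mu>" "E0 v \<le> e"
proof -
  note n = energy_rate_nonneg[OF t \<mu>]
  \<comment> \<open>The added 1 covers the critical mass, where the rate is 0.\<close>
  define lam where "lam = e / (energy_rate \<tau> \<mu> + 1)"
  have l: "lam > 0" unfolding lam_def using e n by (intro divide_pos_pos) auto
  obtain v where v: "v \<in> Dmass \<tau> \<mu>" "E0 v = lam * energy_rate \<tau> \<mu>" by (rule scaled_soliton[OF t \<mu>(1) l])
  have "lam * energy_rate \<tau> \<mu> \<le> lam * (energy_rate \<tau> \<mu> + 1)" using l by (intro mult_left_mono) auto
  also have "\<dots> = e" using n by (simp add: lam_def)
  finally show ?thesis using that v by simp
qed

lemma inf_energy_eq:
  assumes t: "\<tau> > 1" and \<mu>: "\<mu> > 0"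
  shows "inf_energy \<tau> \<mu> = (if \<mu> \<le> crit_mass \<tau> then 0 else - \<infinity>)"
proof (cases "\<mu> \<le> crit_mass \<tau>")
  case True
  have "inf_energy \<tau> \<mu> \<le> 0"
  proof (rule ereal_le_epsilon2)
    fix e :: real assume "e > 0"
    then obtain v where "v \<in> Dmass \<tau> \<mu>" "E0 v \<le> e" using small_energy[OF t \<mu> True] by blast
    then show "inf_energy \<tau> \<mu> \<le> 0 + ereal e" unfolding inf_energy_def by (auto intro: INF_lower2)
  qed
  moreover have "inf_energy \<tau> \<mu> \<ge> 0"
    unfolding inf_energy_def using E0_nonneg[OF t \<mu> True] by (intro INF_greatest) auto
  ultimately show ?thesis using True by simp
next
  case False
  have "inf_energy \<tau> \<mu> = - \<infinity>"
  proof (rule ereal_bot)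
    fix B :: real
    obtain v where "v \<in> Dmass \<tau> \<mu>" "E0 v < B" using unbounded_below[OF t] False by (metis not_le)
    then show "inf_energy \<tau> \<mu> \<le> ereal B" unfolding inf_energy_def by (auto intro!: INF_lower2[of v])
  qed
  then show ?thesis using False by simp
qed

section \<open>Ground states and further stationary states\<close>

lemma half_six_eq_0:
  assumes H: "H1_half f g" and z: "half_six f = 0"
  shows "half_sq f = 0"
proof -
  have "AE x in halfline. norm (f x) ^ 6 = 0"
    using z H1_half_power6[OF H] unfolding half_six_def by (subst (asm) integral_nonneg_eq_0_iff_AE) auto
  then have "AE x in halfline. (norm (f x))\<^sup>2 = 0" by eventually_elim simp
  then show ?thesis unfolding half_sq_def by (rule integral_eq_zero_AE)
qed

text \<open>Above the critical mass the energy has no lower bound. Below it a minimizer has energy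
  at most 0, so the strict lower bound forces its gradient to vanish; the sharp inequality then
  kills its sextic norm and with it the mass.\<close>

lemma ground_state_mass:
  assumes t: "\<tau> > 1" and \<mu>: "\<mu> > 0" and g: "ground_state \<tau> \<mu> u"
  shows "\<mu> = crit_mass \<tau>"
proof (rule ccontr)
  assume ne: "\<mu> \<noteq> crit_mass \<tau>"
  have u: "u \<in> Dmass \<tau> \<mu>" and min: "\<And>v. v \<in> Dmass \<tau> \<mu> \<Longrightarrow> E0 u \<le> E0 v"
    using g by (auto simp: ground_state_def)
  have cm: "crit_mass \<tau> > 0" by (rule crit_mass_pos[OF t])
  show False
  proof (cases "\<mu> < crit_mass \<tau>")
    case False
    then obtain v where "v \<in> Dmass \<tau> \<mu>" "E0 v < E0 u" using unbounded_below[OF t] ne by (metis linorder_neqE)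
    then show False using min[of v] by simp
  next
    case True
    have "E0 u \<le> 0"
    proof (rule field_le_epsilon)
      fix e :: real assume "e > 0"
      then obtain v where "v \<in> Dmass \<tau> \<mu>" "E0 v \<le> e" using small_energy[OF t \<mu>] True by (metis less_imp_le)
      then show "E0 u \<le> 0 + e" using min[of v] by simp
    qed
    then have le: "grad_sq u / 2 * (1 - (\<mu> / crit_mass \<tau>)\<^sup>2) \<le> 0" using E0_lower_bound[OF t u] by linarith
    have "\<mu> / crit_mass \<tau> < 1" "0 \<le> \<mu> / crit_mass \<tau>" using True \<mu> cm by auto
    then have "(\<mu> / crit_mass \<tau>)\<^sup>2 < 1" by (simp add: abs_square_less_1)
    then have "grad_sq u \<le> 0" using le by (simp add: mult_le_0_iff)
    then have g0: "grad_sq u = 0" using grad_sq_nonneg[of u] by linarith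
    have u': "u \<in> Dspace \<tau>" "(Lp_norm 2 UNIV u)\<^sup>2 = \<mu>" using u by (auto simp: Dmass_def)
    obtain f1 g1 f2 g2 where R: "rep u f1 g1 f2 g2" using Dspace_rep[OF u'(1)] by metis
    have "half_six f1 + half_six f2 \<le> 0"
      using Dspace_sharp_inequality[OF t u'(1)] g0 rep_six[OF R] by simp
    then have "half_six f1 = 0" "half_six f2 = 0"
      using half_six_nonneg[of f1] half_six_nonneg[of f2] by auto
    then have "half_sq f1 = 0" "half_sq f2 = 0"
      using half_six_eq_0 R unfolding rep_def by blast+
    then show False using rep_mass[OF R] u'(2) \<mu> by simp
  qed
qed

lemma zero_energy_ground_state:
  assumes t: "\<tau> > 1" and u: "u \<in> Dmass \<tau> (crit_mass \<tau>)" and p: "positive_fun u" and z: "E0 u = 0"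
  shows "ground_state \<tau> (crit_mass \<tau>) u"
proof -
  have "nonneg_fun u" using p unfolding positive_fun_def nonneg_fun_def by (auto intro: less_imp_le)
  moreover have "E0 u \<le> E0 v" if "v \<in> Dmass \<tau> (crit_mass \<tau>)" for v
    using E0_nonneg[OF t crit_mass_pos[OF t] order_refl that] z by simp
  ultimately show ?thesis using u by (simp add: ground_state_def)
qed

lemma ground_state_exists:
  assumes t: "\<tau> > 1"
  obtains u where "ground_state \<tau> (crit_mass \<tau>) u" "E0 u = 0"
proof -
  obtain a1 b1 a2 b2 where S: "soliton \<tau> 1 a1 b1 a2 b2" and m: "half_sq (cr a1) + half_sq (cr a2) = crit_mass \<tau>"
    by (rule ground_soliton[OF t zero_less_one])
  note G = soliton_glue[OF S]
  have "glue (cr a1) (cr a2) \<in> Dmass \<tau> (crit_mass \<tau>)"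
    using G(2) m rep_mass[OF G(1)] by (simp add: Dmass_def)
  from zero_energy_ground_state[OF t this G(3) soliton_E0[OF S G(1)]] soliton_E0[OF S G(1)]
  show ?thesis by (rule that)
qed

text \<open>At the critical mass the minimum of the energy is 0, and zero energy at that mass is
  precisely equality in the sharp inequality.\<close>

lemma ground_state_optimizer:
  assumes t: "\<tau> > 1" and \<mu>: "\<mu> > 0" and g: "ground_state \<tau> \<mu> u"
  shows "(Lp_norm 6 UNIV u) ^ 6 = K_GN \<tau> * grad_sq u * (Lp_norm 2 UNIV u) ^ 4"
proof -
  have cm: "crit_mass \<tau> > 0" by (rule crit_mass_pos[OF t])
  have m: "\<mu> = crit_mass \<tau>" by (rule ground_state_mass[OF t \<mu> g])
  have u: "u \<in> Dmass \<tau> \<mu>" and min: "\<And>v. v \<in> Dmass \<tau> \<mu> \<Longrightarrow> E0 u \<le> E0 v"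
    using g by (auto simp: ground_state_def)
  obtain q where "ground_state \<tau> (crit_mass \<tau>) q" "E0 q = 0" by (rule ground_state_exists[OF t])
  then have "E0 u \<le> 0" using min[of q] m by (auto simp: ground_state_def)
  moreover have "E0 u \<ge> 0" using E0_nonneg[OF t \<mu> _ u] m by simp
  ultimately have "(Lp_norm 6 UNIV u) ^ 6 = 3 * grad_sq u" unfolding E0_def by simp
  moreover have "(Lp_norm 2 UNIV u) ^ 4 = (crit_mass \<tau>)\<^sup>2"
  proof -
    have "(Lp_norm 2 UNIV u)\<^sup>2 = crit_mass \<tau>" using u m by (simp add: Dmass_def)
    then show ?thesis by (metis mult_2 numeral_Bit0 power_add power2_eq_square)
  qed
  ultimately show ?thesis using cm by (simp add: K_GN_eq[OF t])
qed

lemma excited_mass_neq: "\<tau> > 1 \<Longrightarrow> excited_mass \<tau> \<noteq> crit_mass \<tau>"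
  using angle(5)[of \<tau>] by (simp add: excited_mass_def crit_mass_def)

text \<open>The excited soliton also has zero energy, so energy cannot tell it from a ground state.
  What does is the mass: it differs from the critical one, and there no ground state exists at
  all.\<close>

lemma further_stationary_states:
  assumes t: "\<tau> > 1" and \<mu>: "\<mu> > 0"
  shows "(\<exists>u. stationary_state \<tau> \<mu> u \<and> positive_fun u \<and> \<not> ground_state \<tau> \<mu> u) \<longleftrightarrow> \<mu> = excited_mass \<tau>"
proof
  assume "\<exists>u. stationary_state \<tau> \<mu> u \<and> positive_fun u \<and> \<not> ground_state \<tau> \<mu> u"
  then obtain u where u: "stationary_state \<tau> \<mu> u" "positive_fun u" "\<not> ground_state \<tau> \<mu> u" by blast
  obtain lam a1 b1 a2 b2 where S: "soliton \<tau> lam a1 b1 a2 b2" and R: "rep u (cr a1) (cr b1) (cr a2) (cr b2)"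
    by (rule positive_stationary_soliton[OF u(1) \<mu> u(2)])
  have D: "u \<in> Dmass \<tau> \<mu>" using u(1) by (simp add: stationary_state_def)
  then have "\<mu> = half_sq (cr a1) + half_sq (cr a2)" using rep_mass[OF R] by (simp add: Dmass_def)
  then have "\<mu> = crit_mass \<tau> \<or> \<mu> = excited_mass \<tau>" using soliton_mass(2)[OF t S] by presburger
  moreover have "\<mu> \<noteq> crit_mass \<tau>"
    using zero_energy_ground_state[OF t _ u(2) soliton_E0[OF S R]] D u(3) by blast
  ultimately show "\<mu> = excited_mass \<tau>" by blast
next
  assume m: "\<mu> = excited_mass \<tau>"
  obtain a1 b1 a2 b2 where S: "soliton \<tau> 1 a1 b1 a2 b2" and m': "half_sq (cr a1) + half_sq (cr a2) = excited_mass \<tau>"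
    by (rule excited_soliton[OF t])
  note G = soliton_glue[OF S]
  let ?u = "glue (cr a1) (cr a2)"
  have "?u \<in> Dmass \<tau> \<mu>" using G(2) m m' rep_mass[OF G(1)] by (simp add: Dmass_def)
  then have "stationary_state \<tau> \<mu> ?u" by (rule weak_eq_imp_stationary[OF G(1) _ soliton_weak_eq[OF S]])
  moreover have "\<not> ground_state \<tau> \<mu> ?u"
    using ground_state_mass[OF t \<mu>] excited_mass_neq[OF t] m by metis
  ultimately show "\<exists>u. stationary_state \<tau> \<mu> u \<and> positive_fun u \<and> \<not> ground_state \<tau> \<mu> u" using G(3) by blast
qed

theorem theorem2p2:
  fixes \<tau> \<mu> :: real
  assumes "\<tau> > 1" and "\<mu> > 0"
  shows
    "(inf_energy \<tau> \<mu> = (if \<mu> \<le> mu_star \<tau> then 0 else - \<infinity>)) \<and>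
     (((\<exists>u. ground_state \<tau> \<mu> u) \<longleftrightarrow> \<mu> = mu_star \<tau>) \<and>
      (\<forall>u\<in>Dspace \<tau>. (Lp_norm 6 UNIV u) ^ 6 \<le> K_GN \<tau> * grad_sq u * (Lp_norm 2 UNIV u) ^ 4) \<and>
      (\<forall>u. ground_state \<tau> \<mu> u \<longrightarrow>
         (Lp_norm 6 UNIV u) ^ 6 = K_GN \<tau> * grad_sq u * (Lp_norm 2 UNIV u) ^ 4) \<and>
      mu_star \<tau> = sqrt 3 / 2 * (pi / 2 + 2 * arcsin (1 / sqrt (1 + \<tau> ^ 4)))) \<and>
     ((\<exists>u. stationary_state \<tau> \<mu> u \<and> positive_fun u \<and> \<not> ground_state \<tau> \<mu> u) \<longleftrightarrow>
        \<mu> = sqrt 3 / 2 * (3 * pi / 2 - 2 * arcsin (1 / sqrt (1 + \<tau> ^ 4))))"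
proof (intro conjI)
  note t = assms(1)
  show "inf_energy \<tau> \<mu> = (if \<mu> \<le> mu_star \<tau> then 0 else - \<infinity>)"
    unfolding mu_star_eq[OF t] by (rule inf_energy_eq[OF assms])
  show "(\<exists>u. ground_state \<tau> \<mu> u) \<longleftrightarrow> \<mu> = mu_star \<tau>"
    unfolding mu_star_eq[OF t] using ground_state_mass[OF assms] ground_state_exists[OF t] by metis
  show "\<forall>u\<in>Dspace \<tau>. (Lp_norm 6 UNIV u) ^ 6 \<le> K_GN \<tau> * grad_sq u * (Lp_norm 2 UNIV u) ^ 4"
    unfolding K_GN_eq[OF t] using Dspace_sharp_inequality[OF t] by blast
  show "\<forall>u. ground_state \<tau> \<mu> u \<longrightarrow>
      (Lp_norm 6 UNIV u) ^ 6 = K_GN \<tau> * grad_sq u * (Lp_norm 2 UNIV u) ^ 4"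
    using ground_state_optimizer[OF assms] by blast
  show "mu_star \<tau> = sqrt 3 / 2 * (pi / 2 + 2 * arcsin (1 / sqrt (1 + \<tau> ^ 4)))"
    unfolding mu_star_eq[OF t] crit_mass_def angle_def ..
  show "(\<exists>u. stationary_state \<tau> \<mu> u \<and> positive_fun u \<and> \<not> ground_state \<tau> \<mu> u) \<longleftrightarrow>
      \<mu> = sqrt 3 / 2 * (3 * pi / 2 - 2 * arcsin (1 / sqrt (1 + \<tau> ^ 4)))"
    unfolding further_stationary_states[OF assms] excited_mass_def angle_def ..
qed

end
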